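(* If a H\"older triangle $T$ is combinatorially normally embedded, then it is normally embedded.
   Context: Fix a polynomially bounded o-minimal structure over $\mathbb R$ with field of exponents $\mathbb F$. All sets are germs at the origin of $\mathbb R^N$, definable in this structure. The outer metric on $X$ is $|x-y|$; the inner metric is the length of a shortest path in $X$; $X$ is normally embedded if these metrics are equivalent. For $\beta\in\mathbb F_{\ge1}$, a $\beta$-H\"older triangle is a set inner bi-Lipschitz homeomorphic to $\{(u,v)\in\mathbb R^2:u\ge0,\ 0\le v\le u^\beta\}$; its boundary arcs correspond to $\{v=0\}$ and $\{v=u^\beta\}$; $T=T(\gamma_1,\gamma_2)$ means that $\gamma_1,\gamma_2$ are the boundary arcs. An arc is a germ of a map $\gamma:[0,\epsilon)\to\mathbb R^N$, $\gamma(0)=0$, $|\gamma(t)|=t$, identified with its image. The tangency order $tord(\gamma,\gamma')$ is the exponent $q$ with $|\gamma(t)-\gamma'(t)|=ct^q+o(t^q)$, $c\neq0$ ($\infty$ if $\gamma=\gamma'$), and $tord(\gamma,X)=\sup tord(\gamma,\lambda)$ over all arcs $\lambda\subset X$. Two normally embedded H\"older triangles $T$ and $T'$ are transverse if there is a boundary arc $\tilde\lambda$ of $T$ and a boundary arc $\tilde\lambda'$ of $T'$ such that $tord(\tilde\lambda,\gamma')=tord(\gamma',T)$ for any arc $\gamma'$ of $T'$ and $tord(\tilde\lambda',\gamma)=tord(\gamma,T')$ for any arc $\gamma$ of $T$. (Two transverse triangles either are disjoint or have a common boundary arc $\lambda$, and in the latter case $\tilde\lambda=\tilde\lambda'=\lambda$.)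 Let $T=\bigcup T_i$ be a H\"older triangle decomposed into (finitely many) normally embedded subtriangles $T_i=T(\lambda_{i-1},\lambda_i)$ such that $T_i\cap T_{i+1}=\lambda_i$. $T$ is combinatorially normally embedded if any two triangles $T_i$ and $T_j$ are transverse and $tord(\lambda_i,\lambda_j)=\min(tord(\lambda_i,\lambda_k),tord(\lambda_k,\lambda_j))$ for all $i<k<j$. *)

theory Defs
  imports "HOL-Analysis.Analysis" "HOL-Library.Landau_Symbols"
begin

section \<open>O-minimal structures over the real field\<close>

text \<open>
  \<open>S n\<close> is the collection of definable subsets of \<open>\<real>\<^sup>n\<close>; a point of \<open>\<real>\<^sup>n\<close> is a list of length \<open>n\<close>.
  Since \<open>S 1\<close> consists of \<^emph>\<open>all\<close> finite unions of intervals (points included), real parameters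
  are allowed. The order relation is definable from the ring operations.
\<close>

locale o_minimal_structure =
  fixes S :: "nat \<Rightarrow> real list set set"
  assumes ambient: "A \<in> S n \<Longrightarrow> A \<subseteq> {xs. length xs = n}"
    and full: "{xs. length xs = n} \<in> S n"
    and union: "A \<in> S n \<Longrightarrow> B \<in> S n \<Longrightarrow> A \<union> B \<in> S n"
    and complement: "A \<in> S n \<Longrightarrow> {xs. length xs = n} - A \<in> S n"
    and product_left: "A \<in> S n \<Longrightarrow> {x # xs | x xs. xs \<in> A} \<in> S (Suc n)"
    and product_right: "A \<in> S n \<Longrightarrow> {xs @ [x] | x xs. xs \<in> A} \<in> S (Suc n)"
    and diagonal: "i < n \<Longrightarrow> j < n \<Longrightarrow> {xs. length xs = n \<and> xs ! i = xs ! j} \<in> S n"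
    and projection: "A \<in> S (Suc n) \<Longrightarrow> butlast ` A \<in> S n"
    and graph_plus: "{[x, y, x + y] | x y. True} \<in> S 3"
    and graph_times: "{[x, y, x * y] | x y. True} \<in> S 3"
    and o_minimal: "S 1 = {(\<lambda>x. [x]) ` \<Union>\<I> | \<I>. finite \<I> \<and> (\<forall>I\<in>\<I>. is_interval I)}"

text \<open>
  The choice of an enumeration of the orthonormal basis is immaterial, because a structure
  is closed under permutation of coordinates.
\<close>

definition definable :: "(nat \<Rightarrow> real list set set) \<Rightarrow> 'a::euclidean_space set \<Rightarrow> bool" where
  "definable S A \<longleftrightarrow>
     (\<exists>bs. distinct bs \<and> set bs = Basis \<and> (\<lambda>x. map (\<lambda>b. x \<bullet> b) bs) ` A \<in> S (length bs))"

locale polynomially_bounded_o_minimal_structure = o_minimal_structure +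
  assumes polynomially_bounded:
    "\<And>f :: real \<Rightarrow> real. definable S {(t, f t) | t. True} \<Longrightarrow>
       \<exists>k::nat. \<forall>\<^sub>F t in at_top. \<bar>f t\<bar> \<le> t ^ k"

definition field_of_exponents :: "(nat \<Rightarrow> real list set set) \<Rightarrow> real set" where
  "field_of_exponents S = {r. definable S {(t, t powr r) | t. 0 < t}}"


section \<open>Germs at the origin, arcs, tangency order\<close>

text \<open>
  A germ at the origin is represented by any set in the class; arcs, tangency orders, normal
  embedding and Hoelder triangles depend on representatives only through their germs at \<open>0\<close>.
\<close>

definition germ_eq :: "'a::euclidean_space set \<Rightarrow> 'a set \<Rightarrow> bool" where
  "germ_eq X Y \<longleftrightarrow> (\<forall>\<^sub>F x in nhds 0. x \<in> X \<longleftrightarrow> x \<in> Y)"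

definition definable_germ :: "(nat \<Rightarrow> real list set set) \<Rightarrow> 'a::euclidean_space set \<Rightarrow> bool" where
  "definable_germ S X \<longleftrightarrow> (\<exists>\<epsilon>>0. definable S (X \<inter> ball 0 \<epsilon>))"

text \<open>
  Continuity of an arc near \<open>0\<close> is automatic, by the o-minimal monotonicity theorem.
\<close>

definition is_arc :: "(nat \<Rightarrow> real list set set) \<Rightarrow> (real \<Rightarrow> 'a::euclidean_space) \<Rightarrow> bool" where
  "is_arc S \<gamma> \<longleftrightarrow>
     (\<exists>\<epsilon>>0. definable S {(t, \<gamma> t) | t. 0 \<le> t \<and> t < \<epsilon>} \<and>
       \<gamma> 0 = 0 \<and> (\<forall>t. 0 \<le> t \<and> t < \<epsilon> \<longrightarrow> norm (\<gamma> t) = t))"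

text \<open>
  The condition \<open>norm (\<gamma> t) = t\<close> discards the irrelevant values of \<open>\<gamma>\<close>: if the arc is parametrized
  on \<open>[0, \<epsilon>)\<close>, then this set agrees with \<open>\<gamma> ` [0, \<epsilon>)\<close> inside the ball of radius \<open>\<epsilon>\<close>.
\<close>

definition arc_image :: "(real \<Rightarrow> 'a::euclidean_space) \<Rightarrow> 'a set" where
  "arc_image \<gamma> = {\<gamma> t | t. 0 \<le> t \<and> norm (\<gamma> t) = t}"

definition arc_in :: "(real \<Rightarrow> 'a::euclidean_space) \<Rightarrow> 'a set \<Rightarrow> bool" where
  "arc_in \<gamma> X \<longleftrightarrow> (\<forall>\<^sub>F t in at_right 0. \<gamma> t \<in> X)"

definition tord :: "(real \<Rightarrow> 'a::euclidean_space) \<Rightarrow> (real \<Rightarrow> 'a) \<Rightarrow> ereal" where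
  "tord \<gamma> \<gamma>' =
     (if \<forall>\<^sub>F t in at_right 0. \<gamma> t = \<gamma>' t then \<infinity>
      else ereal (THE q. \<exists>c. c \<noteq> 0 \<and>
        (\<lambda>t. norm (\<gamma> t - \<gamma>' t) - c * t powr q) \<in> o[at_right 0](\<lambda>t. t powr q)))"

definition tord_set ::
    "(nat \<Rightarrow> real list set set) \<Rightarrow> (real \<Rightarrow> 'a::euclidean_space) \<Rightarrow> 'a set \<Rightarrow> ereal" where
  "tord_set S \<gamma> X = (SUP \<eta>\<in>{\<eta>. is_arc S \<eta> \<and> arc_in \<eta> X}. tord \<gamma> \<eta>)"


section \<open>Inner metric and normal embedding\<close>

definition path_length :: "(real \<Rightarrow> 'a::metric_space) \<Rightarrow> ennreal" where
  "path_length g =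
     (SUP (n, t)\<in>{(n::nat, t). mono_on {..n} t \<and> t ` {..n} \<subseteq> {0..1}}.
        ennreal (\<Sum>i<n. dist (g (t i)) (g (t (Suc i)))))"

text \<open>The value is \<open>\<infinity>\<close> if no rectifiable path in \<open>X\<close> joins the two points.\<close>

definition inner_dist :: "'a::metric_space set \<Rightarrow> 'a \<Rightarrow> 'a \<Rightarrow> ennreal" where
  "inner_dist X x y =
     (INF g\<in>{g. path g \<and> path_image g \<subseteq> X \<and> pathstart g = x \<and> pathfinish g = y}. path_length g)"

text \<open>
  Paths in the representative \<open>X\<close> may leave the ball of radius \<open>\<epsilon>\<close>, but a path witnessing the
  first inequality for points close to \<open>0\<close> is short and hence stays close to \<open>0\<close>, so that
  the notion depends on the germ only.
\<close>

definition normally_embedded :: "'a::euclidean_space set \<Rightarrow> bool" where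
  "normally_embedded X \<longleftrightarrow>
     (\<exists>C>0. \<exists>\<epsilon>>0. \<forall>x\<in>X \<inter> ball 0 \<epsilon>. \<forall>y\<in>X \<inter> ball 0 \<epsilon>.
        inner_dist X x y \<le> ennreal C * ennreal (dist x y) \<and>
        ennreal (dist x y) \<le> ennreal C * inner_dist X x y)"

text \<open>
  \<open>h\<close> represents the germ of an inner bi-Lipschitz homeomorphism from the germ of \<open>X\<close>
  onto the germ of \<open>Y\<close>; \<open>U\<close> is a neighbourhood of \<open>0\<close> such that \<open>h\<close> is meaningful on \<open>X \<inter> U\<close>.
\<close>

definition inner_bilipschitz_germ ::
    "'a::euclidean_space set \<Rightarrow> 'b::euclidean_space set \<Rightarrow> 'a set \<Rightarrow> ('a \<Rightarrow> 'b) \<Rightarrow> bool" where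
  "inner_bilipschitz_germ X Y U h \<longleftrightarrow>
     open U \<and> 0 \<in> U \<and> h 0 = 0 \<and>
     (\<exists>V g. open V \<and> 0 \<in> V \<and> homeomorphism (X \<inter> U) (Y \<inter> V) h g) \<and>
     (\<exists>C>0. \<forall>x\<in>X \<inter> U. \<forall>y\<in>X \<inter> U.
        inner_dist Y (h x) (h y) \<le> ennreal C * inner_dist X x y \<and>
        inner_dist X x y \<le> ennreal C * inner_dist Y (h x) (h y))"


section \<open>Hoelder triangles\<close>

definition standard_triangle :: "real \<Rightarrow> (real \<times> real) set" where
  "standard_triangle \<beta> = {(u, v). 0 \<le> u \<and> 0 \<le> v \<and> v \<le> u powr \<beta>}"

text \<open>\<open>T\<close> is a \<open>\<beta>\<close>-Hoelder triangle with boundary arcs \<open>\<gamma>\<^sub>1\<close> and \<open>\<gamma>\<^sub>2\<close>.\<close>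

definition beta_holder_triangle ::
    "(nat \<Rightarrow> real list set set) \<Rightarrow> real \<Rightarrow> 'a::euclidean_space set \<Rightarrow>
     (real \<Rightarrow> 'a) \<Rightarrow> (real \<Rightarrow> 'a) \<Rightarrow> bool" where
  "beta_holder_triangle S \<beta> T \<gamma>\<^sub>1 \<gamma>\<^sub>2 \<longleftrightarrow>
     \<beta> \<in> field_of_exponents S \<and> 1 \<le> \<beta> \<and> definable_germ S T \<and> is_arc S \<gamma>\<^sub>1 \<and> is_arc S \<gamma>\<^sub>2 \<and>
     (\<exists>U h. inner_bilipschitz_germ (standard_triangle \<beta>) T U h \<and>
        germ_eq (h ` ({(u, v). 0 \<le> u \<and> v = 0} \<inter> U)) (arc_image \<gamma>\<^sub>1) \<and>
        germ_eq (h ` ({(u, v). 0 \<le> u \<and> v = u powr \<beta>} \<inter> U)) (arc_image \<gamma>\<^sub>2))"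

definition holder_triangle_arcs ::
    "(nat \<Rightarrow> real list set set) \<Rightarrow> 'a::euclidean_space set \<Rightarrow>
     (real \<Rightarrow> 'a) \<Rightarrow> (real \<Rightarrow> 'a) \<Rightarrow> bool" where
  "holder_triangle_arcs S T \<gamma>\<^sub>1 \<gamma>\<^sub>2 \<longleftrightarrow> (\<exists>\<beta>. beta_holder_triangle S \<beta> T \<gamma>\<^sub>1 \<gamma>\<^sub>2)"

definition holder_triangle ::
    "(nat \<Rightarrow> real list set set) \<Rightarrow> 'a::euclidean_space set \<Rightarrow> bool" where
  "holder_triangle S T \<longleftrightarrow> (\<exists>\<gamma>\<^sub>1 \<gamma>\<^sub>2. holder_triangle_arcs S T \<gamma>\<^sub>1 \<gamma>\<^sub>2)"

definition boundary_arc ::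
    "(nat \<Rightarrow> real list set set) \<Rightarrow> 'a::euclidean_space set \<Rightarrow> (real \<Rightarrow> 'a) \<Rightarrow> bool" where
  "boundary_arc S T \<gamma> \<longleftrightarrow>
     (\<exists>\<gamma>'. holder_triangle_arcs S T \<gamma> \<gamma>' \<or> holder_triangle_arcs S T \<gamma>' \<gamma>)"

definition transverse ::
    "(nat \<Rightarrow> real list set set) \<Rightarrow> 'a::euclidean_space set \<Rightarrow> 'a set \<Rightarrow> bool" where
  "transverse S T T' \<longleftrightarrow>
     holder_triangle S T \<and> normally_embedded T \<and>
     holder_triangle S T' \<and> normally_embedded T' \<and>
     (\<exists>\<mu> \<mu>'. boundary_arc S T \<mu> \<and> boundary_arc S T' \<mu>' \<and>
        (\<forall>\<gamma>'. is_arc S \<gamma>' \<and> arc_in \<gamma>' T' \<longrightarrow> tord \<mu> \<gamma>' = tord_set S \<gamma>' T) \<and>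
        (\<forall>\<gamma>. is_arc S \<gamma> \<and> arc_in \<gamma> T \<longrightarrow> tord \<mu>' \<gamma> = tord_set S \<gamma> T'))"

definition combinatorially_normally_embedded ::
    "(nat \<Rightarrow> real list set set) \<Rightarrow> 'a::euclidean_space set \<Rightarrow> bool" where
  "combinatorially_normally_embedded S T \<longleftrightarrow>
     (\<exists>(n::nat) Ts ls. 1 \<le> n \<and>
        germ_eq T (\<Union>i\<in>{1..n}. Ts i) \<and>
        (\<forall>i\<in>{1..n}. holder_triangle_arcs S (Ts i) (ls (i - 1)) (ls i) \<and> normally_embedded (Ts i)) \<and>
        (\<forall>i\<in>{1..<n}. germ_eq (Ts i \<inter> Ts (i + 1)) (arc_image (ls i))) \<and>
        (\<forall>i\<in>{1..n}. \<forall>j\<in>{1..n}. i \<noteq> j \<longrightarrow> transverse S (Ts i) (Ts j)) \<and>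
        (\<forall>i k j. i < k \<and> k < j \<and> j \<le> n \<longrightarrow>
           tord (ls i) (ls j) = min (tord (ls i) (ls k)) (tord (ls k) (ls j))))"

end

theory Submission
  imports Defs
begin

text \<open>
  Let \<open>x\<close> and \<open>y\<close> be points of \<open>T\<close> near the origin. If they lie in the same triangle \<open>Ts i\<close>, then a short
  path exists because \<open>Ts i\<close> is normally embedded. If \<open>x\<close> lies in \<open>Ts i\<close> and \<open>y\<close> in \<open>Ts j\<close> with \<open>i < j\<close>,
  then transversality provides boundary arcs \<open>\<mu>\<close> of \<open>Ts i\<close> and \<open>\<mu>'\<close> of \<open>Ts j\<close>, and the path goes from \<open>x\<close>
  within \<open>Ts i\<close> to \<open>\<mu> (norm x)\<close>, from there along the chain of triangles to \<open>\<mu>' (norm x)\<close>, and finally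
  within \<open>Ts j\<close> to \<open>y\<close>. Each stage has a length of the order of \<open>norm (x - y)\<close>:

  \<^item> In metric terms transversality says that \<open>norm (x - \<mu>' (norm x))\<close> is at most a constant times the
    distance of \<open>x\<close> from \<open>Ts j\<close>, uniformly in \<open>x\<close>, and symmetrically for \<open>\<mu>\<close> (\<open>dist_arc_le\<close>). Hence
    \<open>x\<close>, \<open>\<mu> (norm x)\<close>, \<open>\<mu>' (norm x)\<close> and \<open>y\<close> are within a multiple of \<open>norm (x - y)\<close> of each other.
  \<^item> A Hoelder triangle has only two boundary arcs, up to germs (\<open>boundary_arc_cases\<close>); this is invariance
    of domain. So \<open>\<mu>\<close> and \<open>\<mu>'\<close> are arcs \<open>ls a\<close> and \<open>ls a'\<close> of the decomposition, with \<open>a \<le> a'\<close>.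
  \<^item> The condition on the tangency orders implies
    \<open>tord (ls a) (ls a') \<le> tord (ls m) (ls (Suc m))\<close> for \<open>a \<le> m < a'\<close>, so that consecutive arcs between
    \<open>ls a\<close> and \<open>ls a'\<close> are not farther apart than these two, up to a constant. The triangle between
    consecutive arcs is normally embedded, and the stages add up (\<open>arcs_short_path\<close>).

  The passage from tangency orders to uniform inequalities is where the o-minimal structure enters. If an
  inequality fails for every constant, then definable choice selects arcs along which it fails, and their
  tangency orders contradict the hypothesis. This requires three facts. The distance of two arcs is
  asymptotic to \<open>c * t powr q\<close> (\<open>definable_power_asymptotics\<close>, a theorem of C. Miller), so that tangency orders
  are meaningful and their comparison amounts to an inequality up to a constant. Arcs parametrized by the
  norm are Lipschitz with a uniform constant (\<open>arc_Lipschitz\<close>). Consequently a point of a definable germ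
  can be moved within the germ to a sphere of comparable radius at a cost proportional to the change of
  radius (\<open>definable_germ_radial\<close>), which reduces everything to points of equal norm. All of this rests on
  the dichotomy that a definable condition on \<open>t\<close> either holds for all small \<open>t > 0\<close> or fails for all small
  \<open>t > 0\<close>.
\<close>

section \<open>Calculus of definable sets and functions\<close>

definition coords :: "'a::euclidean_space list \<Rightarrow> 'a \<Rightarrow> real list" where
  "coords bs x = map (\<lambda>b. x \<bullet> b) bs"

text \<open>These maps permute, drop and duplicate coordinates; they carry the variables of a formula to those of
  its subformulas.\<close>

definition coordinate_map :: "('a::euclidean_space \<Rightarrow> 'b::euclidean_space) \<Rightarrow> bool" where
  "coordinate_map L \<longleftrightarrow> (\<forall>b\<in>Basis. \<exists>c\<in>Basis. \<forall>z. L z \<bullet> b = z \<bullet> c)"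

lemma length_coords [simp]: "length (coords bs x) = length bs"
  by (simp add: coords_def)

lemma coords_inject:
  assumes "set bs = Basis" shows "coords bs x = coords bs y \<longleftrightarrow> x = y"
  unfolding coords_def map_eq_conv assms by (rule euclidean_eq_iff[symmetric])

lemma coords_surj:
  assumes bs: "distinct bs" "set bs = (Basis :: 'a::euclidean_space set)" and len: "length xs = length bs"
  shows "\<exists>x. coords bs x = xs"
proof
  define f where "f b = the (map_of (zip bs xs) b)" for b
  have "(\<Sum>b\<in>Basis. f b *\<^sub>R b) \<bullet> bs ! i = xs ! i" if i: "i < length bs" for i
  proof -
    have "bs ! i \<in> Basis" using nth_mem[OF i] bs(2) by simp
    then have "(\<Sum>b\<in>Basis. f b *\<^sub>R b) \<bullet> bs ! i = f (bs ! i)" by simp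
    also have "\<dots> = xs ! i" using map_of_zip_nth[OF len[symmetric] bs(1), of i] i len by (simp add: f_def)
    finally show ?thesis .
  qed
  then show "coords bs (\<Sum>b\<in>Basis. f b *\<^sub>R b) = xs"
    unfolding coords_def using len by (intro nth_equalityI) simp_all
qed

lemma enumerate_Basis: obtains bs where "distinct bs" "set bs = (Basis :: 'a::euclidean_space set)"
  using finite_distinct_list[OF finite_Basis] by blast

lemma coordinate_map_id: "coordinate_map (\<lambda>z. z)"
  unfolding coordinate_map_def by blast

lemma coordinate_map_compose:
  assumes f: "coordinate_map f" and g: "coordinate_map g" shows "coordinate_map (\<lambda>z. f (g z))"
proof (unfold coordinate_map_def, intro ballI)
  fix b :: 'b assume "b \<in> Basis"
  then obtain c where c: "c \<in> Basis" "\<And>z. f z \<bullet> b = z \<bullet> c"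
    using f unfolding coordinate_map_def by blast
  obtain d where d: "d \<in> Basis" "\<And>z. g z \<bullet> c = z \<bullet> d"
    using g c(1) unfolding coordinate_map_def by blast
  show "\<exists>d\<in>Basis. \<forall>z. f (g z) \<bullet> b = z \<bullet> d" using c(2) d by auto
qed

lemma coordinate_map_fst: "coordinate_map (fst :: 'a::euclidean_space \<times> 'b::euclidean_space \<Rightarrow> 'a)"
proof (unfold coordinate_map_def, intro ballI)
  fix b :: 'a assume "b \<in> Basis"
  then show "\<exists>c\<in>Basis. \<forall>z::'a \<times> 'b. fst z \<bullet> b = z \<bullet> c"
    by (intro bexI[of _ "(b, 0)"]) (auto simp: Basis_prod_def inner_prod_def)
qed

lemma coordinate_map_snd: "coordinate_map (snd :: 'a::euclidean_space \<times> 'b::euclidean_space \<Rightarrow> 'b)"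
proof (unfold coordinate_map_def, intro ballI)
  fix b :: 'b assume "b \<in> Basis"
  then show "\<exists>c\<in>Basis. \<forall>z::'a \<times> 'b. snd z \<bullet> b = z \<bullet> c"
    by (intro bexI[of _ "(0, b)"]) (auto simp: Basis_prod_def inner_prod_def)
qed

lemma coordinate_map_inner:
  assumes "b \<in> Basis" shows "coordinate_map (\<lambda>z. z \<bullet> b)"
  using assms by (auto simp: coordinate_map_def)

lemma coordinate_map_Pair:
  assumes f: "coordinate_map f" and g: "coordinate_map g" shows "coordinate_map (\<lambda>z. (f z, g z))"
proof (unfold coordinate_map_def, intro ballI)
  fix b :: "'b \<times> 'c" assume "b \<in> Basis"
  then consider b' where "b' \<in> Basis" "b = (b', 0)" | b' where "b' \<in> Basis" "b = (0, b')"
    unfolding Basis_prod_def by blast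
  then show "\<exists>c\<in>Basis. \<forall>z. (f z, g z) \<bullet> b = z \<bullet> c"
  proof cases
    case 1
    then show ?thesis using f unfolding coordinate_map_def by (simp add: inner_prod_def)
  next
    case 2
    then show ?thesis using g unfolding coordinate_map_def by (simp add: inner_prod_def)
  qed
qed

lemmas coordinate_map_intros = coordinate_map_Pair coordinate_map_id
  coordinate_map_compose[OF coordinate_map_fst] coordinate_map_compose[OF coordinate_map_snd]
  coordinate_map_compose[OF coordinate_map_inner]

context o_minimal_structure
begin

lemma S_empty: "{} \<in> S n"
  using complement[OF full, of n] by simp

lemma S_Int: assumes "A \<in> S n" "B \<in> S n" shows "A \<inter> B \<in> S n"
proof -
  let ?U = "{xs::real list. length xs = n}"
  have "A \<inter> B = ?U - ((?U - A) \<union> (?U - B))" using ambient[OF assms(1)] by blast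
  then show ?thesis using complement union assms by metis
qed

lemma S_INT:
  assumes "finite I" "\<And>i. i \<in> I \<Longrightarrow> {xs. length xs = n \<and> P i xs} \<in> S n"
  shows "{xs. length xs = n \<and> (\<forall>i\<in>I. P i xs)} \<in> S n"
  using assms
proof (induction I)
  case empty then show ?case using full by simp
next
  case (insert i I)
  have "{xs. length xs = n \<and> (\<forall>i\<in>insert i I. P i xs)} =
      {xs. length xs = n \<and> P i xs} \<inter> {xs. length xs = n \<and> (\<forall>i\<in>I. P i xs)}" by auto
  then show ?case using insert S_Int by simp
qed

lemma S_cylinder:
  assumes "A \<in> S m" shows "{xs @ ys | xs ys. length xs = n \<and> ys \<in> A} \<in> S (n + m)"
proof (induction n)
  case 0 then show ?case using assms by simp
next
  case (Suc n)
  have "{xs @ ys | xs ys. length xs = Suc n \<and> ys \<in> A} =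
      {x # zs | x zs. zs \<in> {xs @ ys | xs ys. length xs = n \<and> ys \<in> A}}"
  proof (intro equalityI subsetI)
    fix zs assume "zs \<in> {xs @ ys | xs ys. length xs = Suc n \<and> ys \<in> A}"
    then obtain xs ys where "zs = xs @ ys" "length xs = Suc n" "ys \<in> A" by blast
    then show "zs \<in> {x # zs | x zs. zs \<in> {xs @ ys | xs ys. length xs = n \<and> ys \<in> A}}"
      by (cases xs) auto
  next
    fix zs assume "zs \<in> {x # zs | x zs. zs \<in> {xs @ ys | xs ys. length xs = n \<and> ys \<in> A}}"
    then obtain x xs ys where "zs = (x # xs) @ ys" "length (x # xs) = Suc n" "ys \<in> A" by auto
    then show "zs \<in> {xs @ ys | xs ys. length xs = Suc n \<and> ys \<in> A}" by blast
  qed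
  then show ?case using product_left[OF Suc] by simp
qed

lemma S_take: "A \<in> S (n + m) \<Longrightarrow> take n ` A \<in> S n"
proof (induction m arbitrary: A)
  case 0
  have "take n xs = xs" if "xs \<in> A" for xs using ambient[OF 0] that by auto
  then have "take n ` A = A" by simp
  then show ?case using 0 by simp
next
  case (Suc m)
  have "take n (butlast xs) = take n xs" if "xs \<in> A" for xs
  proof -
    have "length xs = n + Suc m" using ambient[OF Suc.prems] that by auto
    then show ?thesis by (simp add: butlast_conv_take)
  qed
  then have "take n ` A = take n ` butlast ` A" unfolding image_image by (intro image_cong) auto
  moreover have "butlast ` A \<in> S (n + m)" using projection[of A "n + m"] Suc.prems by simp
  ultimately show ?case using Suc.IH by metis
qed

text \<open>Substituting variables into a definable predicate, possibly with repetitions and dummy variables,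
  is an intersection with diagonals of a cylinder over it, followed by a projection.\<close>

lemma S_reindex:
  assumes A: "A \<in> S m" and \<sigma>: "\<And>i. i < m \<Longrightarrow> \<sigma> i < n"
  shows "{xs. length xs = n \<and> map (\<lambda>i. xs ! \<sigma> i) [0..<m] \<in> A} \<in> S n"
proof -
  let ?D = "{zs::real list. length zs = n + m \<and> (\<forall>i\<in>{..<m}. zs ! (n + i) = zs ! \<sigma> i)}"
  let ?C = "{xs @ ys | xs ys. length xs = n \<and> ys \<in> A}"
  have "?D \<in> S (n + m)"
  proof (rule S_INT)
    fix i assume "i \<in> {..<m}"
    then have "\<sigma> i < n + m" "n + i < n + m" using \<sigma>[of i] by auto
    then show "{zs. length zs = n + m \<and> zs ! (n + i) = zs ! \<sigma> i} \<in> S (n + m)" by (intro diagonal)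
  qed simp
  then have CD: "take n ` (?C \<inter> ?D) \<in> S n"
    by (intro S_take[where m = m] S_Int S_cylinder[OF A])
  have len: "length ys = m" if "ys \<in> A" for ys using ambient[OF A] that by auto
  have eq: "take n ` (?C \<inter> ?D) = {xs. length xs = n \<and> map (\<lambda>i. xs ! \<sigma> i) [0..<m] \<in> A}" (is "_ = ?R")
  proof (intro equalityI subsetI)
    fix xs assume "xs \<in> take n ` (?C \<inter> ?D)"
    then obtain ys where xs: "length xs = n" and ys: "ys \<in> A"
      and sub: "\<forall>i<m. (xs @ ys) ! (n + i) = (xs @ ys) ! \<sigma> i" by auto
    have "map (\<lambda>i. xs ! \<sigma> i) [0..<m] = ys"
    proof (rule nth_equalityI)
      fix i assume "i < length (map (\<lambda>i. xs ! \<sigma> i) [0..<m])"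
      then have "i < m" by simp
      then show "map (\<lambda>i. xs ! \<sigma> i) [0..<m] ! i = ys ! i"
        using sub[rule_format, of i] \<sigma>[of i] xs by (simp add: nth_append)
    qed (use len ys in simp)
    then show "xs \<in> ?R" using xs ys by simp
  next
    fix xs assume "xs \<in> ?R"
    then have xs: "length xs = n" and ys: "map (\<lambda>i. xs ! \<sigma> i) [0..<m] \<in> A" (is "?ys \<in> A") by auto
    have "xs @ ?ys \<in> ?C" using xs ys by blast
    moreover have "(xs @ ?ys) ! (n + i) = (xs @ ?ys) ! \<sigma> i" if "i < m" for i
      using that xs \<sigma>[OF that] by (simp add: nth_append)
    ultimately have "xs @ ?ys \<in> ?C \<inter> ?D" using xs by simp
    moreover have "xs = take n (xs @ ?ys)" using xs by simp
    ultimately show "xs \<in> take n ` (?C \<inter> ?D)" by (rule rev_image_eqI)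
  qed
  show ?thesis using CD unfolding eq .
qed

lemma S_coordinate_vimage:
  fixes L :: "'c::euclidean_space \<Rightarrow> 'd::euclidean_space"
  assumes L: "coordinate_map L" and cs: "distinct cs" "set cs = Basis" and ds: "set ds = Basis"
    and A: "coords ds ` A \<in> S (length ds)"
  shows "coords cs ` {z. L z \<in> A} \<in> S (length cs)"
proof -
  have "\<exists>j. j < length cs \<and> (\<forall>z. L z \<bullet> ds ! i = z \<bullet> cs ! j)" if "i < length ds" for i
  proof -
    have "ds ! i \<in> Basis" using nth_mem[OF that] unfolding ds .
    then obtain c where c: "c \<in> Basis" "\<forall>z. L z \<bullet> ds ! i = z \<bullet> c" using L unfolding coordinate_map_def by blast
    have "c \<in> set cs" using c(1) unfolding cs(2) .
    then obtain j where "j < length cs" "cs ! j = c" unfolding in_set_conv_nth by blast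
    then show ?thesis using c(2) by blast
  qed
  then obtain \<sigma> where \<sigma>: "\<And>i. i < length ds \<Longrightarrow> \<sigma> i < length cs"
      "\<And>i z. i < length ds \<Longrightarrow> L z \<bullet> ds ! i = z \<bullet> cs ! \<sigma> i" by metis
  have L_coords: "map (\<lambda>i. coords cs z ! \<sigma> i) [0..<length ds] = coords ds (L z)" for z
    using \<sigma> by (intro nth_equalityI) (simp_all add: coords_def)
  have eq: "{xs. length xs = length cs \<and> map (\<lambda>i. xs ! \<sigma> i) [0..<length ds] \<in> coords ds ` A}
      = coords cs ` {z. L z \<in> A}" (is "?R = ?r")
  proof (intro equalityI subsetI)
    fix xs assume xs: "xs \<in> ?R"
    then obtain z where z: "coords cs z = xs" using coords_surj[OF cs, of xs] by blast
    have "coords ds (L z) \<in> coords ds ` A" using xs unfolding L_coords[of z, symmetric] z by blast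
    then obtain a where "a \<in> A" "coords ds (L z) = coords ds a" by blast
    then have "L z \<in> A" using coords_inject[OF ds] by metis
    then show "xs \<in> ?r" using z by blast
  next
    fix xs assume "xs \<in> ?r"
    then obtain z where "xs = coords cs z" "L z \<in> A" by blast
    then show "xs \<in> ?R" using L_coords[of z] by simp
  qed
  show ?thesis using S_reindex[OF A, of \<sigma> "length cs", OF \<sigma>(1)] unfolding eq by blast
qed

lemma definable_coords_iff:
  fixes A :: "'a::euclidean_space set"
  assumes bs: "distinct bs" "set bs = (Basis :: 'a set)"
  shows "definable S A \<longleftrightarrow> coords bs ` A \<in> S (length bs)"
proof
  assume "definable S A"
  then obtain cs where "set cs = (Basis::'a set)" "coords cs ` A \<in> S (length cs)"
    unfolding definable_def coords_def[symmetric] coords_def[abs_def, symmetric] by blast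
  then show "coords bs ` A \<in> S (length bs)"
    using S_coordinate_vimage[OF coordinate_map_id bs, of cs A] by simp
next
  assume "coords bs ` A \<in> S (length bs)"
  then show "definable S A" unfolding definable_def coords_def[abs_def] using bs by blast
qed

text \<open>Formulas whose variables range over Euclidean spaces are read as predicates, and terms as functions, of
  the tuple of the variables. In the closure rules the formula is a higher-order pattern, so that definability
  is checked by applying \<open>dpred_intros\<close> along its syntax.\<close>

definition dpred :: "('a::euclidean_space \<Rightarrow> bool) \<Rightarrow> bool" where
  "dpred P \<longleftrightarrow> definable S {z. P z}"

definition dfun :: "('a::euclidean_space \<Rightarrow> 'b::euclidean_space) \<Rightarrow> bool" where
  "dfun f \<longleftrightarrow> dpred (\<lambda>p. snd p = f (fst p))"

lemma dpred_coordinate_map: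
  assumes "coordinate_map L" "dpred P" shows "dpred (\<lambda>z. P (L z))"
proof -
  obtain cs where cs: "distinct cs" "set cs = (Basis::'a set)" by (rule enumerate_Basis)
  obtain ds where ds: "distinct ds" "set ds = (Basis::'b set)" by (rule enumerate_Basis)
  show ?thesis using S_coordinate_vimage[OF assms(1) cs ds(2), of "{z. P z}"] assms(2)
    unfolding dpred_def definable_coords_iff[OF cs] definable_coords_iff[OF ds] by simp
qed

lemma dpred_conj: assumes "dpred P" "dpred Q" shows "dpred (\<lambda>z. P z \<and> Q z)"
proof -
  obtain bs where bs: "distinct bs" "set bs = (Basis::'a set)" by (rule enumerate_Basis)
  have "coords bs ` {z. P z \<and> Q z} = coords bs ` {z. P z} \<inter> coords bs ` {z. Q z}"
    by (auto simp: coords_inject[OF bs(2)])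
  then show ?thesis
    using S_Int[OF assms[unfolded dpred_def definable_coords_iff[OF bs]]]
    unfolding dpred_def definable_coords_iff[OF bs] by simp
qed

lemma dpred_not: assumes "dpred P" shows "dpred (\<lambda>z. \<not> P z)"
proof -
  obtain bs where bs: "distinct bs" "set bs = (Basis::'a set)" by (rule enumerate_Basis)
  have "coords bs ` {z. \<not> P z} = {xs. length xs = length bs} - coords bs ` {z. P z}"
    (is "?l = ?r")
  proof (intro equalityI subsetI)
    fix xs assume xs: "xs \<in> ?r"
    then obtain z where "coords bs z = xs" using coords_surj[OF bs, of xs] by blast
    then show "xs \<in> ?l" using xs by blast
  qed (auto simp: coords_inject[OF bs(2)])
  then show ?thesis
    using complement[OF assms[unfolded dpred_def definable_coords_iff[OF bs]]]
    unfolding dpred_def definable_coords_iff[OF bs] by simp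
qed

lemma dpred_disj: assumes "dpred P" "dpred Q" shows "dpred (\<lambda>z. P z \<or> Q z)"
  using dpred_not[OF dpred_conj[OF dpred_not[OF assms(1)] dpred_not[OF assms(2)]]] by simp

lemma dpred_imp: assumes "dpred P" "dpred Q" shows "dpred (\<lambda>z. P z \<longrightarrow> Q z)"
  using dpred_disj[OF dpred_not[OF assms(1)] assms(2)] by simp

lemma dpred_const: "dpred (\<lambda>z::'a::euclidean_space. c)"
proof -
  obtain bs where bs: "distinct bs" "set bs = (Basis::'a set)" by (rule enumerate_Basis)
  have "dpred (\<lambda>z::'a. False)" unfolding dpred_def definable_coords_iff[OF bs] using S_empty by simp
  then show ?thesis using dpred_not[of "\<lambda>z::'a. False"] by (cases c) auto
qed

lemma dpred_finite_ball:
  "finite I \<Longrightarrow> (\<And>i. i \<in> I \<Longrightarrow> dpred (\<lambda>z. P z i)) \<Longrightarrow> dpred (\<lambda>z. \<forall>i\<in>I. P z i)"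
  by (induction I rule: finite_induct) (auto intro!: dpred_const dpred_conj)

text \<open>An existential quantifier over a Euclidean space is a projection along all of its coordinates.\<close>

lemma dpred_ex:
  fixes P :: "'a::euclidean_space \<Rightarrow> 'b::euclidean_space \<Rightarrow> bool"
  assumes "dpred (\<lambda>p. P (fst p) (snd p))" shows "dpred (\<lambda>z. \<exists>w. P z w)"
proof -
  obtain bs where bs: "distinct bs" "set bs = (Basis::'a set)" by (rule enumerate_Basis)
  obtain cs where cs: "distinct cs" "set cs = (Basis::'b set)" by (rule enumerate_Basis)
  define ds where "ds = map (\<lambda>b. (b, 0::'b)) bs @ map (\<lambda>c. (0::'a, c)) cs"
  have ds: "distinct ds" "set ds = (Basis::('a \<times> 'b) set)"
    using bs cs by (auto simp: ds_def Basis_prod_def distinct_map inj_on_def)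
  have coords: "coords ds p = coords bs (fst p) @ coords cs (snd p)" for p
    by (auto simp: coords_def ds_def inner_prod_def)
  have "coords bs ` {z. \<exists>w. P z w} = take (length bs) ` coords ds ` {p. P (fst p) (snd p)}"
    (is "?l = ?r")
  proof (intro equalityI subsetI)
    fix xs assume "xs \<in> ?l"
    then obtain z w where "P z w" "xs = coords bs z" by blast
    then have "(z, w) \<in> {p. P (fst p) (snd p)}" by simp
    then have "coords ds (z, w) \<in> coords ds ` {p. P (fst p) (snd p)}" by (rule imageI)
    moreover have "xs = take (length bs) (coords ds (z, w))" using \<open>xs = _\<close> by (simp add: coords)
    ultimately show "xs \<in> ?r" by (rule rev_image_eqI)
  next
    fix xs assume "xs \<in> ?r"
    then obtain p where "P (fst p) (snd p)" "xs = coords bs (fst p)" by (auto simp: coords)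
    then show "xs \<in> ?l" by blast
  qed
  moreover have "coords ds ` {p. P (fst p) (snd p)} \<in> S (length bs + length cs)"
    using assms unfolding dpred_def definable_coords_iff[OF ds] by (simp add: ds_def)
  ultimately show ?thesis
    unfolding dpred_def definable_coords_iff[OF bs] by (simp add: S_take)
qed

lemma dpred_all:
  assumes "dpred (\<lambda>p. P (fst p) (snd p))" shows "dpred (\<lambda>z. \<forall>w. P z w)"
  using dpred_not[OF dpred_ex[OF dpred_not[OF assms]]] by simp

lemma dfun_coordinate_map: assumes "coordinate_map L" shows "dfun L"
proof -
  have diag: "dpred (\<lambda>z. z \<bullet> b = z \<bullet> c)" if "b \<in> Basis" "c \<in> Basis" for b c :: "'a \<times> 'b"
  proof -
    obtain bs where bs: "distinct bs" "set bs = (Basis::('a \<times> 'b) set)" by (rule enumerate_Basis)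
    have "b \<in> set bs" "c \<in> set bs" using that unfolding bs(2) .
    then obtain i j where i: "i < length bs" "bs ! i = b" and j: "j < length bs" "bs ! j = c"
      unfolding in_set_conv_nth by blast
    have eq: "coords bs ` {z. z \<bullet> b = z \<bullet> c} = {xs. length xs = length bs \<and> xs ! i = xs ! j}"
      (is "?l = ?r")
    proof (intro equalityI subsetI)
      fix xs assume xs: "xs \<in> ?r"
      then obtain z where z: "coords bs z = xs" using coords_surj[OF bs, of xs] by blast
      have "xs ! i = z \<bullet> b" "xs ! j = z \<bullet> c" unfolding z[symmetric] using i j by (simp_all add: coords_def)
      then have "z \<bullet> b = z \<bullet> c" using xs by simp
      then show "xs \<in> ?l" using z by blast
    next
      fix xs assume "xs \<in> ?l"
      then obtain z where "xs = coords bs z" "z \<bullet> b = z \<bullet> c" by blast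
      then show "xs \<in> ?r" using i j by (simp add: coords_def)
    qed
    show ?thesis
      unfolding dpred_def definable_coords_iff[OF bs] eq by (rule diagonal[OF i(1) j(1)])
  qed
  have "dpred (\<lambda>p. snd p \<bullet> b = L (fst p) \<bullet> b)" if b: "b \<in> Basis" for b
  proof -
    obtain c where c: "c \<in> Basis" "\<And>z. L z \<bullet> b = z \<bullet> c"
      using bspec[OF assms[unfolded coordinate_map_def] b] by blast
    have "(0, b) \<in> Basis" "(c, 0) \<in> Basis" using b c(1) by (auto simp: Basis_prod_def)
    then have "dpred (\<lambda>p. p \<bullet> (0, b) = p \<bullet> (c, 0))" by (rule diag)
    then show ?thesis unfolding c(2) by (simp add: inner_prod_def)
  qed
  then have "dpred (\<lambda>p. \<forall>b\<in>Basis. snd p \<bullet> b = L (fst p) \<bullet> b)" by (intro dpred_finite_ball finite_Basis)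
  then show ?thesis unfolding dfun_def by (simp add: euclidean_eq_iff[symmetric])
qed

lemma dpred_compose:
  assumes "dpred P" "dfun f" shows "dpred (\<lambda>z. P (f z))"
proof -
  have "dpred (\<lambda>p. snd p = f (fst p) \<and> P (snd p))"
    using assms unfolding dfun_def by (intro dpred_conj dpred_coordinate_map[OF coordinate_map_snd])
  then have "dpred (\<lambda>z. \<exists>w. w = f z \<and> P w)" by (intro dpred_ex) simp
  then show ?thesis by simp
qed

lemma dpred_mem: "definable S A \<Longrightarrow> dfun f \<Longrightarrow> dpred (\<lambda>z. f z \<in> A)"
  using dpred_compose[of "\<lambda>x. x \<in> A"] by (simp add: dpred_def)

lemma dfun_compose:
  assumes "dfun g" "dfun f" shows "dfun (\<lambda>z. g (f z))"
proof -
  have "dpred (\<lambda>q. snd q = f (fst (fst q)))"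
    using dpred_coordinate_map[OF _ assms(2)[unfolded dfun_def], of "\<lambda>q. (fst (fst q), snd q)"]
    by (simp add: coordinate_map_intros)
  moreover have "dpred (\<lambda>q. snd (fst q) = g (snd q))"
    using dpred_coordinate_map[OF _ assms(1)[unfolded dfun_def], of "\<lambda>q. (snd q, snd (fst q))"]
    by (simp add: coordinate_map_intros)
  ultimately have "dpred (\<lambda>p. \<exists>w. w = f (fst p) \<and> snd p = g w)" by (intro dpred_ex dpred_conj)
  then show ?thesis unfolding dfun_def by simp
qed

lemma dfun_id: "dfun (\<lambda>z. z)" by (intro dfun_coordinate_map coordinate_map_intros)
lemma dfun_fst: "dfun f \<Longrightarrow> dfun (\<lambda>z. fst (f z))"
  using dfun_compose[OF dfun_coordinate_map[OF coordinate_map_fst]] .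
lemma dfun_snd: "dfun f \<Longrightarrow> dfun (\<lambda>z. snd (f z))"
  using dfun_compose[OF dfun_coordinate_map[OF coordinate_map_snd]] .
lemma dfun_inner_Basis: "b \<in> Basis \<Longrightarrow> dfun f \<Longrightarrow> dfun (\<lambda>z. f z \<bullet> b)"
  using dfun_compose[OF dfun_coordinate_map[OF coordinate_map_inner]] .

lemma dfun_Pair: assumes "dfun f" "dfun g" shows "dfun (\<lambda>z. (f z, g z))"
proof -
  have "dpred (\<lambda>p. fst (snd p) = f (fst p))"
    using dpred_coordinate_map[OF _ assms(1)[unfolded dfun_def], of "\<lambda>q. (fst q, fst (snd q))"]
    by (simp add: coordinate_map_intros)
  moreover have "dpred (\<lambda>p. snd (snd p) = g (fst p))"
    using dpred_coordinate_map[OF _ assms(2)[unfolded dfun_def], of "\<lambda>q. (fst q, snd (snd q))"]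
    by (simp add: coordinate_map_intros)
  ultimately show ?thesis unfolding dfun_def using dpred_conj by (force simp: prod_eq_iff)
qed

lemma dfun_componentwise:
  assumes "\<And>b. b \<in> Basis \<Longrightarrow> dfun (\<lambda>z. f z \<bullet> b)" shows "dfun f"
proof -
  have "dpred (\<lambda>p. snd p \<bullet> b = f (fst p) \<bullet> b)" if "b \<in> Basis" for b
    using dpred_coordinate_map[OF _ assms[OF that, unfolded dfun_def], of "\<lambda>q. (fst q, snd q \<bullet> b)"] that
    by (simp add: coordinate_map_intros)
  then have "dpred (\<lambda>p. \<forall>b\<in>Basis. snd p \<bullet> b = f (fst p) \<bullet> b)" by (intro dpred_finite_ball finite_Basis)
  then show ?thesis unfolding dfun_def by (simp add: euclidean_eq_iff[symmetric])
qed

lemma definable_real_iff: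
  "definable S (A :: real set) \<longleftrightarrow> (\<exists>\<I>. A = \<Union>\<I> \<and> finite \<I> \<and> (\<forall>I\<in>\<I>. is_interval I))"
proof -
  have "definable S A \<longleftrightarrow> (\<lambda>x. [x]) ` A \<in> S 1"
    using definable_coords_iff[of "[1::real]" A] by (simp add: coords_def)
  also have "\<dots> \<longleftrightarrow> (\<exists>\<I>. A = \<Union>\<I> \<and> finite \<I> \<and> (\<forall>I\<in>\<I>. is_interval I))"
    unfolding o_minimal by (auto simp: inj_image_eq_iff inj_on_def)
  finally show ?thesis .
qed

lemma definable_interval: "is_interval I \<Longrightarrow> definable S (I :: real set)"
  unfolding definable_real_iff by (intro exI[of _ "{I}"]) auto

lemma dfun_const: "dfun (\<lambda>_. c)"
proof (rule dfun_componentwise)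
  fix b :: 'b assume "b \<in> Basis"
  have "dpred (\<lambda>p::'a \<times> real. snd p \<in> {c \<bullet> b})"
    by (intro dpred_mem definable_interval dfun_snd dfun_id) (simp add: is_interval_1)
  then show "dfun (\<lambda>_::'a. c \<bullet> b)" unfolding dfun_def by simp
qed

lemma dfun_add_mult_real:
  "dfun (\<lambda>p::real \<times> real. fst p + snd p)" "dfun (\<lambda>p::real \<times> real. fst p * snd p)"
proof -
  define bs :: "((real \<times> real) \<times> real) list" where "bs = [((1, 0), 0), ((0, 1), 0), (0, 1)]"
  have bs: "distinct bs" "set bs = Basis" by (auto simp: bs_def Basis_prod_def zero_prod_def)
  have coords: "coords bs ` {p. snd p = f (fst p)} = {[x, y, f (x, y)] | x y. True}" for f
    by (force simp: coords_def bs_def inner_prod_def image_iff)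
  show "dfun (\<lambda>p::real \<times> real. fst p + snd p)" "dfun (\<lambda>p::real \<times> real. fst p * snd p)"
    unfolding dfun_def dpred_def definable_coords_iff[OF bs]
      coords[of "\<lambda>p. fst p + snd p"] coords[of "\<lambda>p. fst p * snd p"]
    using graph_plus graph_times by (simp_all add: bs_def numeral_3_eq_3)
qed

context
  fixes f g :: "'a::euclidean_space \<Rightarrow> real"
  assumes f: "dfun f" and g: "dfun g"
begin

lemma dfun_add_real: "dfun (\<lambda>z. f z + g z)"
  using dfun_compose[OF dfun_add_mult_real(1) dfun_Pair[OF f g]] by simp

lemma dfun_mult: "dfun (\<lambda>z. f z * g z)"
  using dfun_compose[OF dfun_add_mult_real(2) dfun_Pair[OF f g]] by simp

end

lemma dfun_add: "dfun f \<Longrightarrow> dfun g \<Longrightarrow> dfun (\<lambda>z. f z + g z)"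
  by (rule dfun_componentwise) (auto simp: inner_add_left intro!: dfun_add_real dfun_inner_Basis)

lemma dfun_scaleR: "dfun f \<Longrightarrow> dfun g \<Longrightarrow> dfun (\<lambda>z. f z *\<^sub>R g z)"
  by (rule dfun_componentwise) (auto intro!: dfun_mult dfun_inner_Basis)

lemma dfun_diff: "dfun f \<Longrightarrow> dfun g \<Longrightarrow> dfun (\<lambda>z. f z - g z)"
  using dfun_add[OF _ dfun_scaleR[OF dfun_const, of g "-1"]] by simp

lemma dpred_le: fixes f g :: "_ \<Rightarrow> real" assumes "dfun f" "dfun g" shows "dpred (\<lambda>z. f z \<le> g z)"
  using dpred_mem[OF definable_interval dfun_diff[OF assms(2,1)], of "{0..}"] by simp

lemma dpred_less: fixes f g :: "_ \<Rightarrow> real" assumes "dfun f" "dfun g" shows "dpred (\<lambda>z. f z < g z)"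
  using dpred_not[OF dpred_le[OF assms(2,1)]] by (simp add: not_le)

lemma dpred_eq: assumes "dfun f" "dfun g" shows "dpred (\<lambda>z. f z = g z)"
  using dpred_compose[OF assms(1)[unfolded dfun_def] dfun_Pair[OF dfun_id assms(2)]]
  by (simp add: eq_commute)

lemma dfun_sum: "finite I \<Longrightarrow> (\<And>i. i \<in> I \<Longrightarrow> dfun (f i)) \<Longrightarrow> dfun (\<lambda>z. \<Sum>i\<in>I. f i z)"
  by (induction I rule: finite_induct) (auto intro!: dfun_const dfun_add)

lemma dfun_norm: assumes f: "dfun f" shows "dfun (\<lambda>z. norm (f z))"
proof -
  have "dfun (\<lambda>z. \<Sum>b\<in>Basis. (f z \<bullet> b) * (f z \<bullet> b))"
    by (intro dfun_sum dfun_mult dfun_inner_Basis f) auto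
  then have ip: "dfun (\<lambda>z. f z \<bullet> f z)" by (simp add: euclidean_inner[symmetric])
  have "dpred (\<lambda>p. 0 \<le> snd p \<and> snd p * snd p = f (fst p) \<bullet> f (fst p))"
    by (intro dpred_conj dpred_le dpred_eq dfun_const dfun_snd dfun_id dfun_mult
        dfun_compose[OF ip] dfun_fst)
  moreover have "0 \<le> r \<and> r * r = x \<bullet> x \<longleftrightarrow> r = norm x" for x :: 'b and r
    by (metis norm_ge_zero power2_eq_square power2_norm_eq_inner power2_eq_iff_nonneg)
  ultimately show ?thesis unfolding dfun_def by simp
qed

lemma dfun_abs: "dfun (f :: _ \<Rightarrow> real) \<Longrightarrow> dfun (\<lambda>z. \<bar>f z\<bar>)"
  using dfun_norm[of f] by simp

lemma dfun_if:
  assumes "dpred P" "dfun f" "dfun g" shows "dfun (\<lambda>z. if P z then f z else g z)"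
proof -
  have "dpred (\<lambda>p. (P (fst p) \<and> snd p = f (fst p)) \<or> (\<not> P (fst p) \<and> snd p = g (fst p)))"
    using assms unfolding dfun_def
    by (intro dpred_disj dpred_conj dpred_not dpred_compose[OF assms(1)] dfun_fst dfun_id)
  moreover have "(P (fst p) \<and> snd p = f (fst p)) \<or> (\<not> P (fst p) \<and> snd p = g (fst p)) \<longleftrightarrow>
      snd p = (if P (fst p) then f (fst p) else g (fst p))" for p by simp
  ultimately show ?thesis unfolding dfun_def by simp
qed

lemma dfun_inverse: assumes "dfun (f :: _ \<Rightarrow> real)" shows "dfun (\<lambda>z. inverse (f z))"
proof -
  have "dpred (\<lambda>p. (f (fst p) = 0 \<and> snd p = 0) \<or> (f (fst p) * snd p = 1))"
    by (intro dpred_disj dpred_conj dpred_eq dfun_mult dfun_const dfun_compose[OF assms] dfun_fst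
        dfun_snd dfun_id)
  moreover have "(a = 0 \<and> s = 0) \<or> a * s = 1 \<longleftrightarrow> s = inverse a" for a s :: real
    by (cases "a = 0") (auto simp: field_simps)
  ultimately show ?thesis unfolding dfun_def by simp
qed

lemma dfun_divide: "dfun (f :: _ \<Rightarrow> real) \<Longrightarrow> dfun g \<Longrightarrow> dfun (\<lambda>z. f z / g z)"
  using dfun_mult[OF _ dfun_inverse] by (simp add: divide_inverse)

lemmas dpred_intros = dpred_conj dpred_disj dpred_not dpred_imp dpred_ex dpred_all
  dpred_less dpred_le dpred_eq
  dfun_id dfun_fst dfun_snd dfun_norm dfun_abs dfun_add dfun_diff dfun_mult dfun_divide
  dfun_scaleR dfun_inverse dfun_Pair dfun_const

end

section \<open>Definable functions of one real variable\<close>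

lemma interval_eventually_at_right:
  assumes "is_interval (I :: real set)"
  shows "(\<forall>\<^sub>F x in at_right a. x \<in> I) \<or> (\<forall>\<^sub>F x in at_right a. x \<notin> I)"
proof (cases "\<forall>\<^sub>F x in at_right a. x \<notin> I")
  case False
  then have hit: "\<exists>x\<in>I. a < x \<and> x < b" if "a < b" for b
    using that unfolding eventually_at_right_field by blast
  obtain p where p: "p \<in> I" "a < p" using hit[of "a + 1"] by auto
  have "x \<in> I" if "a < x" "x < p" for x
    using hit[OF that(1)] that p assms unfolding is_interval_1 by (meson less_imp_le)
  then show ?thesis using p(2) unfolding eventually_at_right_field by blast
qed simp

text \<open>Continuous induction: the supremum of the points up to which \<open>g\<close> stays above \<open>g s\<close> has this property too,
  by left continuity, and cannot be less than \<open>t\<close>.\<close>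

lemma le_of_left_continuous_locally_increasing:
  fixes g :: "real \<Rightarrow> real"
  assumes "s \<le> t"
    and left: "\<And>x e. s < x \<Longrightarrow> x \<le> t \<Longrightarrow> 0 < e \<Longrightarrow> \<exists>d>0. \<forall>y. x - d < y \<and> y < x \<longrightarrow> \<bar>g y - g x\<bar> \<le> e"
    and right: "\<And>x. s \<le> x \<Longrightarrow> x < t \<Longrightarrow> \<exists>d>0. \<forall>y. x < y \<and> y < x + d \<longrightarrow> g x \<le> g y"
  shows "g s \<le> g t"
proof -
  define A where "A = {x. s \<le> x \<and> x \<le> t \<and> (\<forall>y. s \<le> y \<and> y \<le> x \<longrightarrow> g s \<le> g y)}"
  define c where "c = Sup A"
  have sA: "s \<in> A" using assms(1) unfolding A_def by (auto intro: antisym)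
  have bdd: "bdd_above A" by (rule bdd_aboveI[of _ t]) (auto simp: A_def)
  have sc: "s \<le> c" unfolding c_def by (rule cSup_upper[OF sA bdd])
  have ct: "c \<le> t" unfolding c_def by (rule cSup_least) (use sA in \<open>auto simp: A_def\<close>)
  have below: "g s \<le> g y" if y: "s \<le> y" "y < c" for y
  proof -
    have "\<exists>x\<in>A. y < x" using y(2) sA bdd unfolding c_def by (subst (asm) less_cSup_iff) auto
    then show ?thesis using y unfolding A_def by auto
  qed
  have gc: "g s \<le> g c"
  proof (cases "c = s")
    case False
    have "g s \<le> g c + e" if e: "0 < e" for e
    proof -
      obtain d where d: "d > 0" "\<And>y. c - d < y \<Longrightarrow> y < c \<Longrightarrow> \<bar>g y - g c\<bar> \<le> e"
        using left[of c e] False sc ct e by auto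
      define y where "y = max s (c - d / 2)"
      have "s \<le> y" "y < c" "c - d < y" using False sc d(1) unfolding y_def by auto
      then show ?thesis using d(2)[of y] below[of y] by linarith
    qed
    then show ?thesis by (rule field_le_epsilon)
  qed simp
  have "c = t"
  proof (rule ccontr)
    assume "c \<noteq> t"
    then have "c < t" using ct by simp
    then obtain d where d: "d > 0" "\<And>y. c < y \<Longrightarrow> y < c + d \<Longrightarrow> g c \<le> g y"
      using right[of c] sc by auto
    define x where "x = min t (c + d / 2)"
    have x: "c < x" "x \<le> t" "x < c + d" using \<open>c < t\<close> d(1) unfolding x_def by auto
    have "g s \<le> g y" if "s \<le> y" "y \<le> x" for y
    proof -
      consider "y < c" | "y = c" | "c < y" by linarith
      then show ?thesis
        by cases (use below[of y] gc d(2)[of y] that x in auto)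
    qed
    then have "x \<in> A" using x sc unfolding A_def by auto
    then have "x \<le> c" unfolding c_def by (rule cSup_upper[OF _ bdd])
    then show False using x(1) by simp
  qed
  then show ?thesis using gc by simp
qed

context o_minimal_structure
begin

lemma dpred_rel:
  assumes "dpred (\<lambda>p. Q (fst p) (snd p))" "dfun f" "dfun g" shows "dpred (\<lambda>z. Q (f z) (g z))"
  using dpred_compose[OF assms(1) dfun_Pair[OF assms(2,3)]] by simp

text \<open>Near a point, on either side of it, a definable predicate of one variable is constantly true or
  constantly false. Limits and eventual monotonicity are derived from this dichotomy.\<close>

definition decides :: "real filter \<Rightarrow> bool" where
  "decides F \<longleftrightarrow> (\<forall>P. dpred P \<longrightarrow> eventually P F \<or> eventually (\<lambda>x. \<not> P x) F)"

lemma decides_at_right: "decides (at_right a)"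
  unfolding decides_def
proof (intro allI impI)
  fix P :: "real \<Rightarrow> bool" assume "dpred P"
  then obtain \<I> where I: "{x. P x} = \<Union>\<I>" "finite \<I>" "\<forall>I\<in>\<I>. is_interval I"
    unfolding dpred_def definable_real_iff by blast
  have P: "P x \<longleftrightarrow> (\<exists>I\<in>\<I>. x \<in> I)" for x using I(1) by blast
  show "eventually P (at_right a) \<or> eventually (\<lambda>x. \<not> P x) (at_right a)"
  proof (cases "\<exists>I\<in>\<I>. \<forall>\<^sub>F x in at_right a. x \<in> I")
    case True
    then obtain J where "J \<in> \<I>" "\<forall>\<^sub>F x in at_right a. x \<in> J" by blast
    then have "eventually P (at_right a)" unfolding P by (auto elim!: eventually_mono)
    then show ?thesis by blast
  next
    case False
    then have "\<forall>I\<in>\<I>. \<forall>\<^sub>F x in at_right a. x \<notin> I" using interval_eventually_at_right I(3) by blast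
    then have "\<forall>\<^sub>F x in at_right a. \<forall>I\<in>\<I>. x \<notin> I" by (rule eventually_ball_finite[OF I(2)])
    then show ?thesis unfolding P by auto
  qed
qed

lemma decides_at_left: "decides (at_left a)"
  unfolding decides_def
proof (intro allI impI)
  fix P :: "real \<Rightarrow> bool" assume P: "dpred P"
  have "dpred (\<lambda>x. P (0 - x))" by (intro dpred_compose[OF P] dpred_intros)
  then show "eventually P (at_left a) \<or> eventually (\<lambda>x. \<not> P x) (at_left a)"
    using decides_at_right[of "- a"] unfolding decides_def at_left_minus[of a] eventually_filtermap
    by auto
qed

lemma eventually_if_frequently:
  assumes "decides F" "dpred P" "\<not> eventually (\<lambda>x. \<not> P x) F" shows "eventually P F"
  using assms unfolding decides_def by blast

lemma infinite_definable_contains_interval: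
  assumes "dpred P" "infinite {x::real. P x}"
  shows "\<exists>a b. a < b \<and> (\<forall>x. a < x \<and> x < b \<longrightarrow> P x)"
proof -
  obtain \<I> where I: "{x. P x} = \<Union>\<I>" "finite \<I>" "\<forall>I\<in>\<I>. is_interval I"
    using assms(1) unfolding dpred_def definable_real_iff by blast
  then obtain J where J: "J \<in> \<I>" "infinite J" using assms(2) finite_Union[of \<I>] by metis
  obtain p where p: "p \<in> J" using J(2) by (metis finite.emptyI ex_in_conv)
  obtain q where q: "q \<in> J" "q \<noteq> p"
    using J(2) p by (metis finite.simps insertI1 subsetI subset_singletonD insert_subset empty_iff finite_subset singleton_iff)
  have "is_interval J" using I(3) J(1) by blast
  then have "x \<in> J" if "min p q < x" "x < max p q" for x
    using that p q(1) unfolding is_interval_1 by (metis less_imp_le max_def min_def)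
  then have "P x" if "min p q < x" "x < max p q" for x using that I(1) J(1) by blast
  moreover have "min p q < max p q" using q(2) by auto
  ultimately show ?thesis by blast
qed

text \<open>The supremum of the thresholds that a definable function eventually exceeds is its limit.\<close>

lemma definable_limit:
  fixes f :: "real \<Rightarrow> real"
  assumes F: "decides F" and f: "dfun f"
  shows "\<exists>l. ((\<lambda>t. ereal (f t)) \<longlongrightarrow> l) F"
proof
  let ?C = "{ereal c | c. \<forall>\<^sub>F t in F. c < f t}"
  show "((\<lambda>t. ereal (f t)) \<longlongrightarrow> Sup ?C) F"
  proof (rule order_tendstoI)
    fix a assume "a < Sup ?C"
    then obtain c where "a < ereal c" "\<forall>\<^sub>F t in F. c < f t" unfolding less_Sup_iff by blast
    then show "\<forall>\<^sub>F t in F. a < ereal (f t)"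
      by (auto elim!: eventually_mono intro: less_trans)
  next
    fix a assume "Sup ?C < a"
    then obtain c where c: "Sup ?C < ereal c" "ereal c < a" using ereal_dense2 by blast
    have "\<not> (\<forall>\<^sub>F t in F. c < f t)"
      using c(1) Sup_upper[of "ereal c" ?C] by (auto simp: not_le[symmetric])
    moreover have "dpred (\<lambda>t. c < f t)" by (intro dpred_intros f)
    ultimately have "\<forall>\<^sub>F t in F. \<not> c < f t" using F unfolding decides_def by blast
    then show "\<forall>\<^sub>F t in F. ereal (f t) < a"
      by (rule eventually_mono) (metis c(2) ereal_less_eq(3) le_less_trans not_less)
  qed
qed

lemma definable_bounded_limit:
  fixes f :: "real \<Rightarrow> real"
  assumes F: "decides F" and f: "dfun f" and bd: "\<forall>\<^sub>F t in F. \<bar>f t\<bar> \<le> B" and nbot: "F \<noteq> bot"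
  shows "\<exists>l. (f \<longlongrightarrow> l) F"
proof -
  obtain l where l: "((\<lambda>t. ereal (f t)) \<longlongrightarrow> l) F" using definable_limit[OF F f] by blast
  have "l \<le> ereal B"
    by (rule tendsto_upperbound[OF l _ nbot]) (use bd in \<open>auto elim!: eventually_mono\<close>)
  moreover have "ereal (- B) \<le> l"
    by (rule tendsto_lowerbound[OF l _ nbot]) (use bd in \<open>auto elim!: eventually_mono\<close>)
  ultimately obtain r where "l = ereal r" by (cases l) auto
  then show ?thesis using l by auto
qed

subsection \<open>Definable choice\<close>

text \<open>For an empty set the value \<open>0\<close> is prescribed, to have a definable function on the whole space.\<close>

lemma dfun_Inf:
  fixes Q :: "'a::euclidean_space \<Rightarrow> real \<Rightarrow> bool"
  assumes Q: "dpred (\<lambda>p. Q (fst p) (snd p))" and nonneg: "\<And>z r. Q z r \<Longrightarrow> 0 \<le> r"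
  shows "dfun (\<lambda>z. if \<exists>r. Q z r then Inf {r. Q z r} else 0)"
proof -
  have "dpred (\<lambda>p. (\<exists>r. Q (fst p) r) \<and> (\<forall>r. Q (fst p) r \<longrightarrow> snd p \<le> r) \<and>
          (\<forall>e. 0 < e \<longrightarrow> (\<exists>r. Q (fst p) r \<and> r < snd p + e)) \<or>
        (\<not> (\<exists>r. Q (fst p) r) \<and> snd p = 0))"
    by (intro dpred_intros dpred_rel[OF Q])
  moreover have "((\<exists>r. Q z r) \<and> (\<forall>r. Q z r \<longrightarrow> s \<le> r) \<and> (\<forall>e. 0 < e \<longrightarrow> (\<exists>r. Q z r \<and> r < s + e)) \<or>
        (\<not> (\<exists>r. Q z r) \<and> s = 0)) \<longleftrightarrow> s = (if \<exists>r. Q z r then Inf {r. Q z r} else 0)"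
    (is "?l \<longleftrightarrow> ?r") for z s
  proof (cases "\<exists>r. Q z r")
    case True
    then have ne: "{r. Q z r} \<noteq> {}" by blast
    have bdd: "bdd_below {r. Q z r}" by (rule bdd_belowI[of _ 0]) (use nonneg in auto)
    show ?thesis
    proof
      assume ?l
      then have low: "\<And>r. Q z r \<Longrightarrow> s \<le> r" and near: "\<And>e. 0 < e \<Longrightarrow> \<exists>r. Q z r \<and> r < s + e"
        using True by auto
      have "s \<le> Inf {r. Q z r}" by (rule cInf_greatest[OF ne]) (use low in auto)
      moreover have "Inf {r. Q z r} \<le> s"
      proof (rule field_le_epsilon)
        fix e :: real assume "0 < e"
        then obtain r where "Q z r" "r < s + e" using near by blast
        then show "Inf {r. Q z r} \<le> s + e" using cInf_lower[OF _ bdd, of r] by simp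
      qed
      ultimately show ?r using True by simp
    next
      assume ?r
      then have s: "s = Inf {r. Q z r}" using True by simp
      have "\<exists>r. Q z r \<and> r < s + e" if "0 < e" for e
        using cInf_lessD[OF ne, of "s + e"] that s by auto
      then show ?l using True cInf_lower[OF _ bdd] s by auto
    qed
  qed simp
  ultimately show ?thesis unfolding dfun_def by simp
qed

text \<open>From a definable set of nonnegative numbers choose its infimum, if that belongs to it, and
  otherwise the midpoint of the interval of length at most one which then begins there.\<close>

lemma definable_choice_nonneg:
  fixes Q :: "'a::euclidean_space \<Rightarrow> real \<Rightarrow> bool"
  assumes Q: "dpred (\<lambda>p. Q (fst p) (snd p))" and nonneg: "\<And>z r. Q z r \<Longrightarrow> 0 \<le> r"
  shows "\<exists>g. dfun g \<and> (\<forall>z r. Q z r \<longrightarrow> Q z (g z))"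
proof -
  define s where "s z = (if \<exists>r. Q z r then Inf {r. Q z r} else 0)" for z
  have s: "dfun s" unfolding s_def by (rule dfun_Inf[OF Q nonneg])
  have s0: "0 \<le> s z" for z unfolding s_def using nonneg by (auto intro!: cInf_greatest)
  define W where "W z w \<longleftrightarrow> s z < w \<and> (\<not> Q z w \<or> s z + 1 \<le> w)" for z w
  have W: "dpred (\<lambda>p. W (fst p) (snd p))"
    unfolding W_def by (intro dpred_intros dpred_rel[OF Q] dfun_compose[OF s])
  have W0: "0 \<le> w" if "W z w" for z w using that s0[of z] unfolding W_def by auto
  define v where "v z = (if \<exists>w. W z w then Inf {w. W z w} else 0)" for z
  have v: "dfun v" unfolding v_def by (rule dfun_Inf[OF W W0])
  define g where "g z = (if Q z (s z) then s z else (s z + v z) / 2)" for z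
  have "dfun g" unfolding g_def by (intro dfun_if dpred_intros dpred_rel[OF Q] s v)
  moreover have "Q z (g z)" if r: "Q z r" for z r
  proof (cases "Q z (s z)")
    case True then show ?thesis by (simp add: g_def)
  next
    case False
    have sz: "s z = Inf {r. Q z r}" using r unfolding s_def by auto
    have ne: "{r. Q z r} \<noteq> {}" using r by blast
    have bdd: "bdd_below {r. Q z r}" by (rule bdd_belowI[of _ 0]) (use nonneg in auto)
    have "\<exists>x. s z < x \<and> x < b \<and> Q z x" if b: "s z < b" for b
    proof -
      obtain x where x: "Q z x" "x < b" using cInf_lessD[OF ne, of b] b sz by auto
      moreover have "s z \<le> x" unfolding sz by (rule cInf_lower[OF _ bdd]) (use x in auto)
      moreover have "x \<noteq> s z" using False x(1) by blast
      ultimately show ?thesis by (intro exI[of _ x]) auto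
    qed
    then have "\<not> eventually (\<lambda>x. \<not> Q z x) (at_right (s z))"
      unfolding eventually_at_right_field by blast
    moreover have "dpred (Q z)" by (rule dpred_rel[OF Q dfun_const dfun_id])
    ultimately have "eventually (Q z) (at_right (s z))"
      using eventually_if_frequently[OF decides_at_right] by blast
    then obtain b where b: "s z < b" "\<And>x. s z < x \<Longrightarrow> x < b \<Longrightarrow> Q z x"
      unfolding eventually_at_right_field by blast
    have Wne: "W z (s z + 1)" unfolding W_def by simp
    then have vz: "v z = Inf {w. W z w}" unfolding v_def by auto
    have "min b (s z + 1) \<le> v z" unfolding vz
    proof (rule cInf_greatest)
      fix w assume "w \<in> {w. W z w}"
      then show "min b (s z + 1) \<le> w"
        by (cases "w < b") (use b(2)[of w] in \<open>auto simp: W_def\<close>)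
    qed (use Wne in auto)
    then have sv: "s z < v z" using b(1) by auto
    have "bdd_below {w. W z w}" by (rule bdd_belowI[of _ 0]) (use W0 in auto)
    then have "\<not> W z ((s z + v z) / 2)"
      using cInf_lower[of "(s z + v z) / 2" "{w. W z w}"] sv unfolding vz[symmetric] by auto
    then have "Q z ((s z + v z) / 2)" using sv unfolding W_def by auto
    then show ?thesis using False by (simp add: g_def)
  qed
  ultimately show ?thesis by blast
qed

lemma definable_choice_real:
  fixes Q :: "'a::euclidean_space \<Rightarrow> real \<Rightarrow> bool"
  assumes Q: "dpred (\<lambda>p. Q (fst p) (snd p))"
  shows "\<exists>g. dfun g \<and> (\<forall>z r. Q z r \<longrightarrow> Q z (g z))"
proof -
  have "dpred (\<lambda>p. Q (fst p) (snd p) \<and> 0 \<le> snd p)" by (intro dpred_intros Q)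
  from definable_choice_nonneg[of "\<lambda>z r. Q z r \<and> 0 \<le> r", OF this]
  obtain g where g: "dfun g" "\<And>z r. Q z r \<Longrightarrow> 0 \<le> r \<Longrightarrow> Q z (g z)" by auto
  have "dpred (\<lambda>p. Q (fst p) (0 - snd p) \<and> 0 \<le> snd p)" by (intro dpred_intros dpred_rel[OF Q])
  from definable_choice_nonneg[of "\<lambda>z r. Q z (0 - r) \<and> 0 \<le> r", OF this]
  obtain h where h: "dfun h" "\<And>z r. Q z (0 - r) \<Longrightarrow> 0 \<le> r \<Longrightarrow> Q z (0 - h z)" by auto
  define k where "k z = (if \<exists>r. Q z r \<and> 0 \<le> r then g z else 0 - h z)" for z
  have "dfun k" unfolding k_def
    by (intro dfun_if dpred_intros g(1) h(1) dpred_rel[OF Q])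
  moreover have "Q z (k z)" if "Q z r" for z r
  proof (cases "\<exists>r. Q z r \<and> 0 \<le> r")
    case True then show ?thesis using g(2) by (auto simp: k_def)
  next
    case False
    then have "r < 0" using that by (auto simp: not_le[symmetric])
    then have "Q z (0 - h z)" using h(2)[of z "- r"] that by simp
    then show ?thesis unfolding k_def if_not_P[OF False] .
  qed
  ultimately show ?thesis by blast
qed

lemma definable_choice:
  fixes P :: "'a::euclidean_space \<Rightarrow> 'b::euclidean_space \<Rightarrow> bool"
  assumes P: "dpred (\<lambda>p. P (fst p) (snd p))"
  shows "\<exists>f. dfun f \<and> (\<forall>z w. P z w \<longrightarrow> P z (f z))"
proof -
  \<comment> \<open>Coordinates are chosen one after the other.\<close>
  have "\<exists>f. dfun f \<and> (\<forall>z. (\<exists>w. P z w) \<longrightarrow> (\<exists>w. P z w \<and> (\<forall>b\<in>B. w \<bullet> b = f z \<bullet> b)))"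
    if "finite B" "B \<subseteq> Basis" for B
    using that
  proof (induction B rule: finite_induct)
    case empty then show ?case using dfun_const by blast
  next
    case (insert b B)
    then obtain f where f: "dfun f"
      and fw: "\<And>z. \<exists>w. P z w \<Longrightarrow> \<exists>w. P z w \<and> (\<forall>b\<in>B. w \<bullet> b = f z \<bullet> b)" by blast
    define R where "R z r \<longleftrightarrow> (\<exists>w. P z w \<and> (\<forall>b\<in>B. w \<bullet> b = f z \<bullet> b) \<and> w \<bullet> b = r)" for z r
    have basis: "b \<in> Basis" "\<And>b'. b' \<in> B \<Longrightarrow> b' \<in> Basis" using insert.prems by auto
    have "dpred (\<lambda>p. R (fst p) (snd p))" unfolding R_def
      by (intro dpred_intros dpred_rel[OF P] dpred_finite_ball insert.hyps(1) dfun_inner_Basis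
          basis dfun_compose[OF f])
    from definable_choice_real[OF this]
    obtain g where g: "dfun g" "\<And>z r. R z r \<Longrightarrow> R z (g z)" by blast
    define h where "h z = f z + (g z - f z \<bullet> b) *\<^sub>R b" for z
    have "dfun h" unfolding h_def by (intro dpred_intros f g(1) dfun_inner_Basis basis)
    moreover have "\<exists>w. P z w \<and> (\<forall>b\<in>insert b B. w \<bullet> b = h z \<bullet> b)" if "\<exists>w. P z w" for z
    proof -
      have "\<exists>r. R z r" using fw[OF that] unfolding R_def by blast
      then have "R z (g z)" using g(2) by blast
      then obtain w where w: "P z w" "\<And>b'. b' \<in> B \<Longrightarrow> w \<bullet> b' = f z \<bullet> b'" "w \<bullet> b = g z"
        unfolding R_def by blast
      have "h z \<bullet> b = g z" using basis(1) by (simp add: h_def inner_add_left)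
      moreover have "h z \<bullet> b' = f z \<bullet> b'" if "b' \<in> B" for b'
      proof -
        have "b' \<noteq> b" using that insert.hyps(2) by blast
        then show ?thesis using inner_Basis[OF basis(1) basis(2)[OF that]] by (simp add: h_def inner_add_left)
      qed
      ultimately have "\<forall>b\<in>insert b B. w \<bullet> b = h z \<bullet> b" using w(2,3) by simp
      then show ?thesis using w(1) by blast
    qed
    ultimately show ?case by blast
  qed
  from this[OF finite_Basis subset_refl] obtain f where f: "dfun f"
    and fw: "\<And>z. \<exists>w. P z w \<Longrightarrow> \<exists>w. P z w \<and> (\<forall>b\<in>Basis. w \<bullet> b = f z \<bullet> b)" by blast
  have "P z (f z)" if zw: "P z w" for z w
  proof -
    obtain w' where "P z w'" "\<forall>b\<in>Basis. w' \<bullet> b = f z \<bullet> b" using fw zw by blast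
    then show ?thesis using euclidean_eq_iff[of w' "f z"] by simp
  qed
  then show ?thesis using f by blast
qed

subsection \<open>Lipschitz continuity of arcs\<close>

text \<open>If \<open>f\<close> were discontinuous from the left at all points of an interval, then the jumps would exceed some fixed
  \<open>e\<close> at infinitely many of them, because the interval is uncountable, and hence on a subinterval. This contradicts
  the existence of the limit from the left at a point of the subinterval.\<close>

lemma definable_eventually_left_continuous:
  fixes f :: "real \<Rightarrow> real"
  assumes f: "dfun f" and bd: "\<And>t. 0 < t \<Longrightarrow> t < b \<Longrightarrow> \<bar>f t\<bar> \<le> B" and "0 < b"
  shows "\<forall>\<^sub>F t in at_right 0. \<forall>e. 0 < e \<longrightarrow>
    (\<exists>d. 0 < d \<and> (\<forall>s. t - d < s \<and> s < t \<longrightarrow> \<bar>f s - f t\<bar> \<le> e))"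
    (is "eventually ?P _")
proof (rule eventually_if_frequently[OF decides_at_right], goal_cases)
  case 1 show ?case by (intro dpred_intros dfun_compose[OF f])
next
  case 2
  show ?case
  proof
    assume "\<forall>\<^sub>F t in at_right 0. \<not> ?P t"
    then obtain c0 where c0: "0 < c0" "\<And>t. 0 < t \<Longrightarrow> t < c0 \<Longrightarrow> \<not> ?P t"
      unfolding eventually_at_right_field by blast
    define c where "c = min b c0"
    have c: "0 < c" "c \<le> b" "c \<le> c0" using \<open>0 < b\<close> c0(1) unfolding c_def by auto
    define E where "E e t \<longleftrightarrow> (\<forall>d. 0 < d \<longrightarrow> (\<exists>s. t - d < s \<and> s < t \<and> e < \<bar>f s - f t\<bar>)) \<and> 0 < t \<and> t < c" for e t
    have E: "dpred (E e)" for e unfolding E_def by (intro dpred_intros dfun_compose[OF f])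
    have "\<exists>n. E (inverse (real (Suc n))) t" if t: "0 < t" "t < c" for t
    proof -
      obtain e where e: "0 < e" "\<And>d. 0 < d \<Longrightarrow> \<exists>s. t - d < s \<and> s < t \<and> e < \<bar>f s - f t\<bar>"
        using c0(2)[of t] t c(3) by (auto simp: not_le)
      obtain n where n: "inverse (real (Suc n)) < e" using reals_Archimedean[OF e(1)] by blast
      have "E (inverse (real (Suc n))) t" unfolding E_def
      proof (intro conjI allI impI t)
        fix d :: real assume "0 < d"
        then obtain s where "t - d < s \<and> s < t \<and> e < \<bar>f s - f t\<bar>" using e(2) by blast
        then show "\<exists>s. t - d < s \<and> s < t \<and> inverse (real (Suc n)) < \<bar>f s - f t\<bar>"
          using n by (intro exI[of _ s]) linarith
      qed
      then show ?thesis by blast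
    qed
    then have "{0<..<c} \<subseteq> (\<Union>n. {t. E (inverse (real (Suc n))) t})" by auto
    then have "\<not> countable (\<Union>n. {t. E (inverse (real (Suc n))) t})"
      using uncountable_open_interval[of 0 c] c(1) countable_subset by blast
    then obtain n where "\<not> countable {t. E (inverse (real (Suc n))) t}" by blast
    then have "infinite {t. E (inverse (real (Suc n))) t}" using countable_finite by blast
    then obtain e where e: "0 < e" "infinite {t. E e t}" by (metis inverse_positive_iff_positive of_nat_0_less_iff zero_less_Suc)
    then obtain p q where pq: "p < q" "\<And>x. p < x \<Longrightarrow> x < q \<Longrightarrow> E e x"
      using infinite_definable_contains_interval[OF E] by blast
    define t where "t = (p + q) / 2"
    have t: "p < t" "t < q" using pq(1) unfolding t_def by auto
    have "\<forall>\<^sub>F s in at_left t. \<bar>f s\<bar> \<le> B"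
      unfolding eventually_at_left_field
    proof (intro exI[of _ p] conjI allI impI t)
      fix s assume "p < s" "s < t"
      then have "E e s" using pq(2) t(2) by auto
      then show "\<bar>f s\<bar> \<le> B" using bd[of s] c(2) unfolding E_def by auto
    qed
    then obtain l where "(f \<longlongrightarrow> l) (at_left t)"
      using definable_bounded_limit[OF decides_at_left f] by force
    then have "\<forall>\<^sub>F s in at_left t. dist (f s) l < e / 2" using e(1) by (intro tendstoD) auto
    then obtain r where r: "r < t" "\<And>s. r < s \<Longrightarrow> s < t \<Longrightarrow> dist (f s) l < e / 2"
      unfolding eventually_at_left_field by blast
    define s where "s = (max p r + t) / 2"
    have s: "p < s" "r < s" "s < t" using t(1) r(1) unfolding s_def by auto
    then have "E e s" using pq(2) t(2) by auto
    then obtain s' where s': "s - (s - r) < s'" "s' < s" "e < \<bar>f s' - f s\<bar>"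
      using s(2) unfolding E_def by (metis diff_gt_0_iff_gt)
    have "dist (f s') l < e / 2" "dist (f s) l < e / 2" using r(2) s s' by auto
    then show False using s'(3) unfolding dist_real_def by linarith
  qed
qed

text \<open>The function \<open>t \<mapsto> f t - 2 * t\<close> is eventually monotone. It cannot increase, because it is negative
  and tends to \<open>0\<close> at \<open>0\<close>.\<close>

lemma definable_one_sided_Lipschitz:
  fixes f :: "real \<Rightarrow> real"
  assumes f: "dfun f" and le: "\<forall>\<^sub>F t in at_right 0. \<bar>f t\<bar> \<le> t"
  shows "\<exists>b>0. \<forall>s t. 0 < s \<and> s \<le> t \<and> t < b \<longrightarrow> f t - f s \<le> 2 * (t - s)"
proof -
  define g where "g t = f t - 2 * t" for t
  have g: "dfun g" unfolding g_def by (intro dpred_intros f)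
  obtain b1 where b1: "0 < b1" "\<And>t. 0 < t \<Longrightarrow> t < b1 \<Longrightarrow> \<bar>f t\<bar> \<le> t"
    using le unfolding eventually_at_right_field by blast
  have "\<bar>g t\<bar> \<le> 3 * b1" if "0 < t" "t < b1" for t using b1(2)[OF that] that unfolding g_def by linarith
  from definable_eventually_left_continuous[OF g this b1(1)]
  obtain b2 where b2: "0 < b2" "\<And>t e. 0 < t \<Longrightarrow> t < b2 \<Longrightarrow> 0 < e \<Longrightarrow>
      \<exists>d>0. \<forall>s. t - d < s \<and> s < t \<longrightarrow> \<bar>g s - g t\<bar> \<le> e"
    unfolding eventually_at_right_field by blast
  define A where "A t \<longleftrightarrow> (\<exists>d. 0 < d \<and> (\<forall>s. t < s \<and> s < t + d \<longrightarrow> g s \<le> g t))" for t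
  have A: "dpred A" unfolding A_def by (intro dpred_intros dfun_compose[OF g])
  have not_A: "\<exists>d>0. \<forall>s. t < s \<and> s < t + d \<longrightarrow> g t \<le> g s" if "\<not> A t" for t
  proof -
    have near: "\<exists>d>0. \<forall>s. t < s \<and> s < t + d \<longrightarrow> Q s" if ev: "eventually Q (at_right t)" for Q
    proof -
      obtain b where "t < b" "\<forall>s>t. s < b \<longrightarrow> Q s" using ev unfolding eventually_at_right_field by blast
      then show ?thesis by (intro exI[of _ "b - t"]) auto
    qed
    have "\<not> eventually (\<lambda>s. g s \<le> g t) (at_right t)" using near[of "\<lambda>s. g s \<le> g t"] that unfolding A_def by blast
    moreover have "dpred (\<lambda>s. g s \<le> g t)" by (intro dpred_intros g)
    ultimately have "eventually (\<lambda>s. \<not> g s \<le> g t) (at_right t)"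
      using decides_at_right[of t] unfolding decides_def by blast
    from near[OF this] show ?thesis by (metis less_imp_le not_le)
  qed
  have "eventually A (at_right 0) \<or> eventually (\<lambda>t. \<not> A t) (at_right 0)"
    using decides_at_right A unfolding decides_def by blast
  then show ?thesis
  proof
    assume "eventually A (at_right 0)"
    then obtain b3 where b3: "0 < b3" "\<And>t. 0 < t \<Longrightarrow> t < b3 \<Longrightarrow> A t"
      unfolding eventually_at_right_field by blast
    have "f t - f s \<le> 2 * (t - s)" if st: "0 < s" "s \<le> t" "t < min b2 b3" for s t
    proof -
      have "- g s \<le> - g t"
      proof (rule le_of_left_continuous_locally_increasing[OF st(2)])
        fix x e :: real assume "s < x" "x \<le> t" "0 < e"
        then show "\<exists>d>0. \<forall>y. x - d < y \<and> y < x \<longrightarrow> \<bar>- g y - - g x\<bar> \<le> e"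
          using b2(2)[of x e] st by (simp add: abs_minus_commute)
      next
        fix x assume "s \<le> x" "x < t"
        then show "\<exists>d>0. \<forall>y. x < y \<and> y < x + d \<longrightarrow> - g x \<le> - g y"
          using b3(2)[of x] st unfolding A_def by auto
      qed
      then show ?thesis unfolding g_def by simp
    qed
    then show ?thesis using b2(1) b3(1) by (intro exI[of _ "min b2 b3"]) auto
  next
    assume "eventually (\<lambda>t. \<not> A t) (at_right 0)"
    then obtain b3 where b3: "0 < b3" "\<And>t. 0 < t \<Longrightarrow> t < b3 \<Longrightarrow> \<not> A t"
      unfolding eventually_at_right_field by blast
    define t where "t = min b1 (min b2 b3) / 2"
    have t: "0 < t" "t < b1" "t < b2" "t < b3" using b1(1) b2(1) b3(1) unfolding t_def by auto
    have inc: "g s \<le> g t" if st: "0 < s" "s \<le> t" for s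
    proof (rule le_of_left_continuous_locally_increasing[OF st(2)])
      fix x e :: real assume "s < x" "x \<le> t" "0 < e"
      then show "\<exists>d>0. \<forall>y. x - d < y \<and> y < x \<longrightarrow> \<bar>g y - g x\<bar> \<le> e" using b2(2)[of x e] st t by simp
    next
      fix x assume "s \<le> x" "x < t"
      then show "\<exists>d>0. \<forall>y. x < y \<and> y < x + d \<longrightarrow> g x \<le> g y" using not_A[OF b3(2)[of x]] st t by simp
    qed
    \<comment> \<open>At \<open>s = t / 4\<close> one has \<open>g s \<ge> - 3 * s > - t \<ge> g t\<close>.\<close>
    have "g (t / 4) \<le> g t" using inc[of "t / 4"] t(1) by simp
    moreover have "\<bar>f t\<bar> \<le> t" "\<bar>f (t / 4)\<bar> \<le> t / 4" using b1(2)[of t] b1(2)[of "t / 4"] t by auto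
    ultimately show ?thesis using t(1) unfolding g_def by linarith
  qed
qed

text \<open>The constant has to be independent of the arc: it is fixed in the proof of \<open>definable_germ_radial\<close> before an
  arc is chosen.\<close>

lemma arc_Lipschitz:
  fixes \<gamma> :: "real \<Rightarrow> 'a::euclidean_space"
  assumes \<gamma>: "dfun \<gamma>" and norm: "\<forall>\<^sub>F t in at_right 0. norm (\<gamma> t) = t"
  shows "\<exists>b>0. \<forall>s t. 0 < s \<and> s < b \<and> 0 < t \<and> t < b \<longrightarrow>
    norm (\<gamma> s - \<gamma> t) \<le> 2 * real DIM('a) * \<bar>s - t\<bar>"
proof -
  have comp: "\<exists>b>0. \<forall>s t. 0 < s \<and> s < b \<and> 0 < t \<and> t < b \<longrightarrow> \<bar>(\<gamma> s - \<gamma> t) \<bullet> i\<bar> \<le> 2 * \<bar>s - t\<bar>"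
    if i: "i \<in> Basis" for i
  proof -
    have 1: "dfun (\<lambda>t. \<gamma> t \<bullet> i)" by (intro dfun_inner_Basis i \<gamma>)
    then have 2: "dfun (\<lambda>t. 0 - \<gamma> t \<bullet> i)" by (intro dpred_intros)
    have le: "\<forall>\<^sub>F t in at_right 0. \<bar>\<gamma> t \<bullet> i\<bar> \<le> t"
      using norm by (rule eventually_mono) (metis Basis_le_norm i)
    then have le': "\<forall>\<^sub>F t in at_right 0. \<bar>0 - \<gamma> t \<bullet> i\<bar> \<le> t" by simp
    obtain b where b: "b > 0" "\<And>s t. 0 < s \<Longrightarrow> s \<le> t \<Longrightarrow> t < b \<Longrightarrow> \<gamma> t \<bullet> i - \<gamma> s \<bullet> i \<le> 2 * (t - s)"
      using definable_one_sided_Lipschitz[OF 1 le] by blast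
    obtain c where c: "c > 0" "\<And>s t. 0 < s \<Longrightarrow> s \<le> t \<Longrightarrow> t < c \<Longrightarrow> \<gamma> s \<bullet> i - \<gamma> t \<bullet> i \<le> 2 * (t - s)"
      using definable_one_sided_Lipschitz[OF 2 le'] by auto
    have "\<bar>(\<gamma> s - \<gamma> t) \<bullet> i\<bar> \<le> 2 * \<bar>s - t\<bar>" if "0 < s" "s < min b c" "0 < t" "t < min b c" for s t
    proof (cases "s \<le> t")
      case True
      then show ?thesis using b(2)[of s t] c(2)[of s t] that by (simp add: inner_diff_left)
    next
      case False
      then show ?thesis using b(2)[of t s] c(2)[of t s] that by (simp add: inner_diff_left)
    qed
    then show ?thesis using b(1) c(1) by (intro exI[of _ "min b c"]) auto
  qed
  then obtain b where b: "\<And>i. i \<in> Basis \<Longrightarrow> b i > 0"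
    "\<And>i s t. i \<in> Basis \<Longrightarrow> 0 < s \<Longrightarrow> s < b i \<Longrightarrow> 0 < t \<Longrightarrow> t < b i \<Longrightarrow> \<bar>(\<gamma> s - \<gamma> t) \<bullet> i\<bar> \<le> 2 * \<bar>s - t\<bar>"
    by metis
  define c where "c = Min (b ` Basis)"
  have c: "0 < c" "\<And>i. i \<in> Basis \<Longrightarrow> c \<le> b i" using b(1) unfolding c_def by auto
  have "norm (\<gamma> s - \<gamma> t) \<le> (2 * real DIM('a)) * \<bar>s - t\<bar>" if "0 < s" "s < c" "0 < t" "t < c" for s t
  proof -
    have "norm (\<gamma> s - \<gamma> t) \<le> (\<Sum>i\<in>Basis. \<bar>(\<gamma> s - \<gamma> t) \<bullet> i\<bar>)" by (rule norm_le_l1)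
    also have "\<dots> \<le> (\<Sum>i\<in>(Basis::'a set). 2 * \<bar>s - t\<bar>)"
    proof (rule sum_mono)
      fix i :: 'a assume i: "i \<in> Basis"
      show "\<bar>(\<gamma> s - \<gamma> t) \<bullet> i\<bar> \<le> 2 * \<bar>s - t\<bar>" by (rule b(2)[OF i]) (use that c(2)[OF i] in auto)
    qed
    finally show ?thesis by simp
  qed
  then show ?thesis using c(1) by (intro exI[of _ c]) auto
qed

end

section \<open>Asymptotics of definable functions\<close>

lemma additive_nonneg_imp_linear:
  fixes a :: "real \<Rightarrow> real"
  assumes add: "\<And>x y. a (x + y) = a x + a y" and nonneg: "\<And>x. 0 \<le> x \<Longrightarrow> 0 \<le> a x"
  shows "a x = x * a 1"
proof -
  have a0: "a 0 = 0" using add[of 0 0] by simp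
  have neg: "a (- x) = - a x" for x using add[of x "- x"] a0 by simp
  have mono: "a x \<le> a y" if "x \<le> y" for x y
    using add[of x "y - x"] nonneg[of "y - x"] that by simp
  have mult: "a (real n * x) = real n * a x" for n x
    by (induction n) (simp_all add: a0 add algebra_simps)
  have pos: "a x = x * a 1" if x: "0 \<le> x" for x
  proof -
    have bound: "real n * \<bar>a x - x * a 1\<bar> \<le> a 1" for n
    proof -
      define m where "m = nat \<lfloor>real n * x\<rfloor>"
      have m: "real m \<le> real n * x" "real n * x \<le> real m + 1"
        using x unfolding m_def by simp_all
      have "real m * a 1 \<le> real n * a x" using mono[OF m(1)] mult[of m 1] mult[of n x] by simp
      moreover have "real n * a x \<le> (real m + 1) * a 1"
        using mono[OF m(2)] mult[of "Suc m" 1] mult[of n x] by (simp add: add.commute)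
      moreover have "real m * a 1 \<le> (real n * x) * a 1" "(real n * x) * a 1 \<le> (real m + 1) * a 1"
        using m nonneg[of 1] by (auto intro: mult_right_mono)
      ultimately have "\<bar>real n * a x - (real n * x) * a 1\<bar> \<le> a 1" by (simp add: algebra_simps abs_le_iff)
      moreover have "real n * a x - (real n * x) * a 1 = real n * (a x - x * a 1)"
        by (simp add: algebra_simps)
      ultimately show ?thesis by (simp add: abs_mult)
    qed
    show ?thesis
    proof (rule ccontr)
      assume "a x \<noteq> x * a 1"
      then have "0 < \<bar>a x - x * a 1\<bar>" by simp
      then obtain n where "a 1 < real n * \<bar>a x - x * a 1\<bar>" using reals_Archimedean3 by blast
      then show False using bound[of n] by simp
    qed
  qed
  show ?thesis
  proof (cases "0 \<le> x")
    case False
    then show ?thesis using pos[of "- x"] neg[of x] by simp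
  qed (rule pos)
qed

lemma filterlim_mult_at_right_0:
  assumes "0 < (x::real)" shows "filterlim (\<lambda>t. t * x) (at_right 0) (at_right 0)"
proof -
  have "((\<lambda>t. t * x) \<longlongrightarrow> 0 * x) (at_right 0)" by (intro tendsto_intros)
  moreover have "\<forall>\<^sub>F t in at_right 0. t * x \<in> {0<..}"
    using assms by (auto simp: eventually_at_right_field intro!: exI[of _ 1])
  ultimately show ?thesis unfolding filterlim_at by (auto simp: eventually_at_filter elim: eventually_mono)
qed

lemma eventually_mult_at_right_0:
  assumes "0 < (x::real)" "eventually P (at_right 0)" shows "\<forall>\<^sub>F t in at_right 0. P (t * x)"
  using filterlim_mult_at_right_0[OF assms(1)] assms(2) unfolding filterlim_iff by blast

context polynomially_bounded_o_minimal_structure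
begin

lemma polynomial_bound_at_top:
  assumes "dfun (f :: real \<Rightarrow> real)" shows "\<exists>k. \<forall>\<^sub>F t in at_top. \<bar>f t\<bar> \<le> t ^ k"
proof (rule polynomially_bounded)
  have "{p. snd p = f (fst p)} = {(t, f t) | t. True}" by force
  then show "definable S {(t, f t) | t. True}" using assms unfolding dfun_def dpred_def by simp
qed

lemma polynomial_bound_at_0:
  assumes f: "dfun (f :: real \<Rightarrow> real)" shows "\<exists>k. \<forall>\<^sub>F t in at_right 0. \<bar>f t\<bar> \<le> inverse t ^ k"
proof -
  have "dfun (\<lambda>s. f (inverse s))" by (intro dfun_compose[OF f] dpred_intros)
  then obtain k where k: "\<forall>\<^sub>F s in at_top. \<bar>f (inverse s)\<bar> \<le> s ^ k" using polynomial_bound_at_top by blast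
  have "\<forall>\<^sub>F t in at_right 0. \<bar>f (inverse (inverse t))\<bar> \<le> inverse t ^ k"
    using k filterlim_inverse_at_top_right unfolding filterlim_iff by blast
  then show ?thesis by auto
qed

text \<open>If the quotients tended to infinity, then \<open>f\<close> would grow along the sequence \<open>t * x ^ n\<close> faster
  than every power of \<open>x ^ -n\<close>.\<close>

lemma ratio_not_at_top_aux:
  fixes f :: "real \<Rightarrow> real"
  assumes f: "dfun f" and pos: "\<forall>\<^sub>F t in at_right 0. 0 < f t" and x: "0 < x" "x < 1"
  shows "\<not> filterlim (\<lambda>t. f (t * x) / f t) at_top (at_right 0)"
proof
  assume lim: "filterlim (\<lambda>t. f (t * x) / f t) at_top (at_right 0)"
  obtain k where k: "\<forall>\<^sub>F t in at_right 0. \<bar>f t\<bar> \<le> inverse t ^ k" using polynomial_bound_at_0[OF f] by blast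
  define A where "A = 2 * inverse x ^ k"
  have "\<forall>\<^sub>F t in at_right 0. A \<le> f (t * x) / f t" using lim unfolding filterlim_at_top by blast
  then have "\<forall>\<^sub>F t in at_right 0. 0 < f t \<and> \<bar>f t\<bar> \<le> inverse t ^ k \<and> A \<le> f (t * x) / f t"
    using pos k by eventually_elim auto
  then obtain b where b: "0 < b" "\<And>t. 0 < t \<Longrightarrow> t < b \<Longrightarrow> 0 < f t \<and> \<bar>f t\<bar> \<le> inverse t ^ k \<and> A \<le> f (t * x) / f t"
    unfolding eventually_at_right_field by blast
  define t where "t n = b / 2 * x ^ n" for n :: nat
  have t: "0 < t n" "t n < b" for n
  proof -
    show "0 < t n" using b(1) x unfolding t_def by simp
    have "x ^ n \<le> 1" using x by (simp add: power_le_one)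
    then have "b / 2 * x ^ n \<le> b / 2 * 1" using b(1) by (intro mult_left_mono) auto
    then show "t n < b" using b(1) unfolding t_def by simp
  qed
  have A0: "0 < A" using x unfolding A_def by simp
  have grow: "A ^ n * f (t 0) \<le> f (t n)" for n
  proof (induction n)
    case (Suc n)
    have "0 < f (t n)" "A \<le> f (t n * x) / f (t n)" using b(2)[OF t[of n]] by auto
    then have "A * f (t n) \<le> f (t n * x)" by (simp add: pos_le_divide_eq)
    moreover have "t n * x = t (Suc n)" unfolding t_def by simp
    moreover have "A * (A ^ n * f (t 0)) \<le> A * f (t n)" using Suc A0 by (intro mult_left_mono) auto
    ultimately show ?case by (simp add: mult.assoc)
  qed simp
  have f0: "0 < f (t 0)" using b(2)[OF t[of 0]] by simp
  have "2 ^ n * f (t 0) \<le> inverse (b / 2) ^ k" for n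
  proof -
    have "A ^ n * f (t 0) \<le> inverse (t n) ^ k" using grow[of n] b(2)[OF t[of n]] by linarith
    also have "inverse (t n) = inverse (b / 2) * inverse x ^ n"
      unfolding t_def inverse_mult_distrib power_inverse ..
    also have "(inverse (b / 2) * inverse x ^ n) ^ k = inverse (b / 2) ^ k * (inverse x ^ k) ^ n"
      unfolding power_mult_distrib power_mult[symmetric] mult.commute[of n k] ..
    finally have "(2 ^ n * f (t 0)) * (inverse x ^ k) ^ n \<le> inverse (b / 2) ^ k * (inverse x ^ k) ^ n"
      unfolding A_def by (simp add: power_mult_distrib algebra_simps)
    then show ?thesis using x by (simp add: mult_le_cancel_right)
  qed
  moreover obtain n where "inverse (b / 2) ^ k / f (t 0) < 2 ^ n" using real_arch_pow[of 2] by auto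
  ultimately show False using f0 by (simp add: pos_divide_less_eq) (meson not_less)
qed

lemma ratio_not_at_top:
  fixes f :: "real \<Rightarrow> real"
  assumes f: "dfun f" and pos: "\<forall>\<^sub>F t in at_right 0. 0 < f t" and x: "0 < x"
  shows "\<not> filterlim (\<lambda>t. f (t * x) / f t) at_top (at_right 0)"
proof
  assume lim: "filterlim (\<lambda>t. f (t * x) / f t) at_top (at_right 0)"
  consider "x < 1" | "x = 1" | "1 < x" by linarith
  then show False
  proof cases
    case 1 then show ?thesis using ratio_not_at_top_aux[OF f pos x] lim by blast
  next
    case 2
    have "\<forall>\<^sub>F t in at_right 0. 2 \<le> f (t * x) / f t" using lim unfolding filterlim_at_top by blast
    then have "\<forall>\<^sub>F t in at_right (0::real). False" using pos by eventually_elim (use 2 in auto)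
    then show ?thesis by simp
  next
    case 3
    \<comment> \<open>The quotients of \<open>1 / f\<close> for \<open>1 / x\<close> are those of \<open>f\<close> for \<open>x\<close> at another argument.\<close>
    have "filterlim (\<lambda>t. f ((t * inverse x) * x) / f (t * inverse x)) at_top (at_right 0)"
      by (rule filterlim_compose[OF lim filterlim_mult_at_right_0]) (use x in simp)
    then have "filterlim (\<lambda>t. inverse (f (t * inverse x)) / inverse (f t)) at_top (at_right 0)"
      using x by (simp add: field_simps)
    moreover have "dfun (\<lambda>t. inverse (f t))" by (intro dpred_intros f)
    moreover have "\<forall>\<^sub>F t in at_right 0. 0 < inverse (f t)" using pos by eventually_elim simp
    ultimately show ?thesis using ratio_not_at_top_aux[of "\<lambda>t. inverse (f t)" "inverse x"] 3 x
      by (simp add: field_simps)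
  qed
qed

text \<open>The limit exists in the extended reals by definability. If it were \<open>0\<close> for \<open>x\<close>, then it would be infinite for
  \<open>1 / x\<close>.\<close>

lemma ratio_limit:
  fixes f :: "real \<Rightarrow> real"
  assumes f: "dfun f" and pos: "\<forall>\<^sub>F t in at_right 0. 0 < f t" and x: "0 < x"
  shows "\<exists>l>0. ((\<lambda>t. f (t * x) / f t) \<longlongrightarrow> l) (at_right 0)"
proof -
  have "dfun (\<lambda>t. f (t * x) / f t)" by (intro dpred_intros dfun_compose[OF f] f)
  then obtain L where L: "((\<lambda>t. ereal (f (t * x) / f t)) \<longlongrightarrow> L) (at_right 0)"
    using definable_limit[OF decides_at_right] by blast
  have q: "\<forall>\<^sub>F t in at_right 0. 0 < f (t * x) / f t"
    using pos eventually_mult_at_right_0[OF x pos] by eventually_elim simp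
  have "0 \<le> L"
    by (rule tendsto_lowerbound[OF L]) (use q in \<open>auto elim!: eventually_mono\<close>)
  moreover have "L \<noteq> \<infinity>"
    using ratio_not_at_top[OF f pos x] L by (auto simp: tendsto_PInfty_eq_at_top)
  moreover have "L \<noteq> 0"
  proof
    assume "L = 0"
    then have "((\<lambda>t. f (t * x) / f t) \<longlongrightarrow> 0) (at_right 0)" using L by (simp add: zero_ereal_def)
    then have inv: "filterlim (\<lambda>t. inverse (f (t * x) / f t)) at_top (at_right 0)"
      by (rule filterlim_inverse_at_top) (rule q)
    have "filterlim (\<lambda>t. inverse (f ((t * inverse x) * x) / f (t * inverse x))) at_top (at_right 0)"
      by (rule filterlim_compose[OF inv filterlim_mult_at_right_0]) (use x in simp)
    then have "filterlim (\<lambda>t. f (t * inverse x) / f t) at_top (at_right 0)" using x by (simp add: field_simps)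
    then show False using ratio_not_at_top[OF f pos, of "inverse x"] x by simp
  qed
  ultimately obtain l where "L = ereal l" "0 < l" by (cases L) (auto simp: zero_ereal_def)
  then show ?thesis using L by auto
qed

text \<open>Suppose that \<open>g\<close> tends to infinity. By definable choice and polynomial boundedness \<open>g\<close> exceeds
  \<open>s\<close> on \<open>(0, s ^ -k)\<close>, for a fixed \<open>k\<close> and all large \<open>s\<close>, so that \<open>g\<close> grows at least like
  \<open>t powr (- 1 / k)\<close>. But a slowly varying function grows more slowly than every power.\<close>

lemma slowly_varying_not_at_top:
  fixes g :: "real \<Rightarrow> real"
  assumes g: "dfun g" and pos: "\<forall>\<^sub>F t in at_right 0. 0 < g t"
    and slow: "((\<lambda>t. g (t * inverse 2) / g t) \<longlongrightarrow> 1) (at_right 0)"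
  shows "\<not> filterlim g at_top (at_right 0)"
proof
  assume lim: "filterlim g at_top (at_right 0)"
  define P where "P s u \<longleftrightarrow> 0 < u \<and> (\<forall>t. 0 < t \<and> t < u \<longrightarrow> s \<le> g t)" for s u
  have "dpred (\<lambda>p. P (fst p) (snd p))" unfolding P_def by (intro dpred_intros dfun_compose[OF g])
  from definable_choice[OF this] obtain H where H: "dfun H" "\<And>s u. P s u \<Longrightarrow> P s (H s)" by blast
  have PH: "P s (H s)" for s
  proof -
    have "\<forall>\<^sub>F t in at_right 0. s \<le> g t" using lim unfolding filterlim_at_top by blast
    then show ?thesis using H(2)[of s] unfolding P_def eventually_at_right_field by blast
  qed
  have "dfun (\<lambda>s. inverse (H s))" by (intro dpred_intros H(1))
  then obtain k where "\<forall>\<^sub>F s in at_top. \<bar>inverse (H s)\<bar> \<le> s ^ k" using polynomial_bound_at_top by blast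
  then obtain s0 where s0: "\<And>s. s0 \<le> s \<Longrightarrow> \<bar>inverse (H s)\<bar> \<le> s ^ k" unfolding eventually_at_top_linorder by blast
  have large: "s \<le> g t" if s: "s0 \<le> s" "0 < s" and t: "0 < t" "t < inverse (s ^ k)" for s t
  proof -
    have "0 < H s" using PH[of s] unfolding P_def by simp
    then have "inverse (s ^ k) \<le> H s" using s0[OF s(1)] s(2) by (simp add: field_simps)
    then show ?thesis using PH[of s] t unfolding P_def by auto
  qed
  have "((\<lambda>a::real. a ^ k) \<longlongrightarrow> 1 ^ k) (at_right 1)" by (intro tendsto_intros)
  then have "\<forall>\<^sub>F a::real in at_right 1. a ^ k < 3 / 2" by (rule order_tendstoD) simp
  then obtain c :: real where c: "1 < c" "\<And>a. 1 < a \<Longrightarrow> a < c \<Longrightarrow> a ^ k < 3 / 2"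
    unfolding eventually_at_right_field by blast
  define a where "a = (1 + c) / 2"
  have a: "1 < a" "a ^ k < 3 / 2" using c(1) c(2)[of a] unfolding a_def by auto
  have "\<forall>\<^sub>F t in at_right 0. g (t * inverse 2) / g t < a" by (rule order_tendstoD(2)[OF slow a(1)])
  then have "\<forall>\<^sub>F t in at_right 0. 0 < g t \<and> g (t * inverse 2) / g t < a" using pos by eventually_elim auto
  then obtain b where b: "0 < b" "\<And>t. 0 < t \<Longrightarrow> t < b \<Longrightarrow> 0 < g t \<and> g (t * inverse 2) / g t < a"
    unfolding eventually_at_right_field by blast
  define b' where "b' = min b 1 / 2"
  have b': "0 < b'" "b' < b" "b' < 1" using b(1) unfolding b'_def by auto
  define t where "t n = b' * inverse 2 ^ n" for n :: nat
  have t: "0 < t n" "t n \<le> b'" for n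
  proof -
    have "inverse 2 ^ n \<le> (1::real)" by (simp add: power_le_one)
    then have "b' * inverse 2 ^ n \<le> b' * 1" using b' by (intro mult_left_mono) auto
    then show "t n \<le> b'" unfolding t_def by simp
  qed (use b' in \<open>simp add: t_def\<close>)
  have g0: "0 < g (t 0)" using b(2)[of "t 0"] t[of 0] b' by simp
  have up: "g (t n) \<le> a ^ n * g (t 0)" for n
  proof (induction n)
    case (Suc n)
    have "0 < g (t n)" "g (t n * inverse 2) / g (t n) < a" using b(2)[of "t n"] t[of n] b' by auto
    then have "g (t n * inverse 2) \<le> a * g (t n)" by (simp add: pos_divide_less_eq)
    moreover have "t n * inverse 2 = t (Suc n)" unfolding t_def by simp
    moreover have "a * g (t n) \<le> a * (a ^ n * g (t 0))" using Suc a(1) by (intro mult_left_mono) auto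
    ultimately show ?case by (simp add: mult.assoc)
  qed simp
  have "2 ^ m \<le> (3 / 2) ^ m * g (t 0)" if m: "s0 \<le> 2 ^ m" for m
  proof -
    have "(2::real) ^ (k * m) = (2 ^ m) ^ k" by (metis power_mult mult.commute)
    then have "t (k * m) < inverse ((2 ^ m) ^ k)"
      using b' unfolding t_def by (simp add: power_inverse field_simps)
    then have "2 ^ m \<le> g (t (k * m))" using large[OF m _ t(1)] by simp
    also have "\<dots> \<le> (a ^ k) ^ m * g (t 0)" using up[of "k * m"] by (simp add: power_mult)
    also have "\<dots> \<le> (3 / 2) ^ m * g (t 0)"
      using a g0 by (intro mult_right_mono power_mono) auto
    finally show ?thesis .
  qed
  then have bound: "(4 / 3) ^ m \<le> g (t 0)" if "s0 \<le> 2 ^ m" for m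
    using that by (simp add: power_divide field_simps) (simp add: power_mult_distrib[symmetric] flip: power_mult_distrib)
  obtain m1 where m1: "s0 < 2 ^ m1" using real_arch_pow[of 2 s0] by auto
  obtain m2 where m2: "g (t 0) < (4 / 3) ^ m2" using real_arch_pow[of "4 / 3" "g (t 0)"] by auto
  define m where "m = max m1 m2"
  have "(2::real) ^ m1 \<le> 2 ^ m" "(4 / 3::real) ^ m2 \<le> (4 / 3) ^ m" unfolding m_def by (auto intro: power_increasing)
  then show False using m1 m2 bound[of m] by linarith
qed

text \<open>The limit \<open>\<phi> x\<close> of \<open>f (t * x) / f t\<close> is multiplicative in \<open>x\<close> and definable. Therefore
  \<open>\<phi> x = x powr r\<close>, and the quotient of \<open>f t\<close> by the definable function \<open>t powr r\<close> varies slowly.\<close>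

lemma definable_power_asymptotics:
  fixes f :: "real \<Rightarrow> real"
  assumes f: "dfun f" and pos: "\<forall>\<^sub>F t in at_right 0. 0 < f t"
  shows "\<exists>r c. 0 < c \<and> ((\<lambda>t. f t / t powr r) \<longlongrightarrow> c) (at_right 0)"
proof -
  define \<Phi> where "\<Phi> x l \<longleftrightarrow> (\<forall>e. 0 < e \<longrightarrow> (\<exists>b. 0 < b \<and> (\<forall>t. 0 < t \<and> t < b \<longrightarrow> \<bar>f (t * x) / f t - l\<bar> < e)))" for x l
  have \<Phi>: "\<Phi> x l \<longleftrightarrow> ((\<lambda>t. f (t * x) / f t) \<longlongrightarrow> l) (at_right 0)" for x l
    unfolding \<Phi>_def tendsto_iff dist_real_def eventually_at_right_field by blast
  have dpred_\<Phi>: "dpred (\<lambda>p. \<Phi> (fst p) (snd p))"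
    unfolding \<Phi>_def by (intro dpred_intros dfun_compose[OF f])
  have "\<forall>x. \<exists>l. 0 < x \<longrightarrow> 0 < l \<and> \<Phi> x l" using ratio_limit[OF f pos] unfolding \<Phi> by blast
  then obtain \<phi> where \<phi>: "\<And>x. 0 < x \<Longrightarrow> 0 < \<phi> x" "\<And>x. 0 < x \<Longrightarrow> \<Phi> x (\<phi> x)" by metis
  have unique: "l = \<phi> x" if "\<Phi> x l" "0 < x" for x l
    using tendsto_unique[OF trivial_limit_at_right_real] that \<phi>(2)[OF that(2)] unfolding \<Phi> by blast
  have \<phi>_mult: "\<phi> (x * y) = \<phi> x * \<phi> y" if x: "0 < x" and y: "0 < y" for x y
  proof -
    have "((\<lambda>t. f (t * x * y) / f (t * x)) \<longlongrightarrow> \<phi> y) (at_right 0)"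
      using filterlim_compose[OF \<phi>(2)[OF y, unfolded \<Phi>] filterlim_mult_at_right_0[OF x]] .
    then have "((\<lambda>t. f (t * x) / f t * (f (t * x * y) / f (t * x))) \<longlongrightarrow> \<phi> x * \<phi> y) (at_right 0)"
      using \<phi>(2)[OF x] unfolding \<Phi> by (intro tendsto_mult)
    moreover have "\<forall>\<^sub>F t in at_right 0. f (t * x) / f t * (f (t * x * y) / f (t * x)) = f (t * (x * y)) / f t"
      using eventually_mult_at_right_0[OF x pos] by eventually_elim (simp add: mult.assoc)
    ultimately have "\<Phi> (x * y) (\<phi> x * \<phi> y)" unfolding \<Phi> by (rule Lim_transform_eventually)
    then show ?thesis using unique x y by simp
  qed
  have \<phi>_pow: "\<phi> (x ^ Suc n) = \<phi> x ^ Suc n" if "0 < x" for x n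
    by (induction n) (use that in \<open>simp_all add: \<phi>_mult\<close>)
  define a where "a s = ln (\<phi> (exp s))" for s
  have a_add: "a (s + t) = a s + a t" for s t
    using \<phi>(1)[of "exp s"] \<phi>(1)[of "exp t"] by (simp add: a_def exp_add \<phi>_mult ln_mult)
  have a_neg: "a (- s) = - a s" for s using a_add[of s "- s"] a_add[of 0 0] by simp
  have "dpred (\<lambda>x. \<exists>l. \<Phi> x l \<and> 1 \<le> l)" by (intro dpred_intros dpred_rel[OF dpred_\<Phi>])
  then have "(\<forall>\<^sub>F x in at_right 0. \<exists>l. \<Phi> x l \<and> 1 \<le> l) \<or> (\<forall>\<^sub>F x in at_right 0. \<not> (\<exists>l. \<Phi> x l \<and> 1 \<le> l))"
    using decides_at_right unfolding decides_def by blast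
  then have "(\<forall>\<^sub>F x in at_right 0. 1 \<le> \<phi> x) \<or> (\<forall>\<^sub>F x in at_right 0. \<phi> x \<le> 1)"
  proof (elim disj_forward)
    assume "\<forall>\<^sub>F x in at_right 0. \<exists>l. \<Phi> x l \<and> 1 \<le> l"
    then show "\<forall>\<^sub>F x in at_right 0. 1 \<le> \<phi> x"
      using eventually_at_right_less[of 0] by eventually_elim (use unique in auto)
  next
    assume "\<forall>\<^sub>F x in at_right 0. \<not> (\<exists>l. \<Phi> x l \<and> 1 \<le> l)"
    then show "\<forall>\<^sub>F x in at_right 0. \<phi> x \<le> 1"
      using eventually_at_right_less[of 0]
      by eventually_elim (use \<phi>(2) in \<open>force simp: not_le\<close>)
  qed
  then obtain b where b: "0 < b" "(\<forall>x. 0 < x \<and> x < b \<longrightarrow> 1 \<le> \<phi> x) \<or> (\<forall>x. 0 < x \<and> x < b \<longrightarrow> \<phi> x \<le> 1)"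
    unfolding eventually_at_right_field by blast
  have small: "\<exists>n. 0 < x ^ Suc n \<and> x ^ Suc n < b" if x: "0 < x" "x < 1" for x
  proof -
    obtain n where n: "x ^ n < b" using real_arch_pow_inv[OF b(1) x(2)] by blast
    have "x ^ Suc n \<le> x ^ n" using x by (intro power_decreasing) auto
    then have "x ^ Suc n < b" using n by (rule le_less_trans)
    then show ?thesis using zero_less_power[OF x(1)] by blast
  qed
  have a_linear: "a s = s * a 1" for s
    using b(2)
  proof
    assume ge: "\<forall>x. 0 < x \<and> x < b \<longrightarrow> 1 \<le> \<phi> x"
    have "1 \<le> \<phi> x" if x: "0 < x" "x < 1" for x
    proof (rule ccontr)
      assume "\<not> 1 \<le> \<phi> x"
      moreover obtain n where "0 < x ^ Suc n" "x ^ Suc n < b" using small[OF x] by blast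
      ultimately show False
        using ge[rule_format, of "x ^ Suc n"] \<phi>_pow[OF x(1), of n] \<phi>(1)[OF x(1)]
          power_less_one_iff[of "\<phi> x" "Suc n"] by (simp del: power_Suc)
    qed
    then have nonneg: "0 \<le> a (- s)" if "0 < s" for s using that unfolding a_def by simp
    have "0 \<le> - a s" if "0 \<le> s" for s using that nonneg[of s] a_neg[of s] a_add[of 0 0] by (cases "s = 0") auto
    moreover have "- a (s + t) = - a s + - a t" for s t using a_add[of s t] by simp
    ultimately have "- a s = s * - a 1" by (intro additive_nonneg_imp_linear[of "\<lambda>s. - a s"])
    then show ?thesis by simp
  next
    assume le: "\<forall>x. 0 < x \<and> x < b \<longrightarrow> \<phi> x \<le> 1"
    have "\<phi> x \<le> 1" if x: "0 < x" "x < 1" for x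
    proof (rule ccontr)
      assume "\<not> \<phi> x \<le> 1"
      then have "1 < \<phi> x ^ Suc n" for n by (intro one_less_power) auto
      moreover obtain n where "0 < x ^ Suc n" "x ^ Suc n < b" using small[OF x] by blast
      ultimately show False
        using le[rule_format, of "x ^ Suc n"] \<phi>_pow[OF x(1), of n]
        by (metis not_le)
    qed
    then have nonpos: "a (- s) \<le> 0" if "0 < s" for s using that \<phi>(1)[of "exp (- s)"] unfolding a_def by simp
    have "0 \<le> a s" if "0 \<le> s" for s using that nonpos[of s] a_neg[of s] a_add[of 0 0] by (cases "s = 0") auto
    from additive_nonneg_imp_linear[OF a_add this] show ?thesis .
  qed
  define r where "r = a 1"
  have \<phi>_powr: "\<phi> x = x powr r" if x: "0 < x" for x
  proof -
    have "\<phi> x = exp (a (ln x))" using \<phi>(1)[OF x] x by (simp add: a_def)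
    then show ?thesis using a_linear[of "ln x"] x by (simp add: r_def powr_def mult.commute)
  qed
  define pw where "pw x = (if 0 < x then x powr r else 0)" for x
  have "dpred (\<lambda>p. (0 < fst p \<and> \<Phi> (fst p) (snd p)) \<or> (\<not> 0 < fst p \<and> snd p = 0))"
    by (intro dpred_intros dpred_rel[OF dpred_\<Phi>])
  moreover have "(0 < x \<and> \<Phi> x l) \<or> (\<not> 0 < x \<and> l = 0) \<longleftrightarrow> l = pw x" for x l
    using unique[of x l] \<phi>(2)[of x] \<phi>_powr[of x] unfolding pw_def by auto
  ultimately have pw: "dfun pw" unfolding dfun_def by simp
  define g where "g t = f t / pw t" for t
  have g: "dfun g" unfolding g_def by (intro dpred_intros f pw)
  have g_pos: "\<forall>\<^sub>F t in at_right 0. 0 < g t"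
    using pos eventually_at_right_less[of 0] by eventually_elim (simp add: g_def pw_def)
  have slow: "((\<lambda>t. g (t * inverse 2) / g t) \<longlongrightarrow> 1) (at_right 0)"
  proof -
    have "((\<lambda>t. f (t * inverse 2) / f t) \<longlongrightarrow> \<phi> (inverse 2)) (at_right 0)" using \<phi>(2)[of "inverse 2"] unfolding \<Phi> by simp
    then have "((\<lambda>t. f (t * inverse 2) / f t / \<phi> (inverse 2)) \<longlongrightarrow> \<phi> (inverse 2) / \<phi> (inverse 2)) (at_right 0)"
      using \<phi>(1)[of "inverse 2"] by (intro tendsto_intros) auto
    moreover have "\<phi> (inverse 2) / \<phi> (inverse 2) = 1" using \<phi>(1)[of "inverse 2"] by simp
    moreover have "\<forall>\<^sub>F t in at_right 0. f (t * inverse 2) / f t / \<phi> (inverse 2) = g (t * inverse 2) / g t"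
      using eventually_at_right_less[of 0]
    proof eventually_elim
      case (elim t)
      have "(t * inverse 2) powr r = t powr r * \<phi> (inverse 2)"
        using elim \<phi>_powr[of "inverse 2"] by (subst powr_mult) auto
      then have "g (t * inverse 2) / g t = f (t * inverse 2) / (t powr r * \<phi> (inverse 2)) / (f t / t powr r)"
        using elim unfolding g_def pw_def by simp
      also have "\<dots> = f (t * inverse 2) / f t / \<phi> (inverse 2)" using elim by simp
      finally show ?case by (rule sym)
    qed
    ultimately show ?thesis using Lim_transform_eventually by fastforce
  qed
  obtain L where L: "((\<lambda>t. ereal (g t)) \<longlongrightarrow> L) (at_right 0)"
    using definable_limit[OF decides_at_right g] by blast
  have "0 \<le> L"
    by (rule tendsto_lowerbound[OF L]) (use g_pos in \<open>auto elim!: eventually_mono\<close>)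
  moreover have "L \<noteq> \<infinity>"
    using slowly_varying_not_at_top[OF g g_pos slow] L by (auto simp: tendsto_PInfty_eq_at_top)
  moreover have "L \<noteq> 0"
  proof
    assume "L = 0"
    then have "(g \<longlongrightarrow> 0) (at_right 0)" using L by (simp add: zero_ereal_def)
    then have "filterlim (\<lambda>t. inverse (g t)) at_top (at_right 0)"
      by (rule filterlim_inverse_at_top) (rule g_pos)
    moreover have "dfun (\<lambda>t. inverse (g t))" by (intro dpred_intros g)
    moreover have "\<forall>\<^sub>F t in at_right 0. 0 < inverse (g t)" using g_pos by eventually_elim simp
    moreover have "((\<lambda>t. inverse (g (t * inverse 2)) / inverse (g t)) \<longlongrightarrow> 1) (at_right 0)"
      using tendsto_inverse[OF slow one_neq_zero] by (simp only: inverse_1 divide_inverse inverse_mult_distrib inverse_inverse_eq mult.commute)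
    ultimately show False using slowly_varying_not_at_top[of "\<lambda>t. inverse (g t)"] by blast
  qed
  ultimately obtain c where c: "L = ereal c" "0 < c" by (cases L) (auto simp: zero_ereal_def)
  then have "(g \<longlongrightarrow> c) (at_right 0)" using L by simp
  moreover have "\<forall>\<^sub>F t in at_right 0. g t = f t / t powr r"
    using eventually_at_right_less[of 0] by eventually_elim (simp add: g_def pw_def)
  ultimately have "((\<lambda>t. f t / t powr r) \<longlongrightarrow> c) (at_right 0)" by (rule Lim_transform_eventually)
  then show ?thesis using c(2) by blast
qed

end

section \<open>Arcs and tangency orders\<close>

lemma is_arc_norm: "is_arc S \<gamma> \<Longrightarrow> \<forall>\<^sub>F t in at_right 0. norm (\<gamma> t) = t"
  unfolding is_arc_def eventually_at_right_field by auto

lemma is_arc_0: "is_arc S \<gamma> \<Longrightarrow> \<gamma> 0 = 0"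
  unfolding is_arc_def by auto

lemma powr_rate_unique:
  fixes n :: "real \<Rightarrow> real"
  assumes "((\<lambda>t. n t / t powr q) \<longlongrightarrow> c) (at_right 0)" "((\<lambda>t. n t / t powr p) \<longlongrightarrow> d) (at_right 0)"
    and "d \<noteq> 0"
  shows "q \<le> p"
proof (rule ccontr)
  assume "\<not> q \<le> p"
  then have "((\<lambda>t::real. t powr (q - p)) \<longlongrightarrow> 0) (at_right 0)"
    by (intro tendsto_zero_powrI[where b = "q - p"] tendsto_intros)
      (auto simp: eventually_at_right_field intro!: exI[of _ 1])
  then have "((\<lambda>t. n t / t powr q * t powr (q - p)) \<longlongrightarrow> c * 0) (at_right 0)"
    by (rule tendsto_mult[OF assms(1)])
  moreover have "\<forall>\<^sub>F t in at_right 0. n t / t powr q * t powr (q - p) = n t / t powr p"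
    using eventually_at_right_less[of 0] by eventually_elim (simp add: powr_diff)
  ultimately have "((\<lambda>t. n t / t powr p) \<longlongrightarrow> c * 0) (at_right 0)" by (rule Lim_transform_eventually)
  then show False using tendsto_unique[OF _ assms(2)] assms(3) by simp
qed

lemma smallo_powr_iff:
  fixes n :: "real \<Rightarrow> real"
  shows "(\<lambda>t. n t - c * t powr q) \<in> o[at_right 0](\<lambda>t. t powr q) \<longleftrightarrow>
    ((\<lambda>t. n t / t powr q) \<longlongrightarrow> c) (at_right 0)"
proof -
  have ev: "\<forall>\<^sub>F t in at_right 0. (n t - c * t powr q) / t powr q = n t / t powr q - c"
    using eventually_at_right_less[of 0] by eventually_elim (simp add: field_simps)
  have "(\<lambda>t. n t - c * t powr q) \<in> o[at_right 0](\<lambda>t. t powr q) \<longleftrightarrow>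
      ((\<lambda>t. (n t - c * t powr q) / t powr q) \<longlongrightarrow> 0) (at_right 0)"
  proof
    assume "((\<lambda>t. (n t - c * t powr q) / t powr q) \<longlongrightarrow> 0) (at_right 0)"
    then show "(\<lambda>t. n t - c * t powr q) \<in> o[at_right 0](\<lambda>t. t powr q)"
    proof (rule smalloI_tendsto)
      show "\<forall>\<^sub>F t in at_right 0. t powr q \<noteq> 0"
        using eventually_at_right_less[of 0] by eventually_elim simp
    qed
  qed (rule smalloD_tendsto)
  also have "\<dots> \<longleftrightarrow> ((\<lambda>t. n t / t powr q - c) \<longlongrightarrow> 0) (at_right 0)" by (rule tendsto_cong[OF ev])
  also have "\<dots> \<longleftrightarrow> ((\<lambda>t. n t / t powr q) \<longlongrightarrow> c) (at_right 0)" by (rule LIM_zero_iff)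
  finally show ?thesis .
qed

context o_minimal_structure
begin

lemma arc_representative:
  assumes "is_arc S \<gamma>" shows "\<exists>\<delta>. dfun \<delta> \<and> (\<forall>\<^sub>F t in at_right 0. \<delta> t = \<gamma> t)"
proof -
  obtain e where e: "e > 0" "definable S {(t, \<gamma> t) | t. 0 \<le> t \<and> t < e}"
    using assms unfolding is_arc_def by blast
  define \<delta> where "\<delta> t = (if 0 \<le> t \<and> t < e then \<gamma> t else 0)" for t
  have "dpred (\<lambda>p. p \<in> {(t, \<gamma> t) | t. 0 \<le> t \<and> t < e} \<or> (\<not> (0 \<le> fst p \<and> fst p < e) \<and> snd p = 0))"
    by (intro dpred_intros dpred_mem[OF e(2)])
  moreover have "p \<in> {(t, \<gamma> t) | t. 0 \<le> t \<and> t < e} \<or> (\<not> (0 \<le> fst p \<and> fst p < e) \<and> snd p = 0) \<longleftrightarrow>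
      snd p = \<delta> (fst p)" for p
    unfolding \<delta>_def by (cases p) auto
  ultimately have "dfun \<delta>" unfolding dfun_def by simp
  moreover have "\<forall>\<^sub>F t in at_right 0. \<delta> t = \<gamma> t"
    unfolding eventually_at_right_field \<delta>_def using e(1) by auto
  ultimately show ?thesis by blast
qed

lemma is_arcI:
  assumes f: "dfun f" and norm: "\<forall>\<^sub>F t in at_right 0. norm (f t) = t"
  shows "is_arc S (\<lambda>t. if 0 < t then f t else 0)" (is "is_arc S ?\<gamma>")
proof -
  obtain b where b: "b > 0" "\<And>t. 0 < t \<Longrightarrow> t < b \<Longrightarrow> norm (f t) = t"
    using norm unfolding eventually_at_right_field by blast
  have \<gamma>: "dfun ?\<gamma>" by (intro dfun_if dpred_intros f)
  have "dpred (\<lambda>p. snd p = ?\<gamma> (fst p) \<and> 0 \<le> fst p \<and> fst p < b)"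
    by (intro dpred_intros dfun_compose[OF \<gamma>])
  moreover have "{p. snd p = ?\<gamma> (fst p) \<and> 0 \<le> fst p \<and> fst p < b} = {(t, ?\<gamma> t) | t. 0 \<le> t \<and> t < b}"
    by (auto simp: prod_eq_iff)
  ultimately have "definable S {(t, ?\<gamma> t) | t. 0 \<le> t \<and> t < b}" unfolding dpred_def by simp
  then show ?thesis unfolding is_arc_def using b by (intro exI[of _ b]) auto
qed

text \<open>Since the choice is made on each sphere, the selected function is parametrized by the norm from the start.\<close>

lemma arc_selection:
  fixes P :: "real \<Rightarrow> 'a::euclidean_space \<Rightarrow> bool"
  assumes P: "dpred (\<lambda>p. P (fst p) (snd p))" and ex: "\<forall>\<^sub>F t in at_right 0. \<exists>x. norm x = t \<and> P t x"
  shows "\<exists>\<gamma>. is_arc S \<gamma> \<and> (\<forall>\<^sub>F t in at_right 0. P t (\<gamma> t))"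
proof -
  have "dpred (\<lambda>p. norm (snd p) = fst p \<and> P (fst p) (snd p))" by (intro dpred_intros P)
  from definable_choice[of "\<lambda>t x. norm x = t \<and> P t x", OF this]
  obtain f where f: "dfun f" "\<And>t x. norm x = t \<and> P t x \<Longrightarrow> norm (f t) = t \<and> P t (f t)" by blast
  have ev: "\<forall>\<^sub>F t in at_right 0. norm (f t) = t \<and> P t (f t)"
    using ex by eventually_elim (use f(2) in blast)
  have "is_arc S (\<lambda>t. if 0 < t then f t else 0)"
    using ev by (intro is_arcI f(1)) (auto elim: eventually_mono)
  moreover have "\<forall>\<^sub>F t in at_right 0. P t (if 0 < t then f t else 0)"
    using ev eventually_at_right_less[of 0] by eventually_elim simp
  ultimately show ?thesis by blast
qed

text \<open>A point of \<open>Y\<close> can be moved within \<open>Y\<close> to any comparable distance from the origin, at a cost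
  proportional to the change of that distance. Otherwise an arc through exceptional points, whose own
  points have to be too far apart, violates the uniform Lipschitz bound.\<close>

lemma definable_germ_radial:
  fixes Y :: "'a::euclidean_space set"
  assumes Y: "definable_germ S Y"
  shows "\<exists>K>0. \<exists>b>0. \<forall>y\<in>Y. \<forall>s. norm y < b \<and> 0 < s \<and> s < 2 * norm y \<longrightarrow>
    (\<exists>y'\<in>Y. norm y' = s \<and> norm (y - y') \<le> K * \<bar>norm y - s\<bar>)"
proof -
  obtain e where e: "e > 0" "definable S (Y \<inter> ball 0 e)" using Y unfolding definable_germ_def by blast
  define Z where "Z = Y \<inter> ball 0 e"
  have Z: "definable S Z" using e(2) unfolding Z_def .
  define K where "K = 2 * real DIM('a)"
  have K: "0 < K" unfolding K_def by simp
  define P where "P t y \<longleftrightarrow> y \<in> Z \<and> (\<exists>s. 0 < s \<and> s < 2 * t \<and>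
      (\<forall>y'. y' \<in> Z \<and> norm y' = s \<longrightarrow> K * \<bar>t - s\<bar> < norm (y - y')))" for t y
  have P: "dpred (\<lambda>p. P (fst p) (snd p))"
    unfolding P_def by (intro dpred_intros dpred_mem[OF Z])
  have "\<not> (\<forall>\<^sub>F t in at_right 0. \<exists>y. norm y = t \<and> P t y)"
  proof
    assume "\<forall>\<^sub>F t in at_right 0. \<exists>y. norm y = t \<and> P t y"
    then obtain \<gamma> where \<gamma>: "is_arc S \<gamma>" and P\<gamma>: "\<forall>\<^sub>F t in at_right 0. P t (\<gamma> t)" using arc_selection[OF P] by blast
    obtain \<delta> where \<delta>: "dfun \<delta>" "\<forall>\<^sub>F t in at_right 0. \<delta> t = \<gamma> t" using arc_representative[OF \<gamma>] by blast
    have "\<forall>\<^sub>F t in at_right 0. norm (\<delta> t) = t" using \<delta>(2) is_arc_norm[OF \<gamma>] by eventually_elim simp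
    from arc_Lipschitz[OF \<delta>(1) this] obtain b where b: "b > 0"
      "\<And>s t. 0 < s \<Longrightarrow> s < b \<Longrightarrow> 0 < t \<Longrightarrow> t < b \<Longrightarrow> norm (\<delta> s - \<delta> t) \<le> K * \<bar>s - t\<bar>"
      unfolding K_def by blast
    have "\<forall>\<^sub>F t in at_right 0. norm (\<delta> t) = t \<and> P t (\<delta> t)"
      using P\<gamma> \<delta>(2) is_arc_norm[OF \<gamma>] by eventually_elim simp
    then obtain c where c: "c > 0" "\<And>t. 0 < t \<Longrightarrow> t < c \<Longrightarrow> norm (\<delta> t) = t \<and> P t (\<delta> t)"
      unfolding eventually_at_right_field by blast
    define t where "t = min b c / 4"
    have t: "0 < t" "2 * t < b" "2 * t < c" using b(1) c(1) unfolding t_def by auto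
    have "P t (\<delta> t)" using c(2)[of t] t by simp
    then obtain s where s: "0 < s" "s < 2 * t"
      "\<And>y'. y' \<in> Z \<Longrightarrow> norm y' = s \<Longrightarrow> K * \<bar>t - s\<bar> < norm (\<delta> t - y')"
      unfolding P_def by blast
    have "norm (\<delta> s) = s" "P s (\<delta> s)" using c(2)[of s] s t by auto
    then have "K * \<bar>t - s\<bar> < norm (\<delta> t - \<delta> s)" using s(3) unfolding P_def by blast
    moreover have "norm (\<delta> t - \<delta> s) \<le> K * \<bar>t - s\<bar>" using b(2)[of t s] s t by simp
    ultimately show False by simp
  qed
  moreover have "dpred (\<lambda>t. \<exists>y. norm y = t \<and> P t y)" by (intro dpred_intros dpred_rel[OF P])
  ultimately have "\<forall>\<^sub>F t in at_right 0. \<not> (\<exists>y. norm y = t \<and> P t y)"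
    using decides_at_right unfolding decides_def by blast
  then obtain b where b: "b > 0" "\<And>y. 0 < norm y \<Longrightarrow> norm y < b \<Longrightarrow> \<not> P (norm y) y"
    unfolding eventually_at_right_field by blast
  have "\<exists>y'\<in>Y. norm y' = s \<and> norm (y - y') \<le> K * \<bar>norm y - s\<bar>"
    if y: "y \<in> Y" "norm y < min b e" and s: "0 < s" "s < 2 * norm y" for y s
  proof -
    have "0 < norm y" using s by linarith
    then have "\<not> P (norm y) y" "y \<in> Z" using b(2)[of y] y unfolding Z_def by auto
    then obtain y' where "y' \<in> Z" "norm y' = s" "\<not> K * \<bar>norm y - s\<bar> < norm (y - y')"
      using s unfolding P_def by blast
    then show ?thesis unfolding Z_def by auto
  qed
  then show ?thesis using K b(1) e(1) by (intro exI[of _ K] conjI exI[of _ "min b e"]) auto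
qed

end

context polynomially_bounded_o_minimal_structure
begin

text \<open>In particular the exponent in the definition of the tangency order exists; it is unique because two different
  powers are not comparable.\<close>

lemma tord_asymptotics:
  assumes \<gamma>: "is_arc S \<gamma>" and \<gamma>': "is_arc S \<gamma>'"
  shows "(\<forall>\<^sub>F t in at_right 0. \<gamma> t = \<gamma>' t) \<or>
    (\<exists>q c. 0 < c \<and> tord \<gamma> \<gamma>' = ereal q \<and> ((\<lambda>t. norm (\<gamma> t - \<gamma>' t) / t powr q) \<longlongrightarrow> c) (at_right 0))"
proof -
  obtain \<delta> where \<delta>: "dfun \<delta>" "\<forall>\<^sub>F t in at_right 0. \<delta> t = \<gamma> t" using arc_representative[OF \<gamma>] by blast
  obtain \<delta>' where \<delta>': "dfun \<delta>'" "\<forall>\<^sub>F t in at_right 0. \<delta>' t = \<gamma>' t" using arc_representative[OF \<gamma>'] by blast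
  define n where "n t = norm (\<delta> t - \<delta>' t)" for t
  have n: "dfun n" unfolding n_def by (intro dpred_intros \<delta> \<delta>')
  have n_eq: "\<forall>\<^sub>F t in at_right 0. n t = norm (\<gamma> t - \<gamma>' t)"
    using \<delta>(2) \<delta>'(2) by eventually_elim (simp add: n_def)
  have "dpred (\<lambda>t. 0 < n t)" by (intro dpred_intros n)
  then have "(\<forall>\<^sub>F t in at_right 0. 0 < n t) \<or> (\<forall>\<^sub>F t in at_right 0. \<not> 0 < n t)"
    using decides_at_right unfolding decides_def by blast
  then show ?thesis
  proof
    assume pos: "\<forall>\<^sub>F t in at_right 0. 0 < n t"
    obtain q c where c: "0 < c" "((\<lambda>t. n t / t powr q) \<longlongrightarrow> c) (at_right 0)"
      using definable_power_asymptotics[OF n pos] by blast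
    have "\<forall>\<^sub>F t in at_right 0. n t / t powr q = norm (\<gamma> t - \<gamma>' t) / t powr q"
      using n_eq by eventually_elim simp
    with c(2) have lim: "((\<lambda>t. norm (\<gamma> t - \<gamma>' t) / t powr q) \<longlongrightarrow> c) (at_right 0)"
      by (rule Lim_transform_eventually)
    have ne: "\<not> (\<forall>\<^sub>F t in at_right 0. \<gamma> t = \<gamma>' t)"
    proof
      assume "\<forall>\<^sub>F t in at_right 0. \<gamma> t = \<gamma>' t"
      then have "\<forall>\<^sub>F t in at_right (0::real). False" using pos n_eq by eventually_elim simp
      then show False by simp
    qed
    have "(THE q. \<exists>c. c \<noteq> 0 \<and> ((\<lambda>t. norm (\<gamma> t - \<gamma>' t) / t powr q) \<longlongrightarrow> c) (at_right 0)) = q"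
    proof (rule the_equality)
      show "\<exists>c. c \<noteq> 0 \<and> ((\<lambda>t. norm (\<gamma> t - \<gamma>' t) / t powr q) \<longlongrightarrow> c) (at_right 0)"
        using lim c(1) by (intro exI[of _ c]) simp
      fix p assume "\<exists>c. c \<noteq> 0 \<and> ((\<lambda>t. norm (\<gamma> t - \<gamma>' t) / t powr p) \<longlongrightarrow> c) (at_right 0)"
      then obtain d where d: "d \<noteq> 0" "((\<lambda>t. norm (\<gamma> t - \<gamma>' t) / t powr p) \<longlongrightarrow> d) (at_right 0)" by blast
      show "p = q" using powr_rate_unique[OF lim d(2,1)] powr_rate_unique[OF d(2) lim] c(1) by simp
    qed
    then have "tord \<gamma> \<gamma>' = ereal q" unfolding tord_def smallo_powr_iff using ne by simp
    then show ?thesis using lim c(1) by blast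
  next
    assume "\<forall>\<^sub>F t in at_right 0. \<not> 0 < n t"
    then have "\<forall>\<^sub>F t in at_right 0. \<gamma> t = \<gamma>' t" using n_eq by eventually_elim simp
    then show ?thesis by blast
  qed
qed

lemma norm_le_of_tord_le:
  assumes arcs: "is_arc S \<gamma>1" "is_arc S \<gamma>2" "is_arc S \<gamma>3" "is_arc S \<gamma>4"
    and le: "tord \<gamma>1 \<gamma>2 \<le> tord \<gamma>3 \<gamma>4"
  shows "\<exists>C>0. \<forall>\<^sub>F t in at_right 0. norm (\<gamma>3 t - \<gamma>4 t) \<le> C * norm (\<gamma>1 t - \<gamma>2 t)"
  using tord_asymptotics[OF arcs(3,4)]
proof
  assume "\<forall>\<^sub>F t in at_right 0. \<gamma>3 t = \<gamma>4 t"
  then have "\<forall>\<^sub>F t in at_right 0. norm (\<gamma>3 t - \<gamma>4 t) \<le> 1 * norm (\<gamma>1 t - \<gamma>2 t)" by eventually_elim simp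
  then show ?thesis using zero_less_one by blast
next
  assume "\<exists>q c. 0 < c \<and> tord \<gamma>3 \<gamma>4 = ereal q \<and> ((\<lambda>t. norm (\<gamma>3 t - \<gamma>4 t) / t powr q) \<longlongrightarrow> c) (at_right 0)"
  then obtain q d where q: "0 < d" "tord \<gamma>3 \<gamma>4 = ereal q"
    "((\<lambda>t. norm (\<gamma>3 t - \<gamma>4 t) / t powr q) \<longlongrightarrow> d) (at_right 0)" by blast
  have "\<not> (\<forall>\<^sub>F t in at_right 0. \<gamma>1 t = \<gamma>2 t)" using le q(2) unfolding tord_def[of \<gamma>1] by auto
  then obtain p c where p: "0 < c" "tord \<gamma>1 \<gamma>2 = ereal p"
    "((\<lambda>t. norm (\<gamma>1 t - \<gamma>2 t) / t powr p) \<longlongrightarrow> c) (at_right 0)"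
    using tord_asymptotics[OF arcs(1,2)] by blast
  have pq: "p \<le> q" using le p(2) q(2) by simp
  have 1: "\<forall>\<^sub>F t in at_right 0. norm (\<gamma>3 t - \<gamma>4 t) / t powr q < 2 * d"
    by (rule order_tendstoD(2)[OF q(3)]) (use q(1) in simp)
  have 2: "\<forall>\<^sub>F t in at_right 0. c / 2 < norm (\<gamma>1 t - \<gamma>2 t) / t powr p"
    by (rule order_tendstoD(1)[OF p(3)]) (use p(1) in simp)
  have 3: "\<forall>\<^sub>F t::real in at_right 0. 0 < t \<and> t < 1" unfolding eventually_at_right_field by (intro exI[of _ 1]) auto
  have "\<forall>\<^sub>F t in at_right 0. norm (\<gamma>3 t - \<gamma>4 t) \<le> 4 * d / c * norm (\<gamma>1 t - \<gamma>2 t)"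
    using 1 2 3
  proof eventually_elim
    case (elim t)
    have "t powr q \<le> t powr p" using elim(3) pq by (intro powr_mono') auto
    have "norm (\<gamma>3 t - \<gamma>4 t) \<le> 2 * d * t powr q" using elim(1,3) by (simp add: pos_divide_less_eq)
    also have "\<dots> \<le> 2 * d * t powr p" using \<open>t powr q \<le> t powr p\<close> q(1) by simp
    also have "\<dots> = 4 * d / c * (c / 2 * t powr p)" using p(1) by simp
    also have "\<dots> \<le> 4 * d / c * norm (\<gamma>1 t - \<gamma>2 t)"
      using elim(2,3) p(1) q(1) by (intro mult_left_mono) (simp_all add: pos_less_divide_eq)
    finally show ?case .
  qed
  then show ?thesis using p(1) q(1) by (intro exI[of _ "4 * d / c"]) simp
qed

text \<open>The hypothesis says that the arc \<open>\<mu>\<close> realizes the distance to \<open>Y\<close> from every arc in \<open>X\<close> up to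
  the exponent. If no constant \<open>C\<close> worked, then definable choice would give arcs \<open>\<gamma>\<close> in \<open>X\<close> and
  \<open>\<eta>\<close> in \<open>Y\<close> such that \<open>norm (\<gamma> t - \<mu> t) / norm (\<gamma> t - \<eta> t)\<close> is unbounded, whereas
  \<open>tord \<gamma> \<eta> \<le> tord \<mu> \<gamma>\<close>. For \<open>w t\<close> below, half of it is an admissible factor at \<open>t\<close>; the condition
  \<open>1 \<le> c * t\<close> makes \<open>w t\<close> finite.\<close>

lemma dist_arc_le_same_norm:
  fixes X Y :: "'a::euclidean_space set"
  assumes X: "definable_germ S X" and Y: "definable_germ S Y" and \<mu>: "is_arc S \<mu>"
    and tord: "\<And>\<gamma>. is_arc S \<gamma> \<Longrightarrow> arc_in \<gamma> X \<Longrightarrow> tord \<mu> \<gamma> = tord_set S \<gamma> Y"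
  shows "\<exists>C>0. \<exists>b>0. \<forall>x\<in>X. \<forall>y\<in>Y. norm x < b \<and> norm y = norm x \<longrightarrow>
    norm (x - \<mu> (norm x)) \<le> C * norm (x - y)"
proof -
  obtain e where e: "e > 0" "definable S (X \<inter> ball 0 e)" using X unfolding definable_germ_def by blast
  obtain e' where e': "e' > 0" "definable S (Y \<inter> ball 0 e')" using Y unfolding definable_germ_def by blast
  define X' where "X' = X \<inter> ball 0 e"
  define Y' where "Y' = Y \<inter> ball 0 e'"
  note X' = e(2)[folded X'_def] and Y' = e'(2)[folded Y'_def]
  obtain \<nu> where \<nu>: "dfun \<nu>" "\<forall>\<^sub>F t in at_right 0. \<nu> t = \<mu> t" using arc_representative[OF \<mu>] by blast
  define R where "R c t p \<longleftrightarrow> fst p \<in> X' \<and> snd p \<in> Y' \<and> norm (fst p) = t \<and> norm (snd p) = t \<and>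
      c * norm (fst p - snd p) < norm (fst p - \<nu> t)" for c t p
  define P where "P c t \<longleftrightarrow> (\<exists>p. R c t p)" for c t
  have P: "dpred (\<lambda>q. P (fst q) (snd q))"
    unfolding P_def R_def by (intro dpred_intros dpred_mem[OF X'] dpred_mem[OF Y'] dfun_compose[OF \<nu>(1)])
  have P_mono: "P c t" if "P d t" "c \<le> d" for c d t
  proof -
    obtain p where p: "R d t p" using \<open>P d t\<close> unfolding P_def by blast
    have "c * norm (fst p - snd p) \<le> d * norm (fst p - snd p)" using that(2) by (intro mult_right_mono) auto
    then have "R c t p" using p unfolding R_def by auto
    then show ?thesis unfolding P_def by blast
  qed
  have "\<exists>c\<ge>0. \<forall>\<^sub>F t in at_right 0. \<not> P c t"
  proof (rule ccontr)
    assume "\<not> (\<exists>c\<ge>0. \<forall>\<^sub>F t in at_right 0. \<not> P c t)"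
    moreover have "dpred (P c)" for c by (rule dpred_rel[OF P dfun_const dfun_id])
    ultimately have evP: "\<forall>\<^sub>F t in at_right 0. P c t" if "0 \<le> c" for c
      using eventually_if_frequently[OF decides_at_right] that by blast
    define W where "W t c \<longleftrightarrow> 0 < c \<and> (\<not> P c t \<or> 1 \<le> c * t)" for t c
    have W: "dpred (\<lambda>q. W (fst q) (snd q))" unfolding W_def by (intro dpred_intros dpred_rel[OF P])
    define w where "w t = (if \<exists>c. W t c then Inf {c. W t c} else 0)" for t
    have w: "dfun w" unfolding w_def by (rule dfun_Inf[OF W]) (simp add: W_def)
    have W_ex: "W t (1 / t)" if "0 < t" for t using that unfolding W_def by simp
    have w_large: "\<forall>\<^sub>F t in at_right 0. c \<le> w t" if c: "0 < c" for c
    proof -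
      have "\<forall>\<^sub>F t::real in at_right 0. 0 < t \<and> t < 1 / c"
        unfolding eventually_at_right_field using c by (intro exI[of _ "1 / c"]) auto
      then show ?thesis using evP[OF less_imp_le[OF c]]
      proof eventually_elim
        case (elim t)
        have t: "0 < t" "c * t < 1" using elim(1) c by (auto simp: field_simps)
        have "c \<le> c'" if "W t c'" for c'
        proof (rule ccontr)
          assume "\<not> c \<le> c'"
          then have "c' \<le> c" "c' * t \<le> c * t" using t(1) by auto
          then show False using that P_mono[OF elim(2), of c'] t(2) unfolding W_def by auto
        qed
        then have "c \<le> Inf {c. W t c}" using W_ex[OF t(1)] by (intro cInf_greatest) auto
        then show ?case using W_ex[OF t(1)] unfolding w_def by auto
      qed
    qed
    have half: "\<forall>\<^sub>F t in at_right 0. P (w t / 2) t"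
      using w_large[OF zero_less_one] eventually_at_right_less[of 0]
    proof eventually_elim
      case (elim t)
      have "bdd_below {c. W t c}" by (rule bdd_belowI[of _ 0]) (auto simp: W_def)
      moreover have "w t = Inf {c. W t c}" using W_ex[OF elim(2)] unfolding w_def by auto
      ultimately have "\<not> W t (w t / 2)" using cInf_lower[of "w t / 2" "{c. W t c}"] elim(1) by auto
      then show ?case using elim(1) unfolding W_def by auto
    qed
    have "dpred (\<lambda>q. R (w (fst q) / 2) (fst q) (snd q))" unfolding R_def
      by (intro dpred_intros dpred_mem[OF X'] dpred_mem[OF Y'] dfun_compose[OF \<nu>(1)] dfun_compose[OF w])
    from definable_choice[of "\<lambda>t p. R (w t / 2) t p", OF this]
    obtain f where f: "dfun f" "\<And>t p. R (w t / 2) t p \<Longrightarrow> R (w t / 2) t (f t)" by blast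
    have R: "\<forall>\<^sub>F t in at_right 0. R (w t / 2) t (f t)"
      using half by eventually_elim (use f(2) in \<open>auto simp: P_def\<close>)
    define \<gamma> where "\<gamma> t = (if 0 < t then fst (f t) else 0)" for t
    define \<eta> where "\<eta> t = (if 0 < t then snd (f t) else 0)" for t
    have R': "\<forall>\<^sub>F t in at_right 0. R (w t / 2) t (\<gamma> t, \<eta> t)"
      using R eventually_at_right_less[of 0] by eventually_elim (simp add: \<gamma>_def \<eta>_def)
    have \<gamma>: "is_arc S \<gamma>" unfolding \<gamma>_def
      by (intro is_arcI dpred_intros f(1)) (use R in \<open>auto elim: eventually_mono simp: R_def\<close>)
    have \<eta>: "is_arc S \<eta>" unfolding \<eta>_def
      by (intro is_arcI dpred_intros f(1)) (use R in \<open>auto elim: eventually_mono simp: R_def\<close>)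
    have "arc_in \<gamma> X" unfolding arc_in_def
      using R' by eventually_elim (simp add: R_def X'_def)
    then have "tord \<mu> \<gamma> = tord_set S \<gamma> Y" by (rule tord[OF \<gamma>])
    moreover have "arc_in \<eta> Y" unfolding arc_in_def
      using R' by eventually_elim (simp add: R_def Y'_def)
    then have "tord \<gamma> \<eta> \<le> tord_set S \<gamma> Y" unfolding tord_set_def using \<eta> by (intro SUP_upper) simp
    ultimately obtain C where C: "C > 0" "\<forall>\<^sub>F t in at_right 0. norm (\<mu> t - \<gamma> t) \<le> C * norm (\<gamma> t - \<eta> t)"
      using norm_le_of_tord_le[OF \<gamma> \<eta> \<mu> \<gamma>] by auto
    have "\<forall>\<^sub>F t in at_right 0. 2 * C \<le> w t" by (rule w_large) (use C(1) in simp)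
    then have "\<forall>\<^sub>F t in at_right (0::real). False" using C(2) R' \<nu>(2)
    proof eventually_elim
      case (elim t)
      have "C * norm (\<gamma> t - \<eta> t) \<le> w t / 2 * norm (\<gamma> t - \<eta> t)" using elim(1) by (intro mult_right_mono) auto
      then show ?case using elim(2-4) unfolding R_def by (simp add: norm_minus_commute)
    qed
    then show False by simp
  qed
  then obtain c where c: "0 \<le> c" "\<forall>\<^sub>F t in at_right 0. \<not> P c t" by blast
  have "\<forall>\<^sub>F t in at_right 0. \<not> P c t \<and> \<nu> t = \<mu> t" by (rule eventually_conj[OF c(2) \<nu>(2)])
  then obtain b where b: "b > 0" "\<And>t. 0 < t \<Longrightarrow> t < b \<Longrightarrow> \<not> P c t \<and> \<nu> t = \<mu> t"
    unfolding eventually_at_right_field by blast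
  have "norm (x - \<mu> (norm x)) \<le> (c + 1) * norm (x - y)"
    if "x \<in> X" "y \<in> Y" "norm x < min b (min e e')" "norm y = norm x" for x y
  proof (cases "x = 0")
    case True
    then show ?thesis using is_arc_0[OF \<mu>] c(1) by simp
  next
    case False
    then have "\<not> R c (norm x) (x, y)" "\<nu> (norm x) = \<mu> (norm x)" using b(2)[of "norm x"] that unfolding P_def by auto
    then have "norm (x - \<mu> (norm x)) \<le> c * norm (x - y)" using that unfolding R_def X'_def Y'_def by auto
    also have "\<dots> \<le> (c + 1) * norm (x - y)" by (intro mult_right_mono) auto
    finally show ?thesis .
  qed
  then show ?thesis using c(1) b(1) e(1) e'(1)
    by (intro exI[of _ "c + 1"] conjI exI[of _ "min b (min e e')"]) auto
qed

text \<open>If \<open>norm x < 2 * norm y\<close>, then \<open>y\<close> can be moved within \<open>Y\<close> to the sphere through \<open>x\<close> by a multiple of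
  \<open>norm (x - y)\<close>. Otherwise \<open>norm (x - y)\<close> is comparable to \<open>norm x\<close>, and the claim is trivial.\<close>

lemma dist_arc_le:
  fixes X Y :: "'a::euclidean_space set"
  assumes X: "definable_germ S X" and Y: "definable_germ S Y" and \<mu>: "is_arc S \<mu>"
    and tord: "\<And>\<gamma>. is_arc S \<gamma> \<Longrightarrow> arc_in \<gamma> X \<Longrightarrow> tord \<mu> \<gamma> = tord_set S \<gamma> Y"
  shows "\<exists>C>0. \<exists>b>0. \<forall>x\<in>X. \<forall>y\<in>Y. norm x < b \<and> norm y < b \<longrightarrow>
    norm (x - \<mu> (norm x)) \<le> C * norm (x - y)"
proof -
  obtain C b1 where C: "C > 0" "b1 > 0"
    "\<And>x y. x \<in> X \<Longrightarrow> y \<in> Y \<Longrightarrow> norm x < b1 \<Longrightarrow> norm y = norm x \<Longrightarrow> norm (x - \<mu> (norm x)) \<le> C * norm (x - y)"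
    using dist_arc_le_same_norm[OF X Y \<mu> tord] by blast
  obtain K b2 where K: "K > 0" "b2 > 0"
    "\<And>y s. y \<in> Y \<Longrightarrow> norm y < b2 \<Longrightarrow> 0 < s \<Longrightarrow> s < 2 * norm y \<Longrightarrow>
      \<exists>y'\<in>Y. norm y' = s \<and> norm (y - y') \<le> K * \<bar>norm y - s\<bar>"
    using definable_germ_radial[OF Y] by blast
  obtain b3 where b3: "b3 > 0" "\<And>t. 0 < t \<Longrightarrow> t < b3 \<Longrightarrow> norm (\<mu> t) = t"
    using is_arc_norm[OF \<mu>] unfolding eventually_at_right_field by blast
  define B where "B = 4 + C * (K + 1)"
  have B: "0 < B" using C(1) K(1) unfolding B_def by (intro add_pos_pos mult_pos_pos) auto
  have "norm (x - \<mu> (norm x)) \<le> B * norm (x - y)"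
    if x: "x \<in> X" "norm x < min b1 (min b2 b3)" and y: "y \<in> Y" "norm y < min b1 (min b2 b3)" for x y
  proof -
    have \<mu>x: "norm (\<mu> (norm x)) = norm x"
      using b3(2)[of "norm x"] x is_arc_0[OF \<mu>] by (cases "x = 0") auto
    show ?thesis
    proof (cases "0 < norm x \<and> norm x < 2 * norm y")
      case True
      then obtain y' where y': "y' \<in> Y" "norm y' = norm x" "norm (y - y') \<le> K * \<bar>norm y - norm x\<bar>"
        using K(3)[of y "norm x"] y by auto
      have "\<bar>norm y - norm x\<bar> \<le> norm (x - y)" by (metis norm_triangle_ineq3 norm_minus_commute)
      then have "K * \<bar>norm y - norm x\<bar> \<le> K * norm (x - y)" using K(1) by simp
      moreover have "norm (x - y') \<le> norm (x - y) + norm (y - y')" using norm_triangle_ineq[of "x - y" "y - y'"] by simp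
      ultimately have "norm (x - y') \<le> (K + 1) * norm (x - y)" using y'(3) by (simp add: algebra_simps)
      then have "C * norm (x - y') \<le> C * ((K + 1) * norm (x - y))" using C(1) by simp
      moreover have "norm (x - \<mu> (norm x)) \<le> C * norm (x - y')" by (rule C(3)) (use x y' in auto)
      moreover have "C * ((K + 1) * norm (x - y)) \<le> B * norm (x - y)"
        unfolding B_def by (simp add: algebra_simps)
      ultimately show ?thesis by linarith
    next
      case False
      \<comment> \<open>Unless \<open>x = 0\<close>, here \<open>y\<close> is so much closer to the origin than \<open>x\<close> that the distance is comparable to \<open>norm x\<close>.\<close>
      have "norm x \<le> 2 * norm (x - y)"
      proof (cases "x = 0")
        case False
        then have "2 * norm y \<le> norm x" using \<open>\<not> (0 < norm x \<and> norm x < 2 * norm y)\<close> by auto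
        then show ?thesis using norm_triangle_ineq2[of x y] by linarith
      qed simp
      then have "norm (x - \<mu> (norm x)) \<le> 4 * norm (x - y)"
        using norm_triangle_ineq4[of x "\<mu> (norm x)"] \<mu>x by linarith
      also have "\<dots> \<le> B * norm (x - y)" using C(1) K(1) unfolding B_def by (intro mult_right_mono) auto
      finally show ?thesis .
    qed
  qed
  then show ?thesis using B C(2) K(2) b3(1) by (intro exI[of _ B] conjI exI[of _ "min b1 (min b2 b3)"]) auto
qed

end

section \<open>Boundary arcs of a Hoelder triangle\<close>

lemma germ_eqD: "germ_eq A B \<Longrightarrow> \<exists>r>0. \<forall>x. norm x < r \<longrightarrow> (x \<in> A \<longleftrightarrow> x \<in> B)"
  unfolding germ_eq_def eventually_nhds_metric by simp

lemma arc_image_iff: "x \<in> arc_image \<gamma> \<longleftrightarrow> x = \<gamma> (norm x)"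
  unfolding arc_image_def by (auto intro!: exI[of _ "norm x"]) 

lemma open_subset_standard_triangle:
  assumes W: "open W" "W \<subseteq> standard_triangle \<beta>" and z: "(u, v) \<in> W"
  shows "0 < v \<and> v < u powr \<beta>"
proof -
  obtain r where r: "r > 0" "ball (u, v) r \<subseteq> W" using W(1) z open_contains_ball by blast
  have "(u, v - r / 2) \<in> ball (u, v) r" "(u, v + r / 2) \<in> ball (u, v) r"
    using r(1) by (simp_all add: dist_Pair_Pair dist_real_def)
  then have "(u, v - r / 2) \<in> standard_triangle \<beta>" "(u, v + r / 2) \<in> standard_triangle \<beta>"
    using r(2) W(2) by blast+
  then show ?thesis using r(1) unfolding standard_triangle_def by auto
qed

lemma open_interior_standard_triangle: "open {(u :: real, v). 0 < u \<and> 0 < v \<and> v < u powr \<beta>}"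
proof -
  let ?H = "{p :: real \<times> real. 0 < fst p} \<inter> {p. 0 < snd p}"
  have H: "open ?H" by (intro open_Int open_Collect_less continuous_intros)
  have "continuous_on ?H (\<lambda>p. fst p powr \<beta> - snd p)" by (intro continuous_intros) auto
  then have "open (?H \<inter> (\<lambda>p. fst p powr \<beta> - snd p) -` {0<..})"
    by (rule continuous_open_preimage[OF _ H open_greaterThan])
  moreover have "?H \<inter> (\<lambda>p. fst p powr \<beta> - snd p) -` {0<..} = {(u, v). 0 < u \<and> 0 < v \<and> v < u powr \<beta>}" by auto
  ultimately show ?thesis by simp
qed

text \<open>The change of charts maps a neighbourhood of an interior point of one standard triangle
  continuously and injectively into the other one. By invariance of domain its image is open in the
  plane, and therefore does not contain points of the sides.\<close>

lemma chart_side_to_side: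
  assumes h: "homeomorphism (standard_triangle \<beta> \<inter> U) (T \<inter> V) h g" and U: "open U"
    and h': "homeomorphism (standard_triangle \<beta>' \<inter> U') (T \<inter> V') h' g'" and V': "open V'"
    and e': "(u', v') \<in> standard_triangle \<beta>' \<inter> U'" "v' = 0 \<or> v' = u' powr \<beta>'"
    and p: "h' (u', v') \<in> V"
  shows "\<exists>u v. (u, v) \<in> standard_triangle \<beta> \<inter> U \<and> h (u, v) = h' (u', v') \<and> (v = 0 \<or> v = u powr \<beta>)"
proof -
  define q where "q = g (h' (u', v'))"
  have pT: "h' (u', v') \<in> T \<inter> V'" using homeomorphism_image1[OF h'] e'(1) by blast
  then have pV: "h' (u', v') \<in> T \<inter> V" using p by simp
  have q: "q \<in> standard_triangle \<beta> \<inter> U" using homeomorphism_image2[OF h] pV unfolding q_def by blast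
  have hq: "h q = h' (u', v')" using homeomorphism_apply2[OF h pV] unfolding q_def .
  obtain u v where uv: "q = (u, v)" by (cases q)
  have "v = 0 \<or> v = u powr \<beta>"
  proof (rule ccontr)
    assume nside: "\<not> (v = 0 \<or> v = u powr \<beta>)"
    define I where "I = {(u, v). 0 < u \<and> 0 < v \<and> v < u powr \<beta>} \<inter> U"
    have I: "open I" unfolding I_def by (intro open_Int open_interior_standard_triangle U)
    have I_sub: "I \<subseteq> standard_triangle \<beta> \<inter> U" unfolding I_def standard_triangle_def by auto
    have "0 < v" "v < u powr \<beta>" "0 \<le> u" using q nside unfolding uv standard_triangle_def by auto
    moreover from this have "u \<noteq> 0" by auto
    ultimately have "q \<in> I" using q unfolding I_def uv by auto
    define O1 where "O1 = I \<inter> h -` V'"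
    have ch: "continuous_on I h" using homeomorphism_cont1[OF h] I_sub by (rule continuous_on_subset)
    have O1: "open O1" unfolding O1_def by (rule continuous_open_preimage[OF ch I V'])
    have O1_sub: "O1 \<subseteq> standard_triangle \<beta> \<inter> U" using I_sub unfolding O1_def by blast
    have qO1: "q \<in> O1" using \<open>q \<in> I\<close> hq pT unfolding O1_def by simp
    have img: "h ` O1 \<subseteq> T \<inter> V'" using homeomorphism_image1[OF h] O1_sub unfolding O1_def by blast
    have ck: "continuous_on O1 (g' \<circ> h)"
    proof (rule continuous_on_compose)
      show "continuous_on O1 h" using homeomorphism_cont1[OF h] O1_sub by (rule continuous_on_subset)
      show "continuous_on (h ` O1) g'" using homeomorphism_cont2[OF h'] img by (rule continuous_on_subset)
    qed
    have inj: "inj_on (g' \<circ> h) O1"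
    proof (rule comp_inj_on)
      show "inj_on h O1" by (rule inj_on_inverseI[of _ g]) (use homeomorphism_apply1[OF h] O1_sub in blast)
      show "inj_on g' (h ` O1)" by (rule inj_on_inverseI[of _ h']) (use homeomorphism_apply2[OF h'] img in blast)
    qed
    have "open ((g' \<circ> h) ` O1)" by (rule invariance_of_domain[OF ck O1 inj])
    moreover have "(g' \<circ> h) ` O1 \<subseteq> standard_triangle \<beta>'"
      unfolding image_comp[symmetric] using homeomorphism_image2[OF h'] img by blast
    moreover have "(g' \<circ> h) q = (u', v')" using homeomorphism_apply1[OF h' e'(1)] hq by simp
    then have "(u', v') \<in> (g' \<circ> h) ` O1" using qO1 by (metis imageI)
    ultimately have "0 < v' \<and> v' < u' powr \<beta>'" by (rule open_subset_standard_triangle)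
    then show False using e'(2) by auto
  qed
  then show ?thesis using q hq uv by blast
qed

lemma beta_holder_triangle_chart:
  assumes "beta_holder_triangle S \<beta> T \<gamma>1 \<gamma>2"
  obtains U V h g r where "open U" "0 \<in> U" "h 0 = 0" "open V" "0 \<in> V"
    "homeomorphism (standard_triangle \<beta> \<inter> U) (T \<inter> V) h g" "r > 0"
    "\<forall>x. norm x < r \<longrightarrow> x \<in> V"
    "\<forall>x. norm x < r \<longrightarrow> (x = \<gamma>1 (norm x) \<longleftrightarrow> x \<in> h ` ({(u, v). 0 \<le> u \<and> v = 0} \<inter> U))"
    "\<forall>x. norm x < r \<longrightarrow> (x = \<gamma>2 (norm x) \<longleftrightarrow> x \<in> h ` ({(u, v). 0 \<le> u \<and> v = u powr \<beta>} \<inter> U))"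
proof -
  obtain U h where chart: "inner_bilipschitz_germ (standard_triangle \<beta>) T U h"
    and g1: "germ_eq (h ` ({(u, v). 0 \<le> u \<and> v = 0} \<inter> U)) (arc_image \<gamma>1)"
    and g2: "germ_eq (h ` ({(u, v). 0 \<le> u \<and> v = u powr \<beta>} \<inter> U)) (arc_image \<gamma>2)"
    using assms unfolding beta_holder_triangle_def by blast
  obtain V g where V: "open V" "0 \<in> V" "homeomorphism (standard_triangle \<beta> \<inter> U) (T \<inter> V) h g"
    using chart unfolding inner_bilipschitz_germ_def by blast
  obtain r1 where r1: "r1 > 0" "\<And>x. norm x < r1 \<Longrightarrow> x \<in> h ` ({(u, v). 0 \<le> u \<and> v = 0} \<inter> U) \<longleftrightarrow> x = \<gamma>1 (norm x)"
    using germ_eqD[OF g1] unfolding arc_image_iff by blast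
  obtain r2 where r2: "r2 > 0" "\<And>x. norm x < r2 \<Longrightarrow> x \<in> h ` ({(u, v). 0 \<le> u \<and> v = u powr \<beta>} \<inter> U) \<longleftrightarrow> x = \<gamma>2 (norm x)"
    using germ_eqD[OF g2] unfolding arc_image_iff by blast
  obtain r3 where r3: "r3 > 0" "ball 0 r3 \<subseteq> V" using V(1,2) open_contains_ball by blast
  show ?thesis
  proof (rule that[of U h V g "min r1 (min r2 r3)"])
    show "open U" "0 \<in> U" "h 0 = 0" using chart unfolding inner_bilipschitz_germ_def by auto
    show "\<forall>x. norm x < min r1 (min r2 r3) \<longrightarrow> x \<in> V" using r3(2) by auto
    show "0 < min r1 (min r2 r3)" using r1(1) r2(1) r3(1) by simp
    show "\<forall>x. norm x < min r1 (min r2 r3) \<longrightarrow>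
        (x = \<gamma>1 (norm x) \<longleftrightarrow> x \<in> h ` ({(u, v). 0 \<le> u \<and> v = 0} \<inter> U))"
      by (intro allI impI r1(2)[symmetric]) simp
    show "\<forall>x. norm x < min r1 (min r2 r3) \<longrightarrow>
        (x = \<gamma>2 (norm x) \<longleftrightarrow> x \<in> h ` ({(u, v). 0 \<le> u \<and> v = u powr \<beta>} \<inter> U))"
      by (intro allI impI r2(2)[symmetric]) simp
  qed (rule V)+
qed

lemma side_subset_standard_triangle:
  "{(u, v). 0 \<le> u \<and> v = 0} \<subseteq> standard_triangle \<beta>" "{(u, v). 0 \<le> u \<and> v = u powr \<beta>} \<subseteq> standard_triangle \<beta>"
  unfolding standard_triangle_def by auto

lemma holder_triangle_arcsD:
  assumes "holder_triangle_arcs S T \<gamma>1 \<gamma>2"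
  shows "definable_germ S T" "is_arc S \<gamma>1" "is_arc S \<gamma>2" "arc_in \<gamma>1 T" "arc_in \<gamma>2 T" "0 \<in> T"
proof -
  obtain \<beta> where T: "beta_holder_triangle S \<beta> T \<gamma>1 \<gamma>2" using assms unfolding holder_triangle_arcs_def by blast
  then show "definable_germ S T" and arcs: "is_arc S \<gamma>1" "is_arc S \<gamma>2" unfolding beta_holder_triangle_def by auto
  obtain U V h g r where c: "open U" "0 \<in> U" "h 0 = 0" "open V" "0 \<in> V"
    "homeomorphism (standard_triangle \<beta> \<inter> U) (T \<inter> V) h g" "r > 0"
    "\<forall>x. norm x < r \<longrightarrow> x \<in> V"
    "\<forall>x. norm x < r \<longrightarrow> (x = \<gamma>1 (norm x) \<longleftrightarrow> x \<in> h ` ({(u, v). 0 \<le> u \<and> v = 0} \<inter> U))"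
    "\<forall>x. norm x < r \<longrightarrow> (x = \<gamma>2 (norm x) \<longleftrightarrow> x \<in> h ` ({(u, v). 0 \<le> u \<and> v = u powr \<beta>} \<inter> U))"
    by (rule beta_holder_triangle_chart[OF T])
  have small: "\<forall>\<^sub>F t in at_right 0. t < r" using c(7) unfolding eventually_at_right_field by blast
  have sub: "h ` (A \<inter> U) \<subseteq> T" if "A \<subseteq> standard_triangle \<beta>" for A
    using homeomorphism_image1[OF c(6)] that by blast
  show "arc_in \<gamma>1 T" unfolding arc_in_def
    using is_arc_norm[OF arcs(1)] small
  proof eventually_elim
    case (elim t)
    have "\<gamma>1 t \<in> h ` ({(u, v). 0 \<le> u \<and> v = 0} \<inter> U)"
      by (rule c(9)[rule_format, THEN iffD1]) (use elim in auto)
    then show ?case using sub[OF side_subset_standard_triangle(1)] by blast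
  qed
  show "arc_in \<gamma>2 T" unfolding arc_in_def
    using is_arc_norm[OF arcs(2)] small
  proof eventually_elim
    case (elim t)
    have "\<gamma>2 t \<in> h ` ({(u, v). 0 \<le> u \<and> v = u powr \<beta>} \<inter> U)"
      by (rule c(10)[rule_format, THEN iffD1]) (use elim in auto)
    then show ?case using sub[OF side_subset_standard_triangle(2)] by blast
  qed
  have "(0, 0) \<in> standard_triangle \<beta>" unfolding standard_triangle_def by simp
  then have "h 0 \<in> T" using homeomorphism_image1[OF c(6)] c(2) unfolding zero_prod_def by blast
  then show "0 \<in> T" using c(3) by simp
qed

lemma beta_holder_triangle_sides_unique:
  assumes T: "beta_holder_triangle S \<beta> T \<gamma>1 \<gamma>2" and T': "beta_holder_triangle S \<beta>' T \<delta>1 \<delta>2"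
    and \<mu>: "\<mu> = \<delta>1 \<or> \<mu> = \<delta>2"
  shows "\<forall>\<^sub>F t in at_right 0. \<mu> t = \<gamma>1 t \<or> \<mu> t = \<gamma>2 t"
proof -
  obtain U V h g r where c: "open U" "0 \<in> U" "h 0 = 0" "open V" "0 \<in> V"
    "homeomorphism (standard_triangle \<beta> \<inter> U) (T \<inter> V) h g" "r > 0"
    "\<forall>x. norm x < r \<longrightarrow> x \<in> V"
    "\<forall>x. norm x < r \<longrightarrow> (x = \<gamma>1 (norm x) \<longleftrightarrow> x \<in> h ` ({(u, v). 0 \<le> u \<and> v = 0} \<inter> U))"
    "\<forall>x. norm x < r \<longrightarrow> (x = \<gamma>2 (norm x) \<longleftrightarrow> x \<in> h ` ({(u, v). 0 \<le> u \<and> v = u powr \<beta>} \<inter> U))"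
    by (rule beta_holder_triangle_chart[OF T])
  obtain U' V' h' g' r' where c': "open U'" "0 \<in> U'" "h' 0 = 0" "open V'" "0 \<in> V'"
    "homeomorphism (standard_triangle \<beta>' \<inter> U') (T \<inter> V') h' g'" "r' > 0"
    "\<forall>x. norm x < r' \<longrightarrow> x \<in> V'"
    "\<forall>x. norm x < r' \<longrightarrow> (x = \<delta>1 (norm x) \<longleftrightarrow> x \<in> h' ` ({(u, v). 0 \<le> u \<and> v = 0} \<inter> U'))"
    "\<forall>x. norm x < r' \<longrightarrow> (x = \<delta>2 (norm x) \<longleftrightarrow> x \<in> h' ` ({(u, v). 0 \<le> u \<and> v = u powr \<beta>'} \<inter> U'))"
    by (rule beta_holder_triangle_chart[OF T'])
  have arc: "is_arc S \<mu>" using T' \<mu> unfolding beta_holder_triangle_def by auto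
  have "\<forall>\<^sub>F t::real in at_right 0. t < min r r'"
    using c(7) c'(7) unfolding eventually_at_right_field by (intro exI[of _ "min r r'"]) auto
  with is_arc_norm[OF arc] show ?thesis
  proof eventually_elim
    case (elim t)
    have small: "norm (\<mu> t) < r" "norm (\<mu> t) < r'" using elim by auto
    have "\<mu> t \<in> h' ` ({(u, v). 0 \<le> u \<and> v = 0} \<inter> U') \<union> h' ` ({(u, v). 0 \<le> u \<and> v = u powr \<beta>'} \<inter> U')"
      using \<mu> c'(9,10)[rule_format, OF small(2)] elim(1) by auto
    then obtain u' v' where e': "0 \<le> u'" "(u', v') \<in> U'" "v' = 0 \<or> v' = u' powr \<beta>'" "\<mu> t = h' (u', v')"
      by auto
    then have "(u', v') \<in> standard_triangle \<beta>' \<inter> U'" unfolding standard_triangle_def by auto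
    moreover have "h' (u', v') \<in> V" using c(8)[rule_format, OF small(1)] e'(4) by simp
    ultimately have "\<exists>u v. (u, v) \<in> standard_triangle \<beta> \<inter> U \<and> h (u, v) = \<mu> t \<and> (v = 0 \<or> v = u powr \<beta>)"
      using chart_side_to_side[OF c(6,1) c'(6,4) _ e'(3)] e'(4) by simp
    then obtain u v where e: "(u, v) \<in> standard_triangle \<beta> \<inter> U" "h (u, v) = \<mu> t" "v = 0 \<or> v = u powr \<beta>" by blast
    have "0 \<le> u" using e(1) unfolding standard_triangle_def by auto
    from e(3) show ?case
    proof
      assume "v = 0"
      then have "h (u, v) \<in> h ` ({(u, v). 0 \<le> u \<and> v = 0} \<inter> U)" using e(1) \<open>0 \<le> u\<close> by (intro imageI) auto
      then show ?thesis using c(9)[rule_format, OF small(1)] elim(1) e(2) by simp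
    next
      assume "v = u powr \<beta>"
      then have "h (u, v) \<in> h ` ({(u, v). 0 \<le> u \<and> v = u powr \<beta>} \<inter> U)" using e(1) \<open>0 \<le> u\<close> by (intro imageI) auto
      then show ?thesis using c(10)[rule_format, OF small(1)] elim(1) e(2) by simp
    qed
  qed
qed

lemma boundary_arc_is_arc: "boundary_arc S T \<mu> \<Longrightarrow> is_arc S \<mu>"
  unfolding boundary_arc_def using holder_triangle_arcsD(2,3) by blast

text \<open>For each small \<open>t\<close> the point \<open>\<mu> t\<close> lies on one of the two sides; by the dichotomy it is always the same one.\<close>

lemma (in o_minimal_structure) boundary_arc_cases:
  assumes T: "holder_triangle_arcs S T \<gamma>1 \<gamma>2" and \<mu>: "boundary_arc S T \<mu>"
  shows "(\<forall>\<^sub>F t in at_right 0. \<mu> t = \<gamma>1 t) \<or> (\<forall>\<^sub>F t in at_right 0. \<mu> t = \<gamma>2 t)"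
proof -
  obtain \<beta> where \<beta>: "beta_holder_triangle S \<beta> T \<gamma>1 \<gamma>2" using T unfolding holder_triangle_arcs_def by blast
  obtain \<beta>' \<delta>1 \<delta>2 where \<delta>: "beta_holder_triangle S \<beta>' T \<delta>1 \<delta>2" "\<mu> = \<delta>1 \<or> \<mu> = \<delta>2"
    using \<mu> unfolding boundary_arc_def holder_triangle_arcs_def by blast
  have sides: "\<forall>\<^sub>F t in at_right 0. \<mu> t = \<gamma>1 t \<or> \<mu> t = \<gamma>2 t"
    by (rule beta_holder_triangle_sides_unique[OF \<beta> \<delta>])
  obtain \<nu> where \<nu>: "dfun \<nu>" "\<forall>\<^sub>F t in at_right 0. \<nu> t = \<mu> t"
    using arc_representative[OF boundary_arc_is_arc[OF \<mu>]] by blast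
  obtain \<eta> where \<eta>: "dfun \<eta>" "\<forall>\<^sub>F t in at_right 0. \<eta> t = \<gamma>1 t"
    using arc_representative[OF holder_triangle_arcsD(2)[OF T]] by blast
  have "dpred (\<lambda>t. \<nu> t = \<eta> t)" by (rule dpred_eq[OF \<nu>(1) \<eta>(1)])
  then have "(\<forall>\<^sub>F t in at_right 0. \<nu> t = \<eta> t) \<or> (\<forall>\<^sub>F t in at_right 0. \<nu> t \<noteq> \<eta> t)"
    using decides_at_right unfolding decides_def by blast
  then show ?thesis
  proof
    assume "\<forall>\<^sub>F t in at_right 0. \<nu> t = \<eta> t"
    then have "\<forall>\<^sub>F t in at_right 0. \<mu> t = \<gamma>1 t" using \<nu>(2) \<eta>(2) by eventually_elim simp
    then show ?thesis ..
  next
    assume "\<forall>\<^sub>F t in at_right 0. \<nu> t \<noteq> \<eta> t"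
    then have "\<forall>\<^sub>F t in at_right 0. \<mu> t = \<gamma>2 t" using \<nu>(2) \<eta>(2) sides by eventually_elim auto
    then show ?thesis ..
  qed
qed

section \<open>Short paths\<close>

definition short_path :: "'a::euclidean_space set \<Rightarrow> real \<Rightarrow> 'a \<Rightarrow> 'a \<Rightarrow> bool" where
  "short_path X L x y \<longleftrightarrow>
     (\<exists>g. path g \<and> path_image g \<subseteq> X \<and> pathstart g = x \<and> pathfinish g = y \<and> path_length g \<le> ennreal L)"

lemma partition_sum_le_path_length:
  assumes "mono_on {..n} t" "t ` {..n} \<subseteq> {0..1}"
  shows "ennreal (\<Sum>i<n. dist (g (t i)) (g (t (Suc i)))) \<le> path_length g"
  unfolding path_length_def using assms by (intro SUP_upper2[where i = "(n, t)"]) auto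

lemma path_length_leI:
  assumes "\<And>n t. mono_on {..n} t \<Longrightarrow> t ` {..n} \<subseteq> {0..1} \<Longrightarrow>
    ennreal (\<Sum>i<n. dist (g (t i)) (g (t (Suc i)))) \<le> L"
  shows "path_length g \<le> L"
  unfolding path_length_def by (rule SUP_least) (use assms in auto)

lemma dist_le_path_length:
  assumes "0 \<le> s" "s \<le> t" "t \<le> 1" shows "ennreal (dist (g s) (g t)) \<le> path_length g"
proof -
  let ?p = "\<lambda>i::nat. if i = 0 then s else t"
  have "mono_on {..1} ?p" by (rule mono_onI) (use assms in auto)
  moreover have "?p ` {..1} \<subseteq> {0..1}" using assms by auto
  ultimately have "ennreal (\<Sum>i<1. dist (g (?p i)) (g (?p (Suc i)))) \<le> path_length g"
    by (rule partition_sum_le_path_length)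
  then show ?thesis by simp
qed

lemma path_length_join:
  assumes "pathfinish g1 = pathstart g2"
  shows "path_length (g1 +++ g2) \<le> path_length g1 + path_length g2"
proof (rule path_length_leI)
  fix n :: nat and t :: "nat \<Rightarrow> real"
  assume t: "mono_on {..n} t" "t ` {..n} \<subseteq> {0..1}"
  define a where "a i = min (2 * t i) 1" for i
  define b where "b i = max (2 * t i - 1) 0" for i
  let ?g = "g1 +++ g2"
  have mono: "t i \<le> t j" if "i \<le> j" "j \<le> n" for i j using mono_onD[OF t(1), of i j] that by simp
  have range: "0 \<le> t i" "t i \<le> 1" if "i \<le> n" for i using t(2) that by auto
  have a: "mono_on {..n} a" "a ` {..n} \<subseteq> {0..1}"
  proof -
    show "mono_on {..n} a" unfolding a_def by (intro mono_onI min.mono mult_left_mono mono) auto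
    show "a ` {..n} \<subseteq> {0..1}" using range unfolding a_def by auto
  qed
  have b: "mono_on {..n} b" "b ` {..n} \<subseteq> {0..1}"
  proof -
    show "mono_on {..n} b" unfolding b_def by (intro mono_onI max.mono mult_left_mono diff_mono mono) auto
    show "b ` {..n} \<subseteq> {0..1}" using range unfolding b_def by auto
  qed
  have g1_1: "g1 1 = g2 0" using assms by (simp add: pathfinish_def pathstart_def)
  have "dist (?g (t i)) (?g (t (Suc i))) \<le>
      dist (g1 (a i)) (g1 (a (Suc i))) + dist (g2 (b i)) (g2 (b (Suc i)))" if "i < n" for i
  proof -
    have le: "t i \<le> t (Suc i)" using t(1) that unfolding mono_on_def by auto
    consider "t (Suc i) \<le> 1 / 2" | "t i \<le> 1 / 2" "1 / 2 < t (Suc i)" | "1 / 2 < t i" by linarith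
    then show ?thesis
    proof cases
      case 1
      then show ?thesis using le unfolding joinpaths_def a_def b_def by simp
    next
      case 2
      then have eq: "?g (t i) = g1 (a i)" "?g (t (Suc i)) = g2 (b (Suc i))" "a (Suc i) = 1" "b i = 0"
        unfolding joinpaths_def a_def b_def by auto
      show ?thesis unfolding eq g1_1 by (rule dist_triangle)
    next
      case 3
      then show ?thesis using le unfolding joinpaths_def a_def b_def by simp
    qed
  qed
  then have "(\<Sum>i<n. dist (?g (t i)) (?g (t (Suc i)))) \<le>
      (\<Sum>i<n. dist (g1 (a i)) (g1 (a (Suc i)))) + (\<Sum>i<n. dist (g2 (b i)) (g2 (b (Suc i))))"
    unfolding sum.distrib[symmetric] by (intro sum_mono) auto
  then have "ennreal (\<Sum>i<n. dist (?g (t i)) (?g (t (Suc i)))) \<le>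
      ennreal (\<Sum>i<n. dist (g1 (a i)) (g1 (a (Suc i)))) + ennreal (\<Sum>i<n. dist (g2 (b i)) (g2 (b (Suc i))))"
    unfolding ennreal_plus[OF sum_nonneg sum_nonneg, OF zero_le_dist zero_le_dist, symmetric]
    by (rule ennreal_leI)
  also have "\<dots> \<le> path_length g1 + path_length g2"
    by (intro add_mono partition_sum_le_path_length a b)
  finally show "ennreal (\<Sum>i<n. dist (?g (t i)) (?g (t (Suc i)))) \<le> path_length g1 + path_length g2" .
qed

lemma path_length_reversepath: "path_length (reversepath g) \<le> path_length g"
proof (rule path_length_leI)
  fix n :: nat and t :: "nat \<Rightarrow> real"
  assume t: "mono_on {..n} t" "t ` {..n} \<subseteq> {0..1}"
  define s where "s i = 1 - t (n - i)" for i
  have s: "mono_on {..n} s" "s ` {..n} \<subseteq> {0..1}"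
    using t unfolding s_def mono_on_def by (auto simp: image_subset_iff)
  have "(\<Sum>i<n. dist (reversepath g (t i)) (reversepath g (t (Suc i)))) =
      (\<Sum>i<n. dist (g (s (n - Suc i))) (g (s (Suc (n - Suc i)))))"
    by (intro sum.cong refl) (auto simp: reversepath_def s_def Suc_diff_Suc dist_commute)
  also have "\<dots> = (\<Sum>i<n. dist (g (s i)) (g (s (Suc i))))"
    by (rule sum.nat_diff_reindex)
  finally show "ennreal (\<Sum>i<n. dist (reversepath g (t i)) (reversepath g (t (Suc i)))) \<le> path_length g"
    using partition_sum_le_path_length[OF s, of g] by simp
qed

lemma path_length_const: "path_length (\<lambda>_. x) = 0"
proof -
  have "path_length (\<lambda>_. x) \<le> 0" by (rule path_length_leI) simp
  then show ?thesis by simp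
qed

lemma short_path_refl: "x \<in> X \<Longrightarrow> short_path X L x x"
  unfolding short_path_def
  by (intro exI[of _ "\<lambda>_. x"]) (auto simp: path_def path_image_def pathstart_def pathfinish_def path_length_const)

lemma short_path_sym: assumes "short_path X L x y" shows "short_path X L y x"
proof -
  obtain g where g: "path g" "path_image g \<subseteq> X" "pathstart g = x" "pathfinish g = y" "path_length g \<le> ennreal L"
    using assms unfolding short_path_def by blast
  have "path_length (reversepath g) \<le> ennreal L" using path_length_reversepath[of g] g(5) by (rule order_trans)
  then show ?thesis unfolding short_path_def using g by (intro exI[of _ "reversepath g"]) auto
qed

lemma short_path_trans:
  assumes "short_path X L x y" "short_path X M y z" "0 \<le> L" "0 \<le> M"
  shows "short_path X (L + M) x z"
proof -
  obtain g where g: "path g" "path_image g \<subseteq> X" "pathstart g = x" "pathfinish g = y" "path_length g \<le> ennreal L"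
    using assms(1) unfolding short_path_def by blast
  obtain h where h: "path h" "path_image h \<subseteq> X" "pathstart h = y" "pathfinish h = z" "path_length h \<le> ennreal M"
    using assms(2) unfolding short_path_def by blast
  have "path_length (g +++ h) \<le> path_length g + path_length h" by (rule path_length_join) (use g h in simp)
  also have "\<dots> \<le> ennreal L + ennreal M" using g(5) h(5) by (rule add_mono)
  also have "\<dots> = ennreal (L + M)" using assms(3,4) by simp
  finally show ?thesis unfolding short_path_def using g h
    by (intro exI[of _ "g +++ h"]) (auto simp: path_image_join)
qed

lemma short_path_mono: assumes "short_path X L x y" "L \<le> M" shows "short_path X M x y"
proof -
  obtain g where g: "path g" "path_image g \<subseteq> X" "pathstart g = x" "pathfinish g = y" "path_length g \<le> ennreal L"
    using assms(1) unfolding short_path_def by blast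
  have "path_length g \<le> ennreal M" using g(5) ennreal_leI[OF assms(2)] by (rule order_trans)
  then show ?thesis using g unfolding short_path_def by blast
qed

text \<open>A short path from a point near the origin stays near the origin, where \<open>X\<close> is contained in \<open>Y\<close>.\<close>

lemma short_path_germ:
  assumes "short_path X L x y" "0 \<le> L" and XY: "\<And>z. z \<in> X \<Longrightarrow> norm z < r \<Longrightarrow> z \<in> Y" and r: "norm x + L < r"
  shows "short_path Y L x y"
proof -
  obtain g where g: "path g" "path_image g \<subseteq> X" "pathstart g = x" "pathfinish g = y" "path_length g \<le> ennreal L"
    using assms(1) unfolding short_path_def by blast
  have "g s \<in> Y" if s: "0 \<le> s" "s \<le> 1" for s
  proof -
    have "ennreal (dist (g 0) (g s)) \<le> ennreal L"
      using dist_le_path_length[of 0 s g] s g(5) by (simp add: order_trans)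
    then have "dist x (g s) \<le> L" using assms(2) g(3) by (simp add: pathstart_def)
    then have "norm (g s) < r" using r norm_triangle_sub[of "g s" x] by (simp add: dist_norm norm_minus_commute)
    moreover have "g s \<in> X" using g(2) s unfolding path_image_def by auto
    ultimately show ?thesis using XY by blast
  qed
  then have "path_image g \<subseteq> Y" unfolding path_image_def by auto
  then show ?thesis using g unfolding short_path_def by blast
qed

lemma normally_embedded_short_path:
  assumes "normally_embedded X"
  shows "\<exists>K>0. \<exists>b>0. \<forall>x\<in>X. \<forall>y\<in>X. norm x < b \<and> norm y < b \<longrightarrow> short_path X (K * norm (x - y)) x y"
proof -
  obtain C b where C: "C > 0" "b > 0"
    "\<And>x y. x \<in> X \<Longrightarrow> y \<in> X \<Longrightarrow> norm x < b \<Longrightarrow> norm y < b \<Longrightarrow> inner_dist X x y \<le> ennreal C * ennreal (dist x y)"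
    using assms unfolding normally_embedded_def by auto
  have "short_path X (2 * C * norm (x - y)) x y" if xy: "x \<in> X" "y \<in> X" "norm x < b" "norm y < b" for x y
  proof (cases "x = y")
    case True
    then show ?thesis using short_path_refl[OF xy(1)] by simp
  next
    case False
    have "inner_dist X x y \<le> ennreal (C * norm (x - y))"
      using C(3)[OF xy] C(1) by (simp add: ennreal_mult dist_norm)
    also have "\<dots> < ennreal (2 * C * norm (x - y))"
      using C(1) False by (intro ennreal_lessI) auto
    finally obtain g where "path g" "path_image g \<subseteq> X" "pathstart g = x" "pathfinish g = y"
      "path_length g < ennreal (2 * C * norm (x - y))"
      unfolding inner_dist_def INF_less_iff by auto
    then show ?thesis unfolding short_path_def by (intro exI[of _ g]) auto
  qed
  then show ?thesis using C(1,2) by (intro exI[of _ "2 * C"] conjI exI[of _ b]) auto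
qed

lemma normally_embeddedI:
  assumes "K > 0" "b > 0"
    "\<And>x y. x \<in> X \<Longrightarrow> y \<in> X \<Longrightarrow> norm x < b \<Longrightarrow> norm y < b \<Longrightarrow> short_path X (K * norm (x - y)) x y"
  shows "normally_embedded X"
proof -
  have le: "ennreal (dist x y) \<le> inner_dist X x y" for x y
    unfolding inner_dist_def
  proof (rule INF_greatest)
    fix g assume "g \<in> {g. path g \<and> path_image g \<subseteq> X \<and> pathstart g = x \<and> pathfinish g = y}"
    then show "ennreal (dist x y) \<le> path_length g"
      using dist_le_path_length[of 0 1 g] by (auto simp: pathstart_def pathfinish_def)
  qed
  have "inner_dist X x y \<le> ennreal (K + 1) * ennreal (dist x y) \<and>
      ennreal (dist x y) \<le> ennreal (K + 1) * inner_dist X x y"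
    if xy: "x \<in> X" "y \<in> X" "norm x < b" "norm y < b" for x y
  proof
    obtain g where g: "path g" "path_image g \<subseteq> X" "pathstart g = x" "pathfinish g = y"
      "path_length g \<le> ennreal (K * norm (x - y))"
      using assms(3)[OF xy] unfolding short_path_def by blast
    then have "inner_dist X x y \<le> path_length g" unfolding inner_dist_def by (intro INF_lower) simp
    also have "\<dots> \<le> ennreal ((K + 1) * norm (x - y))"
      using g(5) by (rule order_trans) (intro ennreal_leI mult_right_mono; simp)
    also have "\<dots> = ennreal (K + 1) * ennreal (dist x y)" using assms(1) by (simp add: ennreal_mult dist_norm)
    finally show "inner_dist X x y \<le> ennreal (K + 1) * ennreal (dist x y)" .
    have "1 * inner_dist X x y \<le> ennreal (K + 1) * inner_dist X x y"
      using assms(1) by (intro mult_right_mono) (auto simp flip: ennreal_1 intro!: ennreal_leI)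
    then show "ennreal (dist x y) \<le> ennreal (K + 1) * inner_dist X x y" using le[of x y] by simp
  qed
  then show ?thesis unfolding normally_embedded_def using assms(1,2)
    by (intro exI[of _ "K + 1"] conjI exI[of _ b]) auto
qed

section \<open>Paths through a chain of triangles\<close>

lemma uniform_constants:
  fixes Q :: "'i \<Rightarrow> real \<Rightarrow> real \<Rightarrow> bool"
  assumes "finite I" "\<And>i. i \<in> I \<Longrightarrow> \<exists>K>0. \<exists>b>0. Q i K b"
    and mono: "\<And>i K K' b b'. Q i K b \<Longrightarrow> K \<le> K' \<Longrightarrow> b' \<le> b \<Longrightarrow> Q i K' b'"
  shows "\<exists>K>0. \<exists>b>0. \<forall>i\<in>I. Q i K b"
  using assms(1,2)
proof (induction I rule: finite_induct)
  case empty
  have "\<exists>x::real. 0 < x" using zero_less_one by blast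
  then show ?case by simp
next
  case (insert i I)
  obtain K b where 1: "K > 0" "b > 0" "\<And>j. j \<in> I \<Longrightarrow> Q j K b" using insert by blast
  obtain K' b' where 2: "K' > 0" "b' > 0" "Q i K' b'" using insert.prems by blast
  have "Q j (max K K') (min b b')" if "j \<in> insert i I" for j
  proof (cases "j = i")
    case True
    then show ?thesis using mono[OF 2(3), of "max K K'" "min b b'"] by simp
  next
    case False
    then show ?thesis using that mono[OF 1(3)[of j], of "max K K'" "min b b'"] by simp
  qed
  then show ?case using 1 2 by (intro exI[of _ "max K K'"] conjI exI[of _ "min b b'"]) auto
qed

definition short_joins :: "'a::euclidean_space set \<Rightarrow> 'a set \<Rightarrow> 'a set \<Rightarrow> real \<Rightarrow> real \<Rightarrow> bool" where
  "short_joins T X Y K b \<longleftrightarrow>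
     (\<forall>x\<in>X. \<forall>y\<in>Y. norm x < b \<and> norm y < b \<longrightarrow> short_path T (K * norm (x - y)) x y)"

lemma short_joinsD:
  "short_joins T X Y K b \<Longrightarrow> x \<in> X \<Longrightarrow> y \<in> Y \<Longrightarrow> norm x < b \<Longrightarrow> norm y < b \<Longrightarrow>
    short_path T (K * norm (x - y)) x y"
  unfolding short_joins_def by blast

lemma short_joins_mono:
  assumes "short_joins T X Y K b" "K \<le> K'" "b' \<le> b" shows "short_joins T X Y K' b'"
  unfolding short_joins_def
proof (intro ballI impI)
  fix x y assume xy: "x \<in> X" "y \<in> Y" "norm x < b' \<and> norm y < b'"
  have "short_path T (K * norm (x - y)) x y" by (rule short_joinsD[OF assms(1)]) (use xy assms(3) in auto)
  then show "short_path T (K' * norm (x - y)) x y"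
    by (rule short_path_mono) (use assms(2) in \<open>auto intro: mult_right_mono\<close>)
qed

lemma short_joins_commute: assumes "short_joins T X Y K b" shows "short_joins T Y X K b"
  unfolding short_joins_def
proof (intro ballI impI)
  fix x y assume xy: "x \<in> Y" "y \<in> X" "norm x < b \<and> norm y < b"
  have "short_path T (K * norm (y - x)) y x" by (rule short_joinsD[OF assms]) (use xy in auto)
  then show "short_path T (K * norm (x - y)) x y" using short_path_sym by (simp add: norm_minus_commute)
qed

lemma normally_embedded_short_joins:
  assumes "normally_embedded X" "r > 0" "\<And>z. z \<in> X \<Longrightarrow> norm z < r \<Longrightarrow> z \<in> T"
  shows "\<exists>K>0. \<exists>b>0. short_joins T X X K b"
proof -
  obtain K b where K: "K > 0" "b > 0"
    "\<And>x y. x \<in> X \<Longrightarrow> y \<in> X \<Longrightarrow> norm x < b \<Longrightarrow> norm y < b \<Longrightarrow> short_path X (K * norm (x - y)) x y"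
    using normally_embedded_short_path[OF assms(1)] by blast
  define c where "c = min b (r / (1 + 2 * K))"
  have c: "c > 0" "c \<le> b" using K(1,2) assms(2) unfolding c_def by auto
  have "(1 + 2 * K) * c \<le> (1 + 2 * K) * (r / (1 + 2 * K))"
    using K(1) unfolding c_def by (intro mult_left_mono) auto
  then have cr: "(1 + 2 * K) * c \<le> r" using K(1) by simp
  have "short_joins T X X K c" unfolding short_joins_def
  proof (intro ballI impI)
    fix x y assume xy: "x \<in> X" "y \<in> X" "norm x < c \<and> norm y < c"
    have "K * norm (x - y) \<le> K * (2 * c)" using norm_triangle_ineq4[of x y] xy(3) K(1) by (intro mult_left_mono) auto
    then have "norm x + K * norm (x - y) < r" using xy(3) cr by (simp add: algebra_simps)
    moreover have "short_path X (K * norm (x - y)) x y" by (rule K(3)) (use xy c(2) in auto)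
    moreover have "0 \<le> K * norm (x - y)" using K(1) by simp
    ultimately show "short_path T (K * norm (x - y)) x y" using short_path_germ assms(3) by blast
  qed
  then show ?thesis using K(1) c(1) by blast
qed

lemma arc_in_small:
  assumes "is_arc S \<gamma>" "arc_in \<gamma> X" "0 \<in> X"
  shows "\<exists>b>0. \<forall>t. 0 \<le> t \<and> t < b \<longrightarrow> \<gamma> t \<in> X \<and> norm (\<gamma> t) = t"
proof -
  have "\<forall>\<^sub>F t in at_right 0. \<gamma> t \<in> X \<and> norm (\<gamma> t) = t"
    using assms(2)[unfolded arc_in_def] is_arc_norm[OF assms(1)] by (rule eventually_conj)
  then obtain b where b: "b > 0" "\<And>t. 0 < t \<Longrightarrow> t < b \<Longrightarrow> \<gamma> t \<in> X \<and> norm (\<gamma> t) = t"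
    unfolding eventually_at_right_field by blast
  have "\<gamma> t \<in> X \<and> norm (\<gamma> t) = t" if "0 \<le> t" "t < b" for t
    using that b(2)[of t] is_arc_0[OF assms(1)] assms(3) by (cases "t = 0") auto
  then show ?thesis using b(1) by blast
qed

lemma eventually_arcs_eq:
  assumes "is_arc S \<gamma>" "is_arc S \<gamma>'" "\<forall>\<^sub>F t in at_right 0. \<gamma> t = \<gamma>' t"
  shows "\<exists>b>0. \<forall>t. 0 \<le> t \<and> t < b \<longrightarrow> \<gamma> t = \<gamma>' t"
proof -
  obtain b where b: "b > 0" "\<And>t. 0 < t \<Longrightarrow> t < b \<Longrightarrow> \<gamma> t = \<gamma>' t"
    using assms(3) unfolding eventually_at_right_field by blast
  have "\<gamma> t = \<gamma>' t" if "0 \<le> t" "t < b" for t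
    using that b(2)[of t] is_arc_0[OF assms(1)] is_arc_0[OF assms(2)] by (cases "t = 0") auto
  then show ?thesis using b(1) by blast
qed

locale triangle_chain = polynomially_bounded_o_minimal_structure S
  for S :: "nat \<Rightarrow> real list set set" +
  fixes T :: "'a::euclidean_space set" and n :: nat and Ts :: "nat \<Rightarrow> 'a set" and ls :: "nat \<Rightarrow> real \<Rightarrow> 'a"
  assumes n: "1 \<le> n"
    and germ: "germ_eq T (\<Union>i\<in>{1..n}. Ts i)"
    and triangles: "\<And>i. i \<in> {1..n} \<Longrightarrow> holder_triangle_arcs S (Ts i) (ls (i - 1)) (ls i)"
    and embedded: "\<And>i. i \<in> {1..n} \<Longrightarrow> normally_embedded (Ts i)"
    and transversal: "\<And>i j. i \<in> {1..n} \<Longrightarrow> j \<in> {1..n} \<Longrightarrow> i \<noteq> j \<Longrightarrow> transverse S (Ts i) (Ts j)"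
    and tord_min: "\<And>i k j. i < k \<Longrightarrow> k < j \<Longrightarrow> j \<le> n \<Longrightarrow>
      tord (ls i) (ls j) = min (tord (ls i) (ls k)) (tord (ls k) (ls j))"
begin

lemma germ_radius: "\<exists>r>0. \<forall>x. norm x < r \<longrightarrow> (x \<in> T \<longleftrightarrow> (\<exists>i\<in>{1..n}. x \<in> Ts i))"
  using germ_eqD[OF germ] by simp

lemma triangle_short_joins:
  assumes "i \<in> {1..n}" shows "\<exists>K>0. \<exists>b>0. short_joins T (Ts i) (Ts i) K b"
proof -
  obtain r where "r > 0" "\<And>x. norm x < r \<Longrightarrow> x \<in> T \<longleftrightarrow> (\<exists>i\<in>{1..n}. x \<in> Ts i)" using germ_radius by blast
  then show ?thesis using normally_embedded_short_joins[OF embedded[OF assms], of r T] assms by blast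
qed

lemma ls_arc: assumes "i \<le> n" shows "is_arc S (ls i)"
proof (cases "i = 0")
  case True
  then show ?thesis using holder_triangle_arcsD(2)[OF triangles[of 1]] n by simp
next
  case False
  then show ?thesis using holder_triangle_arcsD(3)[OF triangles[of i]] assms by simp
qed

lemma ls_in_triangle:
  assumes "i \<in> {1..n}" "a = i - 1 \<or> a = i"
  shows "\<exists>b>0. \<forall>t. 0 \<le> t \<and> t < b \<longrightarrow> ls a t \<in> Ts i \<and> norm (ls a t) = t"
  using assms(2) holder_triangle_arcsD[OF triangles[OF assms(1)]] arc_in_small by blast

lemma tord_le_consecutive:
  assumes "i \<le> m" "m < j" "j \<le> n" shows "tord (ls i) (ls j) \<le> tord (ls m) (ls (Suc m))"
proof -
  have "tord (ls i) (ls j) \<le> tord (ls i) (ls (Suc m))"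
  proof (cases "Suc m = j")
    case False
    then show ?thesis using tord_min[of i "Suc m" j] assms by simp
  qed simp
  also have "\<dots> \<le> tord (ls m) (ls (Suc m))"
  proof (cases "i = m")
    case False
    then show ?thesis using tord_min[of i m "Suc m"] assms by simp
  qed simp
  finally show ?thesis .
qed

text \<open>By the condition on the tangency orders, the points at distance \<open>t\<close> from the origin on two
  consecutive arcs between \<open>ls i\<close> and \<open>ls j\<close> are not farther apart than those on \<open>ls i\<close> and \<open>ls j\<close>,
  up to a constant. They are joined within the triangle between the two arcs.\<close>

lemma arcs_short_path:
  assumes "i \<le> j" "j \<le> n"
  shows "\<exists>K>0. \<exists>b>0. \<forall>t. 0 \<le> t \<and> t < b \<longrightarrow> short_path T (K * norm (ls i t - ls j t)) (ls i t) (ls j t)"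
proof -
  have "\<exists>K>0. \<exists>b>0. \<forall>t. 0 \<le> t \<and> t < b \<longrightarrow> short_path T (K * norm (ls i t - ls j t)) (ls i t) (ls m t)"
    if "i \<le> m" "m \<le> j" for m
    using that
  proof (induction m rule: dec_induct)
    case base
    obtain r where r: "r > 0" "\<And>x. norm x < r \<Longrightarrow> x \<in> T \<longleftrightarrow> (\<exists>i\<in>{1..n}. x \<in> Ts i)" using germ_radius by blast
    define k where "k = (if i = 0 then 1 else i)"
    have k: "k \<in> {1..n}" "i = k - 1 \<or> i = k" using assms n unfolding k_def by auto
    obtain b where b: "b > 0" "\<And>t. 0 \<le> t \<Longrightarrow> t < b \<Longrightarrow> ls i t \<in> Ts k \<and> norm (ls i t) = t"
      using ls_in_triangle[OF k] by blast
    have "ls i t \<in> T" if "0 \<le> t" "t < min b r" for t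
      using b(2)[of t] r(2)[of "ls i t"] that k(1) by auto
    then have "\<forall>t. 0 \<le> t \<and> t < min b r \<longrightarrow> short_path T (1 * norm (ls i t - ls j t)) (ls i t) (ls i t)"
      using short_path_refl by blast
    moreover have "0 < min b r" using b(1) r(1) by simp
    ultimately show ?case using zero_less_one by blast
  next
    case (step m)
    obtain K b where IH: "K > 0" "b > 0"
      "\<And>t. 0 \<le> t \<Longrightarrow> t < b \<Longrightarrow> short_path T (K * norm (ls i t - ls j t)) (ls i t) (ls m t)"
      using step by auto
    have m: "Suc m \<in> {1..n}" using step assms by auto
    obtain K1 b1 where K1: "K1 > 0" "b1 > 0" "short_joins T (Ts (Suc m)) (Ts (Suc m)) K1 b1"
      using triangle_short_joins[OF m] by blast
    obtain b2 where b2: "b2 > 0" "\<And>t. 0 \<le> t \<Longrightarrow> t < b2 \<Longrightarrow> ls m t \<in> Ts (Suc m) \<and> norm (ls m t) = t"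
      using ls_in_triangle[OF m, of m] by auto
    obtain b3 where b3: "b3 > 0" "\<And>t. 0 \<le> t \<Longrightarrow> t < b3 \<Longrightarrow> ls (Suc m) t \<in> Ts (Suc m) \<and> norm (ls (Suc m) t) = t"
      using ls_in_triangle[OF m, of "Suc m"] by auto
    have arcs: "is_arc S (ls i)" "is_arc S (ls j)" "is_arc S (ls m)" "is_arc S (ls (Suc m))"
      using step assms by (auto intro!: ls_arc)
    have "tord (ls i) (ls j) \<le> tord (ls m) (ls (Suc m))" by (rule tord_le_consecutive) (use step assms in auto)
    from norm_le_of_tord_le[OF arcs this]
    obtain C b4 where C: "C > 0" "b4 > 0"
      "\<And>t. 0 < t \<Longrightarrow> t < b4 \<Longrightarrow> norm (ls m t - ls (Suc m) t) \<le> C * norm (ls i t - ls j t)"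
      unfolding eventually_at_right_field by blast
    define c where "c = min (min b b1) (min b2 (min b3 b4))"
    have c: "0 < c" "c \<le> b" "c \<le> b1" "c \<le> b2" "c \<le> b3" "c \<le> b4"
      using IH(2) K1(2) b2(1) b3(1) C(2) unfolding c_def by auto
    have "short_path T ((K + K1 * C) * norm (ls i t - ls j t)) (ls i t) (ls (Suc m) t)" if t: "0 \<le> t" "t < c" for t
    proof -
      let ?d = "norm (ls i t - ls j t)"
      have C': "norm (ls m t - ls (Suc m) t) \<le> C * ?d"
      proof (cases "t = 0")
        case True
        then show ?thesis using arcs is_arc_0 by (simp add: is_arc_0)
      next
        case False
        then show ?thesis using C(3)[of t] t c by auto
      qed
      have "short_path T (K1 * norm (ls m t - ls (Suc m) t)) (ls m t) (ls (Suc m) t)"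
        by (rule short_joinsD[OF K1(3)]) (use b2(2)[of t] b3(2)[of t] t c in auto)
      moreover have "K1 * norm (ls m t - ls (Suc m) t) \<le> K1 * C * ?d"
        using mult_left_mono[OF C', of K1] K1(1) by (simp add: mult.assoc)
      ultimately have "short_path T (K1 * C * ?d) (ls m t) (ls (Suc m) t)" by (rule short_path_mono)
      moreover have "short_path T (K * ?d) (ls i t) (ls m t)" using IH(3)[of t] t c by auto
      ultimately have "short_path T (K * ?d + K1 * C * ?d) (ls i t) (ls (Suc m) t)"
        using IH(1) K1(1) C(1) by (intro short_path_trans) auto
      then show ?thesis by (simp add: algebra_simps)
    qed
    moreover have "0 < K + K1 * C" using IH(1) K1(1) C(1) by (simp add: add_pos_pos)
    ultimately show ?case using c(1) by blast
  qed
  from this[OF assms(1) order_refl] show ?thesis .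
qed

text \<open>Let \<open>\<mu>\<close> and \<open>\<mu>'\<close> be the arcs which witness transversality; they are \<open>ls a\<close> and \<open>ls a'\<close>. The points
  of norm \<open>norm x\<close> on these arcs serve as intermediate stations between \<open>x\<close> and \<open>y\<close>.\<close>

lemma transverse_short_joins:
  assumes i: "i \<in> {1..n}" and j: "j \<in> {1..n}" and ij: "i < j"
  shows "\<exists>K>0. \<exists>b>0. short_joins T (Ts i) (Ts j) K b"
proof -
  have "transverse S (Ts i) (Ts j)" using transversal[OF i j] ij by simp
  then obtain \<mu> \<mu>' where bd: "boundary_arc S (Ts i) \<mu>" "boundary_arc S (Ts j) \<mu>'"
    and t1: "\<And>\<gamma>. is_arc S \<gamma> \<Longrightarrow> arc_in \<gamma> (Ts j) \<Longrightarrow> tord \<mu> \<gamma> = tord_set S \<gamma> (Ts i)"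
    and t2: "\<And>\<gamma>. is_arc S \<gamma> \<Longrightarrow> arc_in \<gamma> (Ts i) \<Longrightarrow> tord \<mu>' \<gamma> = tord_set S \<gamma> (Ts j)"
    unfolding transverse_def by blast
  note \<mu> = boundary_arc_is_arc[OF bd(1)] and \<mu>' = boundary_arc_is_arc[OF bd(2)]
  obtain a where a: "a = i - 1 \<or> a = i" "\<forall>\<^sub>F t in at_right 0. \<mu> t = ls a t"
    using boundary_arc_cases[OF triangles[OF i] bd(1)] by blast
  obtain a' where a': "a' = j - 1 \<or> a' = j" "\<forall>\<^sub>F t in at_right 0. \<mu>' t = ls a' t"
    using boundary_arc_cases[OF triangles[OF j] bd(2)] by blast
  have aa': "a \<le> a'" "a' \<le> n" "a \<le> n" using a(1) a'(1) i j ij by auto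
  obtain b1 where b1: "b1 > 0" "\<And>t. 0 \<le> t \<Longrightarrow> t < b1 \<Longrightarrow> \<mu> t = ls a t"
    using eventually_arcs_eq[OF \<mu> ls_arc[OF aa'(3)] a(2)] by blast
  obtain b2 where b2: "b2 > 0" "\<And>t. 0 \<le> t \<Longrightarrow> t < b2 \<Longrightarrow> \<mu>' t = ls a' t"
    using eventually_arcs_eq[OF \<mu>' ls_arc[OF aa'(2)] a'(2)] by blast
  note Ti = holder_triangle_arcsD(1)[OF triangles[OF i]] and Tj = holder_triangle_arcsD(1)[OF triangles[OF j]]
  obtain C1 b3 where C1: "C1 > 0" "b3 > 0"
    "\<And>x y. x \<in> Ts i \<Longrightarrow> y \<in> Ts j \<Longrightarrow> norm x < b3 \<Longrightarrow> norm y < b3 \<Longrightarrow> norm (y - \<mu> (norm y)) \<le> C1 * norm (y - x)"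
    using dist_arc_le[OF Tj Ti \<mu> t1] by blast
  obtain C2 b4 where C2: "C2 > 0" "b4 > 0"
    "\<And>x y. x \<in> Ts i \<Longrightarrow> y \<in> Ts j \<Longrightarrow> norm x < b4 \<Longrightarrow> norm y < b4 \<Longrightarrow> norm (x - \<mu>' (norm x)) \<le> C2 * norm (x - y)"
    using dist_arc_le[OF Ti Tj \<mu>' t2] by blast
  obtain b5 where b5: "b5 > 0" "\<And>t. 0 \<le> t \<Longrightarrow> t < b5 \<Longrightarrow> ls a t \<in> Ts i \<and> norm (ls a t) = t"
    using ls_in_triangle[OF i a(1)] by blast
  obtain b6 where b6: "b6 > 0" "\<And>t. 0 \<le> t \<Longrightarrow> t < b6 \<Longrightarrow> ls a' t \<in> Ts j \<and> norm (ls a' t) = t"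
    using ls_in_triangle[OF j a'(1)] by blast
  obtain K1 b7 where K1: "K1 > 0" "b7 > 0" "short_joins T (Ts i) (Ts i) K1 b7" using triangle_short_joins[OF i] by blast
  obtain K2 b8 where K2: "K2 > 0" "b8 > 0"
    "\<And>t. 0 \<le> t \<Longrightarrow> t < b8 \<Longrightarrow> short_path T (K2 * norm (ls a t - ls a' t)) (ls a t) (ls a' t)"
    using arcs_short_path[OF aa'(1,2)] by blast
  obtain K3 b9 where K3: "K3 > 0" "b9 > 0" "short_joins T (Ts j) (Ts j) K3 b9" using triangle_short_joins[OF j] by blast
  define c where "c = Min {b1, b2, b3, b4, b5, b6, b7, b8, b9}"
  have c_le: "c \<le> b" if "b \<in> {b1, b2, b3, b4, b5, b6, b7, b8, b9}" for b
    unfolding c_def using that by (intro Min_le finite.intros)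
  have c_pos: "0 < c"
    unfolding c_def using b1(1) b2(1) C1(2) C2(2) b5(1) b6(1) K1(2) K2(2) K3(2) by (subst Min_gr_iff) simp_all
  have c: "0 < c" "c \<le> b1" "c \<le> b2" "c \<le> b3" "c \<le> b4" "c \<le> b5" "c \<le> b6" "c \<le> b7" "c \<le> b8" "c \<le> b9"
    by (rule c_pos) (rule c_le; simp)+
  define K where "K = K1 * (C2 + C1 * C2) + K2 * (C1 * C2) + K3 * (C2 + 1)"
  have "0 < K" using K1(1) K2(1) K3(1) C1(1) C2(1) unfolding K_def by (intro add_pos_pos mult_pos_pos) auto
  moreover have "short_joins T (Ts i) (Ts j) K c" unfolding short_joins_def
  proof (intro ballI impI)
    fix x y assume x: "x \<in> Ts i" and y: "y \<in> Ts j" and small: "norm x < c \<and> norm y < c"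
    define t where "t = norm x"
    define p where "p = ls a t"
    define p' where "p' = ls a' t"
    let ?d = "norm (x - y)"
    have t: "0 \<le> t" "t < c" using small unfolding t_def by auto
    have p: "p \<in> Ts i" "norm p = t" "\<mu> t = p" using b5(2)[of t] b1(2)[of t] t c unfolding p_def by auto
    have p': "p' \<in> Ts j" "norm p' = t" "\<mu>' t = p'" using b6(2)[of t] b2(2)[of t] t c unfolding p'_def by auto
    have d1: "norm (x - p') \<le> C2 * ?d" using C2(3)[OF x y] small c p'(3) unfolding t_def by auto
    have "norm (p' - p) \<le> C1 * norm (p' - x)" using C1(3)[OF x p'(1)] t c p(3) p'(2) small by auto
    also have "\<dots> \<le> C1 * (C2 * ?d)" using d1 C1(1) by (simp add: norm_minus_commute)
    finally have d2: "norm (p - p') \<le> C1 * C2 * ?d" by (simp add: norm_minus_commute mult.assoc)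
    have "norm (x - p) \<le> norm (x - p') + norm (p' - p)" using norm_triangle_ineq[of "x - p'" "p' - p"] by simp
    then have d3: "norm (x - p) \<le> (C2 + C1 * C2) * ?d" using d1 d2 by (simp add: norm_minus_commute algebra_simps)
    have "norm (p' - y) \<le> norm (p' - x) + norm (x - y)" using norm_triangle_ineq[of "p' - x" "x - y"] by simp
    then have d4: "norm (p' - y) \<le> (C2 + 1) * ?d" using d1 by (simp add: norm_minus_commute algebra_simps)
    have "short_path T (K1 * norm (x - p)) x p"
      by (rule short_joinsD[OF K1(3)]) (use x p t c small in auto)
    then have s1: "short_path T (K1 * ((C2 + C1 * C2) * ?d)) x p"
      by (rule short_path_mono) (use d3 K1(1) in simp)
    have "short_path T (K2 * norm (p - p')) p p'" using K2(3)[of t] t c unfolding p_def p'_def by auto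
    then have s2: "short_path T (K2 * (C1 * C2 * ?d)) p p'"
      by (rule short_path_mono) (use d2 K2(1) in simp)
    have "short_path T (K3 * norm (p' - y)) p' y"
      by (rule short_joinsD[OF K3(3)]) (use y p' t c small in auto)
    then have s3: "short_path T (K3 * ((C2 + 1) * ?d)) p' y"
      by (rule short_path_mono) (use d4 K3(1) in simp)
    have nonneg: "0 \<le> K1 * ((C2 + C1 * C2) * ?d)" "0 \<le> K2 * (C1 * C2 * ?d)" "0 \<le> K3 * ((C2 + 1) * ?d)"
      using K1(1) K2(1) K3(1) C1(1) C2(1) by auto
    have "short_path T (K1 * ((C2 + C1 * C2) * ?d) + K2 * (C1 * C2 * ?d) + K3 * ((C2 + 1) * ?d)) x y"
      by (rule short_path_trans[OF short_path_trans[OF s1 s2] s3]) (use nonneg in auto)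
    then show "short_path T (K * ?d) x y" unfolding K_def by (simp add: algebra_simps)
  qed
  ultimately show ?thesis using c(1) by blast
qed

lemma normally_embedded_T: "normally_embedded T"
proof -
  obtain r where r: "r > 0" "\<And>x. norm x < r \<Longrightarrow> x \<in> T \<longleftrightarrow> (\<exists>i\<in>{1..n}. x \<in> Ts i)" using germ_radius by blast
  have "\<exists>K>0. \<exists>b>0. \<forall>q\<in>{1..n} \<times> {1..n}. short_joins T (Ts (fst q)) (Ts (snd q)) K b"
  proof (rule uniform_constants)
    fix q assume "q \<in> {1..n} \<times> {1..n}"
    then have q: "fst q \<in> {1..n}" "snd q \<in> {1..n}" by auto
    consider "fst q = snd q" | "fst q < snd q" | "snd q < fst q" by linarith
    then show "\<exists>K>0. \<exists>b>0. short_joins T (Ts (fst q)) (Ts (snd q)) K b"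
    proof cases
      case 1 then show ?thesis using triangle_short_joins[OF q(1)] by simp
    next
      case 2 then show ?thesis using transverse_short_joins[OF q] by blast
    next
      case 3 then show ?thesis using transverse_short_joins[OF q(2,1)] short_joins_commute by blast
    qed
  next
    show "short_joins T (Ts (fst q)) (Ts (snd q)) K' b'"
      if "short_joins T (Ts (fst q)) (Ts (snd q)) K b" "K \<le> K'" "b' \<le> b" for q K K' b b'
      using that by (rule short_joins_mono)
  qed simp
  then obtain K b where K: "K > 0" "b > 0"
    "\<And>i j. i \<in> {1..n} \<Longrightarrow> j \<in> {1..n} \<Longrightarrow> short_joins T (Ts i) (Ts j) K b" by auto
  show ?thesis
  proof (rule normally_embeddedI)
    show "0 < K" by (rule K(1))
    show "0 < min b r" using K(2) r(1) by simp
    fix x y assume xy: "x \<in> T" "y \<in> T" "norm x < min b r" "norm y < min b r"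
    obtain i where "i \<in> {1..n}" "x \<in> Ts i" using r(2)[of x] xy by auto
    moreover obtain j where "j \<in> {1..n}" "y \<in> Ts j" using r(2)[of y] xy by auto
    ultimately show "short_path T (K * norm (x - y)) x y" using short_joinsD[OF K(3)] xy by auto
  qed
qed

end

theorem proposition2p12:
  fixes S :: "nat \<Rightarrow> real list set set" and T :: "(real ^ 'n) set"
  assumes "polynomially_bounded_o_minimal_structure S"
    and "holder_triangle S T"
    and "combinatorially_normally_embedded S T"
  shows "normally_embedded T"
proof -
  interpret polynomially_bounded_o_minimal_structure S by (rule assms(1))
  obtain n :: nat and Ts :: "nat \<Rightarrow> (real ^ 'n) set" and ls :: "nat \<Rightarrow> real \<Rightarrow> real ^ 'n"
    where n: "1 \<le> n" and germ: "germ_eq T (\<Union>i\<in>{1..n}. Ts i)"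
    and triangles: "\<forall>i\<in>{1..n}. holder_triangle_arcs S (Ts i) (ls (i - 1)) (ls i) \<and> normally_embedded (Ts i)"
    and "\<forall>i\<in>{1..<n}. germ_eq (Ts i \<inter> Ts (i + 1)) (arc_image (ls i))"
    and transverse: "\<forall>i\<in>{1..n}. \<forall>j\<in>{1..n}. i \<noteq> j \<longrightarrow> transverse S (Ts i) (Ts j)"
    and tord: "\<forall>i k j. i < k \<and> k < j \<and> j \<le> n \<longrightarrow>
      tord (ls i) (ls j) = min (tord (ls i) (ls k)) (tord (ls k) (ls j))"
    using assms(3) unfolding combinatorially_normally_embedded_def by (elim exE conjE)
  interpret triangle_chain S T n Ts ls
  proof unfold_locales
    show "1 \<le> n" "germ_eq T (\<Union>i\<in>{1..n}. Ts i)" by (rule n germ)+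
    fix i j k :: nat
    show "holder_triangle_arcs S (Ts i) (ls (i - 1)) (ls i)" "normally_embedded (Ts i)" if "i \<in> {1..n}"
      using bspec[OF triangles that] by auto
    show "transverse S (Ts i) (Ts j)" if "i \<in> {1..n}" "j \<in> {1..n}" "i \<noteq> j"
      using transverse that by simp
    show "tord (ls i) (ls j) = min (tord (ls i) (ls k)) (tord (ls k) (ls j))" if "i < k" "k < j" "j \<le> n"
      using tord that by simp
  qed
  show ?thesis by (rule normally_embedded_T)
qed

end
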